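(* Let $d\ge 2$, $0<a<b<\infty$ and $L>1$, and let $H_L^2(\mathcal{A}_{a,b})$ be the polyharmonic Hardy space on the complexified annulus $\mathcal{A}_{a,b}=\mathbb{A}_{a,b}\times\mathbb{S}^{d-1}$, with norm $\|\cdot\|_{H_L^2(\mathcal{A}_{a,b})}$. Then: 1. The space $H_L^2(\mathcal{A}_{a,b})$ is complete with respect to $\|\cdot\|_{H_L^2(\mathcal{A}_{a,b})}$ (hence it is a Hilbert space). 2. (Maximum principle) For every compact set $K\subset\mathcal{A}_{a,b}$ there exists a constant $C>0$ such that for every $f\in H_L^2(\mathcal{A}_{a,b})$ $$|f(z,\theta)|\le \frac{C}{\min\left(1-|z|/b,\ |z|/a-1\right)}\,\|f\|_{H_L^2(\mathcal{A}_{a,b})}\qquad\text{for all }(z,\theta)\in K .$$ 3. If $f\in H_L^2(\mathcal{A}_{a,b})$, then $f\in C^\infty(\mathcal{A}_{a,b})$.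
   Context: $\mathbb{A}_{a,b}=\{z\in\mathbb{C}:a<|z|<b\}$; $\mathbb{S}^{d-1}$ is the unit sphere of $\mathbb{R}^d$ with rotation invariant measure $d\theta$; $\mathcal{A}_{a,b}=\{(z,\theta):a<|z|<b,\ \theta\in\mathbb{S}^{d-1}\}$. $\mathcal{H}_k(\mathbb{R}^d)$ is the space of homogeneous harmonic polynomials of degree $k$ on $\mathbb{R}^d$, $a_k=\dim\mathcal{H}_k(\mathbb{R}^d)$, and $Y_{k,\ell}$, $\ell=1,\dots,a_k$, are real-valued and form an orthonormal basis of $\mathcal{H}_k(\mathbb{R}^d)$ for $\langle f,g\rangle=\int_{\mathbb{S}^{d-1}}f\bar g\,d\theta$. Sums $\sum_{k,\ell}$ run over $k\ge 0$, $1\le\ell\le a_k$. $H^2(\mathbb{A}_{a,b})$ is the classical Hardy space of analytic functions $f$ on $\mathbb{A}_{a,b}$ with $\sup_{a<r<b}\frac1{2\pi}\int_0^{2\pi}|f(re^{i\varphi})|^2d\varphi<\infty$. Such $f$ has boundary values $f^*$ in $L_2$ on the two circles $|z|=a$ and $|z|=b$, and the inner product is $\langle f,g\rangle_{H^2(\mathbb{A}_{a,b})}=\frac1{2\pi}\int_0^{2\pi}f^*(ae^{i\varphi})\overline{g^*(ae^{i\varphi})}d\varphi+\frac1{2\pi}\int_0^{2\pi}f^*(be^{i\varphi})\overline{g^*(be^{i\varphi})}d\varphi$. For $k\ge 0$ the component Hardy space $H^{2,k}(\mathbb{A}_{a,b})$ is the closure in $H^2(\mathbb{A}_{a,b})$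 of $V_{k,d}=\operatorname{span}\{z^{k+2j},\ z^{-d-k+2+2j}: j=0,1,2,\dots\}$. $H_L^2(\mathcal{A}_{a,b})$ consists of all functions $f(z,\theta)=\sum_{k,\ell}f_{k,\ell}(z)Y_{k,\ell}(\theta)$ with $f_{k,\ell}\in H^{2,k}(\mathbb{A}_{a,b})$ and $\|f\|_{H_L^2}^2:=\sum_{k,\ell}\|f_{k,\ell}\|_{H^2(\mathbb{A}_{a,b})}^2L^{2k}<\infty$; the inner product is $\langle f,g\rangle_{H_L^2}=\sum_{k,\ell}\langle f_{k,\ell},g_{k,\ell}\rangle_{H^2(\mathbb{A}_{a,b})}L^{2k}$. The value $f(z,\theta)$ is the sum of the series. *)

theory Defs
  imports "HOL-Analysis.Analysis" "HOL-Complex_Analysis.Complex_Analysis"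
    "HOL-Library.Function_Algebras"
begin

section \<open>Complex vector spaces of functions\<close>

global_interpretation cfun: vector_space "\<lambda>(c::complex) (f::'a \<Rightarrow> complex) x. c * f x"
  by unfold_locales (auto simp: fun_eq_iff algebra_simps)

definition complex_inner_product_space ::
    "('a \<Rightarrow> complex) set \<Rightarrow> (('a \<Rightarrow> complex) \<Rightarrow> ('a \<Rightarrow> complex) \<Rightarrow> complex) \<Rightarrow> bool" where
  "complex_inner_product_space V ip \<longleftrightarrow>
     cfun.subspace V \<and>
     (\<forall>f\<in>V. \<forall>g\<in>V. \<forall>h\<in>V. ip (f + g) h = ip f h + ip g h) \<and>
     (\<forall>c. \<forall>f\<in>V. \<forall>g\<in>V. ip (\<lambda>x. c * f x) g = c * ip f g) \<and>
     (\<forall>f\<in>V. \<forall>g\<in>V. ip g f = cnj (ip f g)) \<and>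
     (\<forall>f\<in>V. f \<noteq> 0 \<longrightarrow> ip f f \<in> \<real> \<and> 0 < Re (ip f f))"

definition complete_wrt :: "('a \<Rightarrow> complex) set \<Rightarrow> (('a \<Rightarrow> complex) \<Rightarrow> real) \<Rightarrow> bool" where
  "complete_wrt V nrm \<longleftrightarrow>
     (\<forall>u :: nat \<Rightarrow> 'a \<Rightarrow> complex.
        (\<forall>n. u n \<in> V) \<and> (\<forall>\<epsilon>>0. \<exists>N. \<forall>m\<ge>N. \<forall>n\<ge>N. nrm (u m - u n) < \<epsilon>) \<longrightarrow>
        (\<exists>f\<in>V. (\<lambda>n. nrm (u n - f)) \<longlonglongrightarrow> 0))"

definition hilbert_space ::
    "('a \<Rightarrow> complex) set \<Rightarrow> (('a \<Rightarrow> complex) \<Rightarrow> ('a \<Rightarrow> complex) \<Rightarrow> complex)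
       \<Rightarrow> (('a \<Rightarrow> complex) \<Rightarrow> real) \<Rightarrow> bool" where
  "hilbert_space V ip nrm \<longleftrightarrow>
     complex_inner_product_space V ip \<and> (\<forall>f\<in>V. nrm f = sqrt (Re (ip f f))) \<and> complete_wrt V nrm"

section \<open>Smooth functions\<close>

text \<open>Only used for open \<open>U\<close>.\<close>

fun C_k_on :: "nat \<Rightarrow> ('a::euclidean_space \<Rightarrow> 'b::real_normed_vector) \<Rightarrow> 'a set \<Rightarrow> bool" where
  "C_k_on 0 f U \<longleftrightarrow> continuous_on U f"
| "C_k_on (Suc k) f U \<longleftrightarrow>
     f differentiable_on U \<and> (\<forall>v\<in>Basis. C_k_on k (\<lambda>x. frechet_derivative f (at x) v) U)"

text \<open>Smoothness on a subset of a Euclidean space (here an embedded submanifold): local existence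
  of smooth extensions to open subsets of the ambient space.\<close>

definition smooth_on :: "('a::euclidean_space \<Rightarrow> 'b::real_normed_vector) \<Rightarrow> 'a set \<Rightarrow> bool" where
  "smooth_on f S \<longleftrightarrow>
     (\<forall>p\<in>S. \<exists>U g. open U \<and> p \<in> U \<and> (\<forall>k. C_k_on k g U) \<and> (\<forall>q\<in>U \<inter> S. g q = f q))"

section \<open>Spherical harmonics\<close>

text \<open>The standard surface measure on the unit sphere, obtained from Lebesgue measure on the unit
  ball by polar coordinates: the surface measure of \<open>E\<close> is \<open>d\<close> times the volume of the
  cone \<open>{x. 0 < |x| \<le> 1, x/|x| \<in> E}\<close>.\<close>

definition sphere_measure :: "(real^'d) measure" where
  "sphere_measure =
     scale_measure (of_nat CARD('d))
       (distr (restrict_space lborel (cball 0 1 - {0})) (restrict_space borel (sphere 0 1)) sgn)"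

definition sphere_inner :: "(real^'d \<Rightarrow> complex) \<Rightarrow> (real^'d \<Rightarrow> complex) \<Rightarrow> complex" where
  "sphere_inner f g = (LINT \<theta>|sphere_measure. f \<theta> * cnj (g \<theta>))"

definition partial_deriv ::
    "'a::euclidean_space \<Rightarrow> ('a \<Rightarrow> complex) \<Rightarrow> 'a \<Rightarrow> complex" where
  "partial_deriv v f x = vector_derivative (\<lambda>t. f (x + t *\<^sub>R v)) (at 0)"

definition laplacian :: "('a::euclidean_space \<Rightarrow> complex) \<Rightarrow> 'a \<Rightarrow> complex" where
  "laplacian f x = (\<Sum>v\<in>Basis. partial_deriv v (partial_deriv v f) x)"

definition harmonic_polys :: "nat \<Rightarrow> (real^'d \<Rightarrow> complex) set" where
  "harmonic_polys k =
     {p. polynomial_function p \<and> (\<forall>t x. p (t *\<^sub>R x) = of_real t ^ k * p x) \<and>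
         (\<forall>x. laplacian p x = 0)}"

definition harmonic_dim :: "'d::finite itself \<Rightarrow> nat \<Rightarrow> nat" where
  "harmonic_dim _ k = cfun.dim (harmonic_polys k :: (real^'d \<Rightarrow> complex) set)"

text \<open>Real-valued functions \<open>Y k l\<close> with \<open>1 \<le> l \<le> a\<^sub>k\<close>, for each \<open>k\<close> an orthonormal basis of the
  homogeneous harmonic polynomials of degree \<open>k\<close>; values of \<open>Y\<close> at other \<open>l\<close> are irrelevant.\<close>

definition harmonic_onb :: "(nat \<Rightarrow> nat \<Rightarrow> real^'d \<Rightarrow> real) \<Rightarrow> bool" where
  "harmonic_onb Y \<longleftrightarrow>
     (\<forall>k. let I = {1..harmonic_dim TYPE('d) k};
              e = (\<lambda>l x. complex_of_real (Y k l x))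
          in cfun.span (e ` I) = harmonic_polys k \<and>
             (\<forall>l\<in>I. \<forall>m\<in>I. sphere_inner (e l) (e m) = (if l = m then 1 else 0)))"

section \<open>The Hardy space of the annulus\<close>

definition annulus :: "real \<Rightarrow> real \<Rightarrow> complex set" where
  "annulus a b = {z. a < cmod z \<and> cmod z < b}"

definition angle_mean :: "(real \<Rightarrow> 'b::{banach,second_countable_topology}) \<Rightarrow> 'b" where
  "angle_mean u = (1 / (2 * pi)) *\<^sub>R (LINT \<phi>:{0..2 * pi}|lborel. u \<phi>)"

text \<open>Only the values on the annulus matter; the inner product below depends only on them.\<close>

definition H2 :: "real \<Rightarrow> real \<Rightarrow> (complex \<Rightarrow> complex) set" where
  "H2 a b = {f. f holomorphic_on annulus a b \<and>
     bdd_above ((\<lambda>r. angle_mean (\<lambda>\<phi>. (cmod (f (rcis r \<phi>)))\<^sup>2)) ` {a<..<b})}"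

text \<open>Boundary values on the circle of radius \<open>s\<close> (\<open>s = a\<close> or \<open>s = b\<close>), as functions of the angle:
  the square integrable limit of \<open>\<phi> \<mapsto> f (r e\<^sup>i\<^sup>\<phi>)\<close> in the \<open>L\<^sub>2\<close> sense as
  \<open>r\<close> tends to \<open>s\<close> inside \<open>(a, b)\<close>. It is determined up to a null set.\<close>

definition is_boundary_value ::
    "real \<Rightarrow> real \<Rightarrow> (complex \<Rightarrow> complex) \<Rightarrow> real \<Rightarrow> (real \<Rightarrow> complex) \<Rightarrow> bool" where
  "is_boundary_value a b f s h \<longleftrightarrow>
     set_borel_measurable lborel {0..2 * pi} h \<and>
     set_integrable lborel {0..2 * pi} (\<lambda>\<phi>. (cmod (h \<phi>))\<^sup>2) \<and>
     ((\<lambda>r. angle_mean (\<lambda>\<phi>. (cmod (f (rcis r \<phi>) - h \<phi>))\<^sup>2)) \<longlongrightarrow> 0) (at s within {a<..<b})"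

definition boundary_value ::
    "real \<Rightarrow> real \<Rightarrow> (complex \<Rightarrow> complex) \<Rightarrow> real \<Rightarrow> real \<Rightarrow> complex" where
  "boundary_value a b f s = (SOME h. is_boundary_value a b f s h)"

definition H2_inner ::
    "real \<Rightarrow> real \<Rightarrow> (complex \<Rightarrow> complex) \<Rightarrow> (complex \<Rightarrow> complex) \<Rightarrow> complex" where
  "H2_inner a b f g =
     angle_mean (\<lambda>\<phi>. boundary_value a b f a \<phi> * cnj (boundary_value a b g a \<phi>)) +
     angle_mean (\<lambda>\<phi>. boundary_value a b f b \<phi> * cnj (boundary_value a b g b \<phi>))"

definition H2_norm :: "real \<Rightarrow> real \<Rightarrow> (complex \<Rightarrow> complex) \<Rightarrow> real" where
  "H2_norm a b f = sqrt (Re (H2_inner a b f f))"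

definition V_space :: "nat \<Rightarrow> nat \<Rightarrow> (complex \<Rightarrow> complex) set" where
  "V_space d k = cfun.span
     (range (\<lambda>j z. z ^ (k + 2 * j)) \<union>
      range (\<lambda>j z. z powi (- int d - int k + 2 + 2 * int j)))"

text \<open>The component space: the norm closure of \<open>V_space d k\<close> in \<open>H2 a b\<close>.\<close>

definition H2_component :: "nat \<Rightarrow> real \<Rightarrow> real \<Rightarrow> nat \<Rightarrow> (complex \<Rightarrow> complex) set" where
  "H2_component d a b k =
     {f \<in> H2 a b. \<forall>\<epsilon>>0. \<exists>g\<in>V_space d k. H2_norm a b (f - g) < \<epsilon>}"

section \<open>The polyharmonic Hardy space\<close>

definition cannulus :: "real \<Rightarrow> real \<Rightarrow> (complex \<times> (real^'d)) set" where
  "cannulus a b = annulus a b \<times> sphere 0 1"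

definition harmonic_index :: "'d::finite itself \<Rightarrow> (nat \<times> nat) set" where
  "harmonic_index _ = {(k, l). 1 \<le> l \<and> l \<le> harmonic_dim TYPE('d) k}"

text \<open>\<open>F\<close> is a family of coefficients of \<open>f\<close>. Sums over \<open>(k, l)\<close> are unconditional.\<close>

definition is_expansion ::
    "(nat \<Rightarrow> nat \<Rightarrow> real^'d \<Rightarrow> real) \<Rightarrow> real \<Rightarrow> real \<Rightarrow> real \<Rightarrow> (complex \<times> (real^'d) \<Rightarrow> complex)
       \<Rightarrow> (nat \<Rightarrow> nat \<Rightarrow> complex \<Rightarrow> complex) \<Rightarrow> bool" where
  "is_expansion Y a b L f F \<longleftrightarrow>
     (\<forall>(k, l)\<in>harmonic_index TYPE('d). F k l \<in> H2_component CARD('d) a b k) \<and>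
     (\<lambda>(k, l). (H2_norm a b (F k l))\<^sup>2 * L ^ (2 * k)) summable_on harmonic_index TYPE('d) \<and>
     (\<forall>(z, \<theta>)\<in>cannulus a b.
        ((\<lambda>(k, l). F k l z * complex_of_real (Y k l \<theta>)) has_sum f (z, \<theta>)) (harmonic_index TYPE('d)))"

text \<open>Functions on \<open>cannulus a b\<close> are represented by total functions vanishing outside of it.\<close>

definition HL2 ::
    "(nat \<Rightarrow> nat \<Rightarrow> real^'d \<Rightarrow> real) \<Rightarrow> real \<Rightarrow> real \<Rightarrow> real \<Rightarrow> (complex \<times> (real^'d) \<Rightarrow> complex) set" where
  "HL2 Y a b L = {f. (\<forall>p. p \<notin> cannulus a b \<longrightarrow> f p = 0) \<and> (\<exists>F. is_expansion Y a b L f F)}"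

text \<open>The coefficients are unique as functions on the annulus.\<close>

definition HL2_coeff ::
    "(nat \<Rightarrow> nat \<Rightarrow> real^'d \<Rightarrow> real) \<Rightarrow> real \<Rightarrow> real \<Rightarrow> real \<Rightarrow> (complex \<times> (real^'d) \<Rightarrow> complex)
       \<Rightarrow> nat \<Rightarrow> nat \<Rightarrow> complex \<Rightarrow> complex" where
  "HL2_coeff Y a b L f = (SOME F. is_expansion Y a b L f F)"

definition HL2_norm ::
    "(nat \<Rightarrow> nat \<Rightarrow> real^'d \<Rightarrow> real) \<Rightarrow> real \<Rightarrow> real \<Rightarrow> real \<Rightarrow> (complex \<times> (real^'d) \<Rightarrow> complex) \<Rightarrow> real" where
  "HL2_norm Y a b L f =
     sqrt (\<Sum>\<^sub>\<infinity>(k, l)\<in>harmonic_index TYPE('d). (H2_norm a b (HL2_coeff Y a b L f k l))\<^sup>2 * L ^ (2 * k))"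

definition HL2_inner ::
    "(nat \<Rightarrow> nat \<Rightarrow> real^'d \<Rightarrow> real) \<Rightarrow> real \<Rightarrow> real \<Rightarrow> real \<Rightarrow> (complex \<times> (real^'d) \<Rightarrow> complex)
       \<Rightarrow> (complex \<times> (real^'d) \<Rightarrow> complex) \<Rightarrow> complex" where
  "HL2_inner Y a b L f g =
     (\<Sum>\<^sub>\<infinity>(k, l)\<in>harmonic_index TYPE('d).
        H2_inner a b (HL2_coeff Y a b L f k l) (HL2_coeff Y a b L g k l) * of_real (L ^ (2 * k)))"

end

theory Submission
  imports Defs
begin

text \<open>
  An element of the space is a family of coefficients \<open>F k l\<close>, taken from closed subspaces of the
  Hardy space of the annulus and square summable with the weights \<open>L ^ (2 * k)\<close>. Two estimates carry
  the whole theorem.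

  The first is a bound for point evaluations, uniform on closed subannuli
  (\<open>H2_evaluation_bound\<close>). A Hardy function has a Laurent expansion with coefficients
  \<open>c n\<close>, Parseval's identity holds on every circle, and boundary values exist by a Riesz--Fischer
  argument (\<open>boundary_value_exists\<close>), so that the squared norm is the sum of
  \<open>|c n|\<^sup>2 (a\<^sup>2\<^sup>n + b\<^sup>2\<^sup>n)\<close> (\<open>H2_norm_sq\<close>). Hence each \<open>|c n|\<close> is controlled by the norm, and the
  Laurent series is dominated by two geometric series. The same bound turns Cauchy sequences into
  locally uniformly convergent ones, which gives completeness (\<open>H2_complete\<close>).

  The second is polynomial growth in \<open>k\<close> of the sum over \<open>l\<close> of \<open>(Y k l \<theta>)\<^sup>2\<close>, uniformly in \<open>\<theta>\<close>
  (\<open>sum_Y_sq_le\<close>). If a homogeneous polynomial \<open>p\<close> of degree \<open>k\<close> has maximal modulus \<open>M\<close> on the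
  sphere at \<open>\<omega>\<close>, a Markov type bound for the derivative shows \<open>|p| \<ge> M / 2\<close> on a ball of radius
  comparable to \<open>1 / (k + 1)\<^sup>2\<close> that lies in the unit ball and touches \<open>\<omega>\<close>; so the squared norm of
  \<open>p\<close> on the sphere is at least \<open>M\<^sup>2\<close> times a constant and a negative power of \<open>k + 1\<close>
  (\<open>homogeneous_poly_sup_le_L2\<close>). The estimate follows by taking \<open>p\<close> to be the sum of
  \<open>Y k l \<theta> * Y k l\<close>.

  Since \<open>L > 1\<close>, the Cauchy--Schwarz inequality with weights \<open>L ^ k\<close> and \<open>L ^ (- k)\<close> combines both
  estimates: every admissible family yields an absolutely convergent expansion, bounded by a
  constant times the norm (\<open>expansion_abs_bound\<close>). This is the maximum principle, because the minimum
  in its statement is less than 1. Completeness follows from that of the coefficient spaces.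

  The norm is defined through the coefficients, so these have to be determined by the function.
  If an expansion vanishes, then for fixed \<open>z\<close> its terms of degree \<open>k\<close> are homogeneous harmonic
  polynomials whose sum vanishes on the sphere; by the maximum principle for harmonic functions the
  sum vanishes in the ball, and comparing powers of the radius separates the degrees
  (\<open>harmonic_series_unique\<close>). Within one degree, orthonormality applies.

  For smoothness, \<open>\<theta>\<close> is replaced by a vector \<open>x\<close> with \<open>|x| < L\<close>. The terms of degree \<open>k\<close> still decay
  geometrically, locally uniformly. A derivative in \<open>z\<close> costs a constant by Cauchy's estimate, a
  derivative in \<open>x\<close> costs a multiple of \<open>k + 1\<close> by the Markov type bound; both preserve geometric
  decay, so the series may be differentiated termwise any number of times
  (\<open>analytic_series_C_k\<close>).
\<close>


section \<open>Laurent expansions on annuli\<close>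

lemma open_annulus: "open (annulus a b)"
proof -
  have "annulus a b = (cmod -` {a<..<b})" by (auto simp: annulus_def)
  then show ?thesis by (simp add: open_vimage continuous_on_norm_id)
qed

lemma circlepath_integral_annulus_eq:
  assumes "0 \<le> a" "f holomorphic_on annulus a b" "a < r" "r < b" "a < s" "s < b"
  shows "contour_integral (circlepath 0 r) f = contour_integral (circlepath 0 s) f"
proof (rule Cauchy_theorem_homotopic_loops)
  show "open (annulus a b)" by (rule open_annulus)
  show "homotopic_loops (annulus a b) (circlepath 0 r) (circlepath 0 s)"
  proof (rule homotopic_loops_linear)
    fix t x :: real
    show "closed_segment (circlepath 0 r t) (circlepath 0 s t) \<subseteq> annulus a b"
    proof
      fix y assume "y \<in> closed_segment (circlepath 0 r t) (circlepath 0 s t)"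
      then obtain u where u: "0 \<le> u" "u \<le> 1" 
        "y = (1 - u) *\<^sub>R circlepath 0 r t + u *\<^sub>R circlepath 0 s t"
        by (auto simp: closed_segment_def)
      then have "y = of_real ((1 - u) * r + u * s) * exp (2 * of_real pi * \<i> * of_real t)"
        by (simp add: circlepath scaleR_conv_of_real algebra_simps)
      then have "cmod y = \<bar>(1 - u) * r + u * s\<bar>"
        by (metis (no_types, lifting) norm_mult norm_of_real norm_exp_i_times mult.assoc mult.commute mult.right_neutral of_real_mult of_real_numeral)
      moreover have "a < (1 - u) * r + u * s" "(1 - u) * r + u * s < b"
        using convex_bound_lt[of r b s "1-u" u] convex_bound_lt[of "-r" "-a" "-s" "1-u" u] u assms by (auto simp: algebra_simps)
      ultimately show "y \<in> annulus a b" using assms by (auto simp: annulus_def)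
    qed
  qed auto
qed (use assms in auto)

text \<open>Both halves of a Laurent expansion arise by integrating a geometric series termwise: \<open>x w = z / w\<close>
  on an outer circle and \<open>x w = w / z\<close> on an inner one. The remainder after \<open>N\<close> terms is the integral
  of \<open>h w * x w ^ N / (1 - x w)\<close>, of size at most a multiple of \<open>q ^ N\<close>.\<close>

lemma circlepath_integral_geometric_sums:
  assumes "0 < r" "continuous_on (sphere 0 r) h" "continuous_on (sphere 0 r) x"
    and q: "\<And>w. w \<in> sphere 0 r \<Longrightarrow> cmod (x w) \<le> q" "q < 1"
  shows "(\<lambda>n. contour_integral (circlepath 0 r) (\<lambda>w. h w * x w ^ n)) sums
         contour_integral (circlepath 0 r) (\<lambda>w. h w / (1 - x w))"
proof -
  let ?I = "contour_integral (circlepath 0 r)"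
  have "compact (h ` sphere 0 r)" using assms by (intro compact_continuous_image) auto
  then obtain B where B: "\<And>w. w \<in> sphere 0 r \<Longrightarrow> cmod (h w) \<le> B"
    by (meson bounded_iff compact_imp_bounded imageI)
  have s0: "complex_of_real r \<in> sphere 0 r" using assms by auto
  have q0: "0 \<le> q" using q(1)[OF s0] norm_ge_zero order_trans by blast
  have B0: "0 \<le> B" using B[OF s0] norm_ge_zero order_trans by blast
  have ne: "x w \<noteq> 1" if "w \<in> sphere 0 r" for w using q(1)[OF that] q(2) by auto
  have intg: "g contour_integrable_on circlepath 0 r" if "continuous_on (sphere 0 r) g" for g
    using that assms(1) by (intro contour_integrable_continuous_circlepath) auto
  have rem: "?I (\<lambda>w. h w / (1 - x w)) - (\<Sum>n<N. ?I (\<lambda>w. h w * x w ^ n)) =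
      ?I (\<lambda>w. h w * x w ^ N / (1 - x w))" for N
  proof -
    have "(\<Sum>n<N. ?I (\<lambda>w. h w * x w ^ n)) = ?I (\<lambda>w. \<Sum>n<N. h w * x w ^ n)"
      by (intro contour_integral_sum[symmetric] intg continuous_intros assms) auto
    moreover have "?I (\<lambda>w. h w / (1 - x w)) - ?I (\<lambda>w. \<Sum>n<N. h w * x w ^ n)
        = ?I (\<lambda>w. h w / (1 - x w) - (\<Sum>n<N. h w * x w ^ n))"
      by (intro contour_integral_diff[symmetric] intg continuous_intros assms) (use ne in auto)
    moreover have "?I (\<lambda>w. h w / (1 - x w) - (\<Sum>n<N. h w * x w ^ n)) = ?I (\<lambda>w. h w * x w ^ N / (1 - x w))"
    proof (rule contour_integral_eq)
      fix w assume "w \<in> path_image (circlepath 0 r)"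
      then have "w \<in> sphere 0 r" using assms by auto
      note n = ne[OF this]
      have "(\<Sum>n<N. h w * x w ^ n) = h w * (1 - x w ^ N) / (1 - x w)"
        using n by (simp add: sum_distrib_left[symmetric] sum_gp_strict)
      then show "h w / (1 - x w) - (\<Sum>n<N. h w * x w ^ n) = h w * x w ^ N / (1 - x w)"
        using n by (simp add: field_simps)
    qed
    ultimately show ?thesis by (simp only:)
  qed
  have bd: "cmod (?I (\<lambda>w. h w * x w ^ N / (1 - x w))) \<le> B * q ^ N / (1 - q) * (2 * pi * r)" for N
  proof (rule has_contour_integral_bound_circlepath[OF has_contour_integral_integral])
    show "(\<lambda>w. h w * x w ^ N / (1 - x w)) contour_integrable_on circlepath 0 r"
      by (intro intg continuous_intros assms) (use ne in auto)
    fix w assume "cmod (w - 0) = r"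
    then have w: "w \<in> sphere 0 r" by auto
    have "1 - q \<le> cmod (1 - x w)" using q(1)[OF w] norm_triangle_ineq2[of 1 "x w"] by simp
    then show "cmod (h w * x w ^ N / (1 - x w)) \<le> B * q ^ N / (1 - q)"
      unfolding norm_divide norm_mult norm_power
      using q q0 B0 B[OF w] w by (intro frac_le mult_mono power_mono) auto
  qed (use q0 B0 q assms in auto)
  have "(\<lambda>N. B * q ^ N / (1 - q) * (2 * pi * r)) \<longlonglongrightarrow> B * 0 / (1 - q) * (2 * pi * r)"
    using q q0 by (intro tendsto_intros LIMSEQ_realpow_zero) auto
  then have "(\<lambda>N. ?I (\<lambda>w. h w / (1 - x w)) - (\<Sum>n<N. ?I (\<lambda>w. h w * x w ^ n))) \<longlonglongrightarrow> 0"
    unfolding rem by (intro Lim_null_comparison[OF always_eventually[OF allI[OF bd]]]) simp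
  from tendsto_diff[OF tendsto_const[of "?I (\<lambda>w. h w / (1 - x w))"] this]
  show ?thesis by (simp add: sums_def)
qed

text \<open>The difference quotient of \<open>f\<close> at \<open>z\<close> is holomorphic across \<open>z\<close>, so its integrals over the two
  circles agree, while \<open>1 / (w - z)\<close> integrates to \<open>2 * pi * \<i>\<close> over the outer circle and to \<open>0\<close> over
  the inner one.\<close>

lemma annulus_Cauchy_formula:
  assumes "0 \<le> a" "f holomorphic_on annulus a b" "a < r" "r < cmod z" "cmod z < s" "s < b"
  shows "2 * pi * \<i> * f z = contour_integral (circlepath 0 s) (\<lambda>w. f w / (w - z))
       - contour_integral (circlepath 0 r) (\<lambda>w. f w / (w - z))"
proof -
  have sub: "sphere 0 t \<subseteq> annulus a b" if "a < t" "t < b" for t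
    using that by (auto simp: annulus_def)
  have cf: "continuous_on (annulus a b) f" using assms holomorphic_on_imp_continuous_on by blast
  define g where "g = (\<lambda>w. if w = z then deriv f z else (f w - f z) / (w - z))"
  have holg: "g holomorphic_on annulus a b"
    unfolding g_def by (rule pole_lemma_open) (use assms open_annulus in auto)
  have eq: "contour_integral (circlepath 0 r) g = contour_integral (circlepath 0 s) g"
    by (rule circlepath_integral_annulus_eq[OF _ holg]) (use assms in auto)
  have exp: "contour_integral (circlepath 0 t) g = contour_integral (circlepath 0 t) (\<lambda>w. f w / (w - z))
      - f z * contour_integral (circlepath 0 t) (\<lambda>w. 1 / (w - z))" if "a < t" "t < b" "t \<noteq> cmod z" for t
  proof -
    have i1: "(\<lambda>w. f w / (w - z)) contour_integrable_on circlepath 0 t"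
      using that sub[of t] assms by (intro contour_integrable_continuous_circlepath continuous_intros continuous_on_subset[OF cf]) auto
    have i2: "(\<lambda>w. 1 / (w - z)) contour_integrable_on circlepath 0 t"
      using that assms by (intro contour_integrable_continuous_circlepath continuous_intros) auto
    have "contour_integral (circlepath 0 t) g = contour_integral (circlepath 0 t) (\<lambda>w. f w / (w - z) - f z * (1 / (w - z)))"
      by (rule contour_integral_eq) (use that assms in \<open>auto simp: g_def diff_divide_distrib\<close>)
    also have "\<dots> = contour_integral (circlepath 0 t) (\<lambda>w. f w / (w - z))
        - contour_integral (circlepath 0 t) (\<lambda>w. f z * (1 / (w - z)))"
      by (intro contour_integral_diff i1 contour_integrable_lmul i2)
    finally show ?thesis using contour_integral_lmul[OF i2, of "f z"] by simp
  qed
  have o: "contour_integral (circlepath 0 s) (\<lambda>w. 1 / (w - z)) = 2 * pi * \<i>"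
    using Cauchy_integral_circlepath_simple[of "\<lambda>_. 1" 0 s z] assms
    by (auto intro!: contour_integral_unique)
  have i: "contour_integral (circlepath 0 r) (\<lambda>w. 1 / (w - z)) = 0"
  proof (intro contour_integral_unique Cauchy_theorem_disc_simple[where a=0 and e="cmod z"])
    show "(\<lambda>w. 1 / (w - z)) holomorphic_on ball 0 (cmod z)" by (intro holomorphic_intros) auto
  qed (use assms in auto)
  show ?thesis using exp[of r] exp[of s] eq o i assms by (simp add: algebra_simps)
qed

definition laurent_coeff :: "(complex \<Rightarrow> complex) \<Rightarrow> real \<Rightarrow> int \<Rightarrow> complex" where
  "laurent_coeff f r n = contour_integral (circlepath 0 r) (\<lambda>w. f w * w powi (-n-1)) / (2 * pi * \<i>)"

lemma powi_holomorphic: "0 \<notin> S \<Longrightarrow> (\<lambda>z. z powi n) holomorphic_on S"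
  by (intro holomorphic_intros) auto

lemma laurent_coeff_radius_eq:
  assumes "0 \<le> a" "f holomorphic_on annulus a b" "a < r" "r < b" "a < s" "s < b"
  shows "laurent_coeff f r n = laurent_coeff f s n"
proof -
  have "(\<lambda>w. f w * w powi (-n-1)) holomorphic_on annulus a b"
    by (intro holomorphic_intros assms) (use assms in \<open>auto simp: annulus_def\<close>)
  from circlepath_integral_annulus_eq[OF assms(1) this assms(3-6)] show ?thesis
    by (simp add: laurent_coeff_def)
qed

lemma has_sum_int_halves:
  fixes f :: "int \<Rightarrow> 'a::{topological_comm_monoid_add}"
  assumes p: "((\<lambda>n. f (int n)) has_sum l) UNIV" and n: "((\<lambda>n. f (- int n - 1)) has_sum m) UNIV"
  shows "(f has_sum (l + m)) UNIV"
proof -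
  have p': "(f has_sum l) (range int)"
    using p by (subst has_sum_reindex) (auto simp: o_def)
  have n': "(f has_sum m) (range (\<lambda>n. - int n - 1))"
    using n by (subst has_sum_reindex) (auto simp: o_def inj_on_def)
  have "(f has_sum (l + m)) (range int \<union> range (\<lambda>n. - int n - 1))"
    by (intro has_sum_Un_disjoint p' n') auto
  moreover have "range int \<union> range (\<lambda>n. - int n - 1) = UNIV"
  proof -
    have "x \<in> range int \<union> range (\<lambda>n. - int n - 1)" for x
    proof (cases "x \<ge> 0")
      case True then show ?thesis by (metis UnI1 nonneg_int_cases rangeI)
    next
      case False
      then have "x = - int (nat (-x-1)) - 1" by simp
      then show ?thesis by blast
    qed
    then show ?thesis by blast
  qed
  ultimately show ?thesis by simp
qed

text \<open>A coefficient does not depend on the radius, so \<open>|c n|\<close> is at most a multiple of \<open>u powi (- n)\<close> for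
  every radius \<open>u\<close>. Radii above \<open>|z|\<close> for \<open>n \<ge> 0\<close> and below \<open>|z|\<close> for \<open>n < 0\<close> make the expansion
  converge absolutely.\<close>

theorem annulus_Laurent_expansion:
  assumes "0 \<le> a" "f holomorphic_on annulus a b" "a < r" "r < b" "z \<in> annulus a b"
  shows "((\<lambda>n. laurent_coeff f r n * z powi n) has_sum f z) UNIV"
proof -
  define c where "c = laurent_coeff f r"
  have z: "a < cmod z" "cmod z < b" using assms by (auto simp: annulus_def)
  then have z0: "z \<noteq> 0" using assms by auto
  obtain s where s: "cmod z < s" "s < b" using z dense by blast
  obtain t where t: "a < t" "t < cmod z" using z dense by blast
  have cs: "continuous_on (sphere 0 u) f" if "a < u" "u < b" for u
    using that holomorphic_on_imp_continuous_on[OF assms(2)]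
    by (rule_tac continuous_on_subset) (auto simp: annulus_def)
  have cc: "c n = laurent_coeff f u n" if "a < u" "u < b" for u n
    using laurent_coeff_radius_eq assms that unfolding c_def by blast
  have c_bound: "\<exists>B. \<forall>n. cmod (c n) \<le> B * u powi (-n)" if u: "a < u" "u < b" for u
  proof -
    have "compact (f ` sphere 0 u)" using cs[OF u] by (intro compact_continuous_image) auto
    then obtain B where B: "\<And>w. w \<in> sphere 0 u \<Longrightarrow> cmod (f w) \<le> B"
      by (meson bounded_iff compact_imp_bounded imageI)
    have B0: "0 \<le> B" using order_trans[OF norm_ge_zero B[of "of_real u"]] u assms by auto
    have "cmod (c n) \<le> B * u powi (-n)" for n
    proof -
      have "cmod (contour_integral (circlepath 0 u) (\<lambda>w. f w * w powi (-n-1))) \<le> (B * u powi (-n-1)) * (2 * pi * u)"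
      proof (rule has_contour_integral_bound_circlepath[OF has_contour_integral_integral])
        show "(\<lambda>w. f w * w powi (-n-1)) contour_integrable_on circlepath 0 u"
          using cs u assms by (intro contour_integrable_continuous_circlepath continuous_intros) auto
      next
        fix w :: complex assume "cmod (w - 0) = u"
        then show "cmod (f w * w powi (-n-1)) \<le> B * u powi (-n-1)"
          using B[of w] u assms by (auto simp: norm_mult norm_power_int intro!: mult_right_mono)
      qed (use B0 u assms in auto)
      also have "\<dots> = B * u powi (-n) * (2 * pi)"
        using u assms power_int_minus_mult[of u "-n"] by (simp add: algebra_simps power_int_diff)
      finally have "cmod (contour_integral (circlepath 0 u) (\<lambda>w. f w * w powi (-n-1))) / (2 * pi) \<le> B * u powi (-n)"
        by (simp add: field_simps)
      then show ?thesis by (simp add: cc[OF u] laurent_coeff_def norm_divide norm_mult)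
    qed
    then show ?thesis by blast
  qed
  \<comment> \<open>The integral over the outer circle yields the nonnegative powers: expand in \<open>z / w\<close>.\<close>
  have "(\<lambda>n. contour_integral (circlepath 0 s) (\<lambda>w. f w / w * (z / w) ^ n)) sums
         contour_integral (circlepath 0 s) (\<lambda>w. f w / w / (1 - z / w))"
    by (rule circlepath_integral_geometric_sums[where q = "cmod z / s"])
      (use s z cs[of s] assms in \<open>auto intro!: continuous_intros simp: norm_divide field_simps\<close>)
  moreover have "contour_integral (circlepath 0 s) (\<lambda>w. f w / w * (z / w) ^ n) = 2 * pi * \<i> * (c (int n) * z powi int n)" for n
  proof -
    have "contour_integral (circlepath 0 s) (\<lambda>w. f w / w * (z / w) ^ n)
        = contour_integral (circlepath 0 s) (\<lambda>w. z ^ n * (f w * w powi (- int n - 1)))"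
      using s z assms
      by (intro contour_integral_eq) (auto simp: power_int_minus power_int_diff field_simps)
    also have "\<dots> = z ^ n * contour_integral (circlepath 0 s) (\<lambda>w. f w * w powi (- int n - 1))"
      using s z cs[of s] assms
      by (intro contour_integral_lmul contour_integrable_continuous_circlepath continuous_intros) auto
    finally show ?thesis using s z by (simp add: cc[of s] laurent_coeff_def)
  qed
  moreover have "contour_integral (circlepath 0 s) (\<lambda>w. f w / w / (1 - z / w)) = contour_integral (circlepath 0 s) (\<lambda>w. f w / (w - z))"
    using s z assms by (intro contour_integral_eq) (auto simp: field_simps)
  ultimately have pos: "(\<lambda>n. 2 * pi * \<i> * (c (int n) * z powi int n)) sums contour_integral (circlepath 0 s) (\<lambda>w. f w / (w - z))"
    by simp
  \<comment> \<open>The integral over the inner circle yields the negative powers: expand in \<open>w / z\<close>.\<close>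
  have "(\<lambda>n. contour_integral (circlepath 0 t) (\<lambda>w. f w / z * (w / z) ^ n)) sums
         contour_integral (circlepath 0 t) (\<lambda>w. f w / z / (1 - w / z))"
    by (rule circlepath_integral_geometric_sums[where q = "t / cmod z"])
      (use t z z0 cs[of t] assms in \<open>auto intro!: continuous_intros simp: norm_divide field_simps\<close>)
  moreover have "contour_integral (circlepath 0 t) (\<lambda>w. f w / z * (w / z) ^ n) = 2 * pi * \<i> * (c (- int n - 1) * z powi (- int n - 1))" for n
  proof -
    have "contour_integral (circlepath 0 t) (\<lambda>w. f w / z * (w / z) ^ n)
        = contour_integral (circlepath 0 t) (\<lambda>w. z powi (- int n - 1) * (f w * w powi (- (- int n - 1) - 1)))"
      using t z z0 assms
      by (intro contour_integral_eq) (auto simp: power_int_minus power_int_diff field_simps)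
    also have "\<dots> = z powi (- int n - 1) * contour_integral (circlepath 0 t) (\<lambda>w. f w * w powi (- (- int n - 1) - 1))"
      using t z cs[of t] assms
      by (intro contour_integral_lmul contour_integrable_continuous_circlepath continuous_intros) auto
    finally show ?thesis using t z by (simp add: cc[of t] laurent_coeff_def)
  qed
  moreover have "contour_integral (circlepath 0 t) (\<lambda>w. f w / z / (1 - w / z)) = - contour_integral (circlepath 0 t) (\<lambda>w. f w / (w - z))"
  proof -
    have "contour_integral (circlepath 0 t) (\<lambda>w. f w / z / (1 - w / z)) = contour_integral (circlepath 0 t) (\<lambda>w. - (f w / (w - z)))"
    proof (rule contour_integral_eq)
      fix w assume "w \<in> path_image (circlepath 0 t)"
      then have "z - w \<noteq> 0" using t z assms by auto
      then have "f w / z / (1 - w / z) = f w / (z - w)" using z0 by (simp add: field_simps)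
      also have "\<dots> = - (f w / (w - z))" by (metis minus_diff_eq minus_divide_right)
      finally show "f w / z / (1 - w / z) = - (f w / (w - z))" .
    qed
    also have "\<dots> = - contour_integral (circlepath 0 t) (\<lambda>w. f w / (w - z))"
      by (rule contour_integral_neg)
    finally show ?thesis .
  qed
  ultimately have neg: "(\<lambda>n. 2 * pi * \<i> * (c (- int n - 1) * z powi (- int n - 1))) sums - contour_integral (circlepath 0 t) (\<lambda>w. f w / (w - z))"
    by simp
  \<comment> \<open>Unconditional summation over the integers needs absolute convergence of both halves.\<close>
  have half: "(g has_sum l) UNIV" if "\<And>n. cmod (g n) \<le> B * q ^ n" "0 \<le> q" "q < 1" "(\<lambda>n. 2 * pi * \<i> * g n) sums (2 * pi * \<i> * l)"
    for g :: "nat \<Rightarrow> complex" and B q l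
  proof -
    have "summable (\<lambda>n. norm (g n))"
      using that by (intro summable_comparison_test[OF _ summable_mult[OF summable_geometric[of q], of B]]) auto
    moreover have "g sums l" using that(4) by (subst (asm) sums_mult_iff) auto
    ultimately show ?thesis by (intro norm_summable_imp_has_sum)
  qed
  obtain B where B: "\<And>n. cmod (c n) \<le> B * s powi (-n)" using c_bound[of s] s z by auto
  obtain B' where B': "\<And>n. cmod (c n) \<le> B' * t powi (-n)" using c_bound[of t] t z by auto
  define l where "l = contour_integral (circlepath 0 s) (\<lambda>w. f w / (w - z)) / (2 * pi * \<i>)"
  define m where "m = - contour_integral (circlepath 0 t) (\<lambda>w. f w / (w - z)) / (2 * pi * \<i>)"
  have p: "((\<lambda>n. c (int n) * z powi int n) has_sum l) UNIV"
  proof (rule half[where B=B and q="cmod z / s"])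
    fix n show "cmod (c (int n) * z powi int n) \<le> B * (cmod z / s) ^ n"
      using mult_right_mono[OF B[of n], of "cmod z ^ n"] by (simp add: norm_mult norm_power power_int_minus field_simps)
  qed (use s pos z assms in \<open>auto simp: l_def\<close>)
  have n: "((\<lambda>n. c (- int n - 1) * z powi (- int n - 1)) has_sum m) UNIV"
  proof (rule half[where B="B' * t / cmod z" and q="t / cmod z"])
    fix n :: nat
    have "- (- int n - 1) = int (Suc n)" by simp
    then have 1: "cmod (c (- int n - 1)) \<le> B' * t ^ Suc n" using B'[of "- int n - 1"] by (metis power_int_of_nat)
    have 2: "cmod (z powi (- int n - 1)) = inverse (cmod z ^ Suc n)"
      using z0 by (simp add: norm_divide norm_mult norm_power power_int_minus power_int_diff field_simps)
    show "cmod (c (- int n - 1) * z powi (- int n - 1)) \<le> B' * t / cmod z * (t / cmod z) ^ n"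
      using mult_right_mono[OF 1, of "inverse (cmod z ^ Suc n)"] unfolding norm_mult 2 by (simp add: field_simps)
  qed (use t neg z z0 assms in \<open>auto simp: m_def\<close>)
  have "((\<lambda>n. c n * z powi n) has_sum (l + m)) UNIV" by (rule has_sum_int_halves[OF p n])
  moreover have "l + m = f z"
    using annulus_Cauchy_formula[OF assms(1,2) t s] by (simp add: l_def m_def field_simps)
  ultimately show ?thesis by (simp add: c_def)
qed

section \<open>Mean square convergence on the circle\<close>

abbreviation circle_measure :: "real measure" where
  "circle_measure \<equiv> restrict_space lborel {0..2 * pi}"

lemma angle_mean_eq: "angle_mean u = (1 / (2 * pi)) *\<^sub>R (LINT \<phi>|circle_measure. u \<phi>)"
  unfolding angle_mean_def by (subst integral_restrict_space) (auto simp: set_lebesgue_integral_def)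

definition circle_L2 :: "(real \<Rightarrow> complex) set" where
  "circle_L2 = {h. h \<in> borel_measurable circle_measure \<and> integrable circle_measure (\<lambda>\<phi>. (cmod (h \<phi>))\<^sup>2)}"

lemma circle_L2_iff:
  "h \<in> circle_L2 \<longleftrightarrow> set_borel_measurable lborel {0..2 * pi} h \<and>
     set_integrable lborel {0..2 * pi} (\<lambda>\<phi>. (cmod (h \<phi>))\<^sup>2)"
  unfolding circle_L2_def set_integrable_def set_borel_measurable_def
  by (simp add: borel_measurable_restrict_space_iff integrable_restrict_space)

lemma finite_measure_circle: "finite_measure circle_measure"
  by (rule finite_measureI) (simp add: emeasure_restrict_space)

lemma continuous_on_imp_integrable_circle:
  fixes h :: "real \<Rightarrow> 'b::{banach,second_countable_topology}"
  assumes "continuous_on {0..2 * pi} h"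
  shows "integrable circle_measure h"
  using borel_integrable_compact[of "{0..2*pi}" h] assms
  by (simp add: integrable_restrict_space)

lemma continuous_on_imp_circle_L2:
  assumes "continuous_on {0..2 * pi} h"
  shows "h \<in> circle_L2"
proof -
  have "integrable circle_measure (\<lambda>\<phi>. (cmod (h \<phi>))\<^sup>2)"
    by (intro continuous_on_imp_integrable_circle continuous_intros assms)
  moreover have "h \<in> borel_measurable circle_measure"
    using continuous_on_imp_integrable_circle[OF assms] by (rule borel_measurable_integrable)
  ultimately show ?thesis by (simp add: circle_L2_def)
qed

lemma integrable_circle_mult_cnj:
  assumes "h \<in> circle_L2" "k \<in> circle_L2"
  shows "integrable circle_measure (\<lambda>\<phi>. h \<phi> * cnj (k \<phi>))"
proof (rule Bochner_Integration.integrable_bound)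
  show "integrable circle_measure (\<lambda>\<phi>. (cmod (h \<phi>))\<^sup>2 + (cmod (k \<phi>))\<^sup>2)"
    using assms by (auto simp: circle_L2_def)
  show "(\<lambda>\<phi>. h \<phi> * cnj (k \<phi>)) \<in> borel_measurable circle_measure"
    using assms by (auto simp: circle_L2_def
      intro!: borel_measurable_times borel_measurable_continuous_on[of cnj] continuous_intros)
  have "x * y \<le> x\<^sup>2 + y\<^sup>2" if "0 \<le> x" "0 \<le> y" for x y :: real
    using sum_squares_bound[of x y] mult_nonneg_nonneg[OF that] by linarith
  then show "AE \<phi> in circle_measure. norm (h \<phi> * cnj (k \<phi>)) \<le> norm ((cmod (h \<phi>))\<^sup>2 + (cmod (k \<phi>))\<^sup>2)"
    by (intro AE_I2) (simp add: norm_mult)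
qed

lemma norm_add_sq_le: "(norm (x + y))\<^sup>2 \<le> 2 * (norm x)\<^sup>2 + 2 * (norm y)\<^sup>2"
  using power_mono[OF norm_triangle_ineq[of x y], of 2] sum_squares_bound[of "norm x" "norm y"]
  by (simp add: power2_sum)

lemma circle_L2_add: 
  assumes "h \<in> circle_L2" "k \<in> circle_L2"
  shows "(\<lambda>\<phi>. h \<phi> + k \<phi>) \<in> circle_L2"
proof -
  have "integrable circle_measure (\<lambda>\<phi>. (cmod (h \<phi> + k \<phi>))\<^sup>2)"
  proof (rule Bochner_Integration.integrable_bound)
    show "integrable circle_measure (\<lambda>\<phi>. 2 * (cmod (h \<phi>))\<^sup>2 + 2 * (cmod (k \<phi>))\<^sup>2)"
      using assms by (auto simp: circle_L2_def)
    show "(\<lambda>\<phi>. (cmod (h \<phi> + k \<phi>))\<^sup>2) \<in> borel_measurable circle_measure"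
      using assms by (auto simp: circle_L2_def)
    show "AE \<phi> in circle_measure. norm ((cmod (h \<phi> + k \<phi>))\<^sup>2) \<le> norm (2 * (cmod (h \<phi>))\<^sup>2 + 2 * (cmod (k \<phi>))\<^sup>2)"
      by (intro AE_I2) (simp add: norm_add_sq_le)
  qed
  then show ?thesis using assms by (auto simp: circle_L2_def)
qed

lemma circle_L2_cmult: "h \<in> circle_L2 \<Longrightarrow> (\<lambda>\<phi>. c * h \<phi>) \<in> circle_L2"
  by (auto simp: circle_L2_def norm_mult power_mult_distrib)

lemma circle_L2_diff: "h \<in> circle_L2 \<Longrightarrow> k \<in> circle_L2 \<Longrightarrow> (\<lambda>\<phi>. h \<phi> - k \<phi>) \<in> circle_L2"
  using circle_L2_add[of h "\<lambda>\<phi>. (-1) * k \<phi>"] circle_L2_cmult[of k "-1"] by simp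

lemma angle_mean_mono:
  fixes u v :: "real \<Rightarrow> real"
  assumes "integrable circle_measure u" "integrable circle_measure v" "\<And>\<phi>. u \<phi> \<le> v \<phi>"
  shows "angle_mean u \<le> angle_mean v"
  unfolding angle_mean_eq using assms by (intro scaleR_left_mono integral_mono) auto

lemma angle_mean_const: "angle_mean (\<lambda>_. c :: real) = c"
  by (simp add: angle_mean_def set_integral_const)

lemma angle_mean_add:
  "integrable circle_measure u \<Longrightarrow> integrable circle_measure v \<Longrightarrow>
    angle_mean (\<lambda>\<phi>. u \<phi> + v \<phi>) = angle_mean u + angle_mean v"
  by (simp add: angle_mean_eq scaleR_add_right)

lemma angle_mean_cmult: "angle_mean (\<lambda>\<phi>. c * u \<phi>) = c * angle_mean (u :: real \<Rightarrow> 'a::{real_normed_field,banach,second_countable_topology})"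
  by (simp add: angle_mean_eq)

lemma angle_mean_sum:
  "(\<And>i. i \<in> I \<Longrightarrow> integrable circle_measure (u i)) \<Longrightarrow>
    angle_mean (\<lambda>\<phi>. \<Sum>i\<in>I. u i \<phi>) = (\<Sum>i\<in>I. angle_mean (u i))"
  by (simp add: angle_mean_eq scaleR_sum_right)

lemma norm_angle_mean_le: "norm (angle_mean u) \<le> angle_mean (\<lambda>\<phi>. norm (u \<phi>))"
  using integral_norm_bound[of circle_measure u] by (simp add: angle_mean_eq divide_right_mono)

lemma angle_mean_cnj: "angle_mean (\<lambda>\<phi>. cnj (u \<phi>)) = cnj (angle_mean u)"
  by (simp add: angle_mean_eq scaleR_conv_of_real)

lemma angle_mean_nonneg: "(\<And>\<phi>. 0 \<le> u \<phi>) \<Longrightarrow> 0 \<le> angle_mean (u :: real \<Rightarrow> real)"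
  by (simp add: angle_mean_eq integral_nonneg_AE)

definition msq :: "(real \<Rightarrow> complex) \<Rightarrow> real" where
  "msq h = angle_mean (\<lambda>\<phi>. (cmod (h \<phi>))\<^sup>2)"

lemma msq_nonneg: "0 \<le> msq h"
  unfolding msq_def by (rule angle_mean_nonneg) auto

lemma angle_mean_mult_cnj_self: "angle_mean (\<lambda>\<phi>. h \<phi> * cnj (h \<phi>)) = of_real (msq h)"
proof -
  have "(LINT \<phi>|circle_measure. h \<phi> * cnj (h \<phi>)) = (LINT \<phi>|circle_measure. complex_of_real ((cmod (h \<phi>))\<^sup>2))"
    by (simp add: complex_norm_square[symmetric] del: of_real_power)
  also have "\<dots> = complex_of_real (LINT \<phi>|circle_measure. (cmod (h \<phi>))\<^sup>2)"
    by (rule integral_complex_of_real)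
  finally show ?thesis by (simp add: msq_def angle_mean_eq scaleR_conv_of_real)
qed

text \<open>Optimising the weight, \<open>t = sqrt B / sqrt A\<close>, turns a family of weighted bounds into a product
  bound; if \<open>A = 0\<close> or \<open>B = 0\<close> suitable weights force \<open>X = 0\<close>.\<close>

lemma sq_le_mult_of_weighted:
  fixes X A B :: real
  assumes "0 \<le> X" "0 \<le> A" "0 \<le> B" and w: "\<And>t. 0 < t \<Longrightarrow> 2 * X \<le> t * A + B / t"
  shows "X\<^sup>2 \<le> A * B"
proof (cases "A = 0 \<or> B = 0")
  case True
  have "X \<le> 0"
  proof (rule ccontr)
    assume X: "\<not> X \<le> 0"
    show False
    proof (cases "A = 0")
      case True
      have "0 < (B + 1) / X" using X assms by (intro divide_pos_pos) auto
      from w[OF this] have "2 * X * (B + 1) \<le> B * X" using True X assms by (simp add: field_simps)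
      moreover have "B * X < 2 * X * (B + 1)" 
      proof -
        have "0 < X" "0 \<le> B * X" using X assms by auto
        then show ?thesis by (simp add: algebra_simps)
      qed
      ultimately show False by simp
    next
      case False
      then have B: "B = 0" "0 < A" using True assms by auto
      from w[of "X / A"] X B show False by (simp add: field_simps)
    qed
  qed
  then show ?thesis using assms True by simp
next
  case False
  then have A: "0 < A" "0 < B" using assms by auto
  from w[of "sqrt B / sqrt A"] A have "2 * X \<le> sqrt B / sqrt A * A + B / (sqrt B / sqrt A)" by simp
  also have "\<dots> = 2 * sqrt (A * B)" using A by (simp add: real_sqrt_mult real_div_sqrt field_simps)
  finally have "X \<le> sqrt (A * B)" by simp
  then have "X\<^sup>2 \<le> (sqrt (A * B))\<^sup>2" using assms by (intro power_mono) auto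
  then show ?thesis using A by simp
qed

lemma angle_mean_Cauchy_Schwarz:
  assumes "h \<in> circle_L2" "k \<in> circle_L2"
  shows "(cmod (angle_mean (\<lambda>\<phi>. h \<phi> * cnj (k \<phi>))))\<^sup>2 \<le> msq h * msq k"
proof (rule sq_le_mult_of_weighted)
  fix t :: real assume t: "0 < t"
  have hi: "integrable circle_measure (\<lambda>\<phi>. (cmod (h \<phi>))\<^sup>2)" "integrable circle_measure (\<lambda>\<phi>. (cmod (k \<phi>))\<^sup>2)"
    using assms by (auto simp: circle_L2_def)
  have pt: "2 * (x * y) \<le> t * x\<^sup>2 + (1 / t) * y\<^sup>2" if "0 \<le> x" "0 \<le> y" for x y :: real
  proof -
    have "0 \<le> (sqrt t * x - y / sqrt t)\<^sup>2" by simp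
    then show ?thesis using t by (simp add: power2_diff power_mult_distrib power_divide field_simps power2_eq_square[of t])
  qed
  have i: "integrable circle_measure (\<lambda>\<phi>. cmod (h \<phi>) * cmod (k \<phi>))"
    using integrable_norm[OF integrable_circle_mult_cnj[OF assms]] by (simp add: norm_mult)
  have "2 * cmod (angle_mean (\<lambda>\<phi>. h \<phi> * cnj (k \<phi>))) \<le> 2 * angle_mean (\<lambda>\<phi>. cmod (h \<phi> * cnj (k \<phi>)))"
    using norm_angle_mean_le by simp
  also have "\<dots> = angle_mean (\<lambda>\<phi>. 2 * cmod (h \<phi> * cnj (k \<phi>)))" by (simp add: angle_mean_cmult)
  also have "\<dots> \<le> angle_mean (\<lambda>\<phi>. t * (cmod (h \<phi>))\<^sup>2 + (1 / t) * (cmod (k \<phi>))\<^sup>2)"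
    using hi i pt by (intro angle_mean_mono) (auto simp: norm_mult)
  also have "\<dots> = t * msq h + (1 / t) * msq k"
    using hi by (subst angle_mean_add) (auto simp: msq_def angle_mean_cmult simp del: times_divide_eq_left)
  finally show "2 * cmod (angle_mean (\<lambda>\<phi>. h \<phi> * cnj (k \<phi>))) \<le> t * msq h + msq k / t" by simp
qed (auto simp: msq_nonneg)

lemma msq_add_le:
  assumes "h \<in> circle_L2" "k \<in> circle_L2"
  shows "msq (\<lambda>\<phi>. h \<phi> + k \<phi>) \<le> 2 * msq h + 2 * msq k"
proof -
  have "msq (\<lambda>\<phi>. h \<phi> + k \<phi>) \<le> angle_mean (\<lambda>\<phi>. 2 * (cmod (h \<phi>))\<^sup>2 + 2 * (cmod (k \<phi>))\<^sup>2)"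
    unfolding msq_def using assms circle_L2_add[OF assms] norm_add_sq_le
    by (intro angle_mean_mono) (auto simp: circle_L2_def)
  also have "\<dots> = 2 * msq h + 2 * msq k"
    using assms by (subst angle_mean_add) (auto simp: msq_def angle_mean_cmult circle_L2_def)
  finally show ?thesis .
qed

text \<open>Continuity of the inner product in mean square: the difference of the two means splits into three
  terms that contain at least one of the differences, and the Cauchy--Schwarz inequality bounds each.\<close>

lemma angle_mean_mult_cnj_tendsto:
  assumes h: "\<forall>\<^sub>F r in F. hs r \<in> circle_L2" "h \<in> circle_L2" "((\<lambda>r. msq (\<lambda>\<phi>. hs r \<phi> - h \<phi>)) \<longlongrightarrow> 0) F"
    and k: "\<forall>\<^sub>F r in F. ks r \<in> circle_L2" "k \<in> circle_L2" "((\<lambda>r. msq (\<lambda>\<phi>. ks r \<phi> - k \<phi>)) \<longlongrightarrow> 0) F"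
  shows "((\<lambda>r. angle_mean (\<lambda>\<phi>. hs r \<phi> * cnj (ks r \<phi>))) \<longlongrightarrow> angle_mean (\<lambda>\<phi>. h \<phi> * cnj (k \<phi>))) F"
proof -
  let ?A = "\<lambda>r. msq (\<lambda>\<phi>. hs r \<phi> - h \<phi>)" and ?B = "\<lambda>r. msq (\<lambda>\<phi>. ks r \<phi> - k \<phi>)"
  have CS: "cmod (angle_mean (\<lambda>\<phi>. x \<phi> * cnj (y \<phi>))) \<le> sqrt (msq x * msq y)"
    if "x \<in> circle_L2" "y \<in> circle_L2" for x y
    using angle_mean_Cauchy_Schwarz[OF that] by (rule real_le_rsqrt)
  have "((\<lambda>r. angle_mean (\<lambda>\<phi>. hs r \<phi> * cnj (ks r \<phi>)) - angle_mean (\<lambda>\<phi>. h \<phi> * cnj (k \<phi>))) \<longlongrightarrow> 0) F"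
  proof (rule Lim_null_comparison)
    show "\<forall>\<^sub>F r in F. norm (angle_mean (\<lambda>\<phi>. hs r \<phi> * cnj (ks r \<phi>)) - angle_mean (\<lambda>\<phi>. h \<phi> * cnj (k \<phi>)))
       \<le> sqrt (?A r * ?B r) + sqrt (?A r * msq k) + sqrt (msq h * ?B r)"
      using h(1) k(1)
    proof eventually_elim
      case (elim r)
      let ?x = "\<lambda>\<phi>. hs r \<phi> - h \<phi>" and ?y = "\<lambda>\<phi>. ks r \<phi> - k \<phi>"
      have L2: "?x \<in> circle_L2" "?y \<in> circle_L2" using elim h k circle_L2_diff by auto
      have "angle_mean (\<lambda>\<phi>. hs r \<phi> * cnj (ks r \<phi>)) = angle_mean (\<lambda>\<phi>. ((?x \<phi> * cnj (?y \<phi>) + ?x \<phi> * cnj (k \<phi>)) + h \<phi> * cnj (?y \<phi>)) + h \<phi> * cnj (k \<phi>))"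
        by (simp add: algebra_simps)
      also have "\<dots> = angle_mean (\<lambda>\<phi>. ?x \<phi> * cnj (?y \<phi>)) + angle_mean (\<lambda>\<phi>. ?x \<phi> * cnj (k \<phi>)) + angle_mean (\<lambda>\<phi>. h \<phi> * cnj (?y \<phi>)) + angle_mean (\<lambda>\<phi>. h \<phi> * cnj (k \<phi>))"
        using L2 h(2) k(2) integrable_circle_mult_cnj
        by (simp add: angle_mean_add del: complex_cnj_diff)
      finally show ?case
        using CS[OF L2] CS[OF L2(1) k(2)] CS[OF h(2) L2(2)]
        by (auto intro!: order_trans[OF norm_triangle_ineq] add_mono)
    qed
    have "((\<lambda>r. sqrt (?A r * ?B r) + sqrt (?A r * msq k) + sqrt (msq h * ?B r)) \<longlongrightarrow> sqrt (0 * 0) + sqrt (0 * msq k) + sqrt (msq h * 0)) F"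
      by (intro tendsto_intros h k)
    then show "((\<lambda>r. sqrt (?A r * ?B r) + sqrt (?A r * msq k) + sqrt (msq h * ?B r)) \<longlongrightarrow> 0) F" by simp
  qed
  then show ?thesis by (rule Lim_null[THEN iffD2])
qed

lemma msq_tendsto:
  assumes "\<forall>\<^sub>F r in F. hs r \<in> circle_L2" "h \<in> circle_L2" "((\<lambda>r. msq (\<lambda>\<phi>. hs r \<phi> - h \<phi>)) \<longlongrightarrow> 0) F"
  shows "((\<lambda>r. msq (hs r)) \<longlongrightarrow> msq h) F"
  using angle_mean_mult_cnj_tendsto[OF assms assms] unfolding angle_mean_mult_cnj_self
  using tendsto_Re by fastforce

lemma angle_mean_cis: "angle_mean (\<lambda>\<phi>. cis (of_int m * \<phi>)) = (if m = 0 then 1 else 0)"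
proof (cases "m = 0")
  case True
  then show ?thesis by (simp add: angle_mean_def set_integral_const scaleR_conv_of_real)
next
  case False
  have "(\<integral>\<phi>. indicator {0..2*pi} \<phi> *\<^sub>R cis (of_int m * \<phi>) \<partial>lborel) = cis (of_int m * (2 * pi)) / (\<i> * of_int m) - cis (of_int m * 0) / (\<i> * of_int m)"
  proof (rule integral_FTC_Icc)
    fix x :: real
    have [simp]: "- (\<i> * (y * \<i>)) = y" for y by (simp add: complex_eq_iff)
    have "((\<lambda>\<phi>. exp (\<i> * (of_int m * of_real \<phi>)) / (\<i> * of_int m)) has_vector_derivative exp (\<i> * (of_int m * of_real x))) (at x within {0..2*pi})"
      using False by (auto intro!: derivative_eq_intros has_vector_derivative_real_field)
    then show "((\<lambda>\<phi>. cis (of_int m * \<phi>) / (\<i> * of_int m)) has_vector_derivative cis (of_int m * x)) (at x within {0..2*pi})"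
      by (simp add: cis_conv_exp)
  qed (auto intro!: continuous_intros)
  also have "cis (of_int m * (2 * pi)) = 1"
    using cis_multiple_2pi[of "of_int m"] by (simp add: mult_ac)
  finally show ?thesis using False by (simp add: angle_mean_def set_lebesgue_integral_def)
qed

text \<open>Orthogonality of the exponentials removes the mixed terms of the double sum.\<close>

lemma msq_trig_sum:
  assumes "finite X"
  shows "msq (\<lambda>\<phi>. \<Sum>n\<in>X. d n * cis (of_int n * \<phi>)) = (\<Sum>n\<in>X. (cmod (d n))\<^sup>2)"
proof -
  let ?S = "\<lambda>\<phi>. \<Sum>n\<in>X. d n * cis (of_int n * \<phi>)"
  have "?S \<phi> * cnj (?S \<phi>) = (\<Sum>n\<in>X. \<Sum>m\<in>X. (d n * cnj (d m)) * cis (of_int (n - m) * \<phi>))" for \<phi>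
    unfolding cnj_sum sum_product
    by (intro sum.cong refl) (simp add: cis_cnj cis_mult algebra_simps)
  then have "angle_mean (\<lambda>\<phi>. ?S \<phi> * cnj (?S \<phi>)) = (\<Sum>n\<in>X. \<Sum>m\<in>X. (d n * cnj (d m)) * (if n - m = 0 then 1 else 0))"
    by (simp add: angle_mean_sum angle_mean_cmult angle_mean_cis continuous_on_imp_integrable_circle continuous_intros
        del: of_int_diff)
  also have "\<dots> = (\<Sum>n\<in>X. \<Sum>m\<in>X. if m = n then d n * cnj (d n) else 0)"
    by (intro sum.cong refl) auto
  also have "\<dots> = (\<Sum>n\<in>X. d n * cnj (d n))" using assms by (simp add: sum.delta)
  also have "\<dots> = of_real (\<Sum>n\<in>X. (cmod (d n))\<^sup>2)"
    by (simp only: of_real_sum complex_norm_square)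
  finally show ?thesis unfolding angle_mean_mult_cnj_self using of_real_eq_iff by blast
qed

text \<open>Absolute summability makes the finite partial sums converge uniformly, hence in mean square, so the
  identity for finite sums passes to the limit.\<close>

lemma Parseval_has_sum:
  fixes d :: "int \<Rightarrow> complex"
  assumes sm: "d summable_on UNIV" and u: "\<And>\<phi>. ((\<lambda>n. d n * cis (of_int n * \<phi>)) has_sum u \<phi>) UNIV"
  shows "((\<lambda>n. (cmod (d n))\<^sup>2) has_sum msq u) UNIV" "u \<in> circle_L2"
proof -
  let ?F = "finite_subsets_at_top (UNIV :: int set)"
  let ?S = "\<lambda>X \<phi>. \<Sum>n\<in>X. d n * cis (of_int n * \<phi>)"
  have abs: "(\<lambda>n. cmod (d n)) summable_on UNIV"
    using sm summable_on_iff_abs_summable_on_complex by blast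
  have ul: "uniform_limit UNIV ?S u ?F"
    by (rule Weierstrass_m_test_general'[OF _ u abs]) (simp add: norm_mult)
  have fin: "\<forall>\<^sub>F X in ?F. finite X" by (simp add: eventually_finite_subsets_at_top_weakI)
  have "continuous_on UNIV u"
    by (rule uniform_limit_theorem[OF _ ul])
      (auto intro!: always_eventually continuous_intros)
  then show uL2: "u \<in> circle_L2"
    by (intro continuous_on_imp_circle_L2) (rule continuous_on_subset, auto)
  have "((\<lambda>X. msq (?S X)) \<longlongrightarrow> msq u) ?F"
  proof (rule msq_tendsto)
    show L2: "\<forall>\<^sub>F X in ?F. ?S X \<in> circle_L2"
      by (intro always_eventually allI continuous_on_imp_circle_L2 continuous_intros)
    show "((\<lambda>X. msq (\<lambda>\<phi>. ?S X \<phi> - u \<phi>)) \<longlongrightarrow> 0) ?F"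
    proof (rule tendstoI)
      fix e :: real assume e: "e > 0"
      then have "\<forall>\<^sub>F X in ?F. \<forall>\<phi>\<in>UNIV. dist (?S X \<phi>) (u \<phi>) < sqrt (e / 2)"
        using ul by (intro uniform_limitD) auto
      then show "\<forall>\<^sub>F X in ?F. dist (msq (\<lambda>\<phi>. ?S X \<phi> - u \<phi>)) 0 < e"
        using L2
      proof eventually_elim
        case (elim X)
        have "(cmod (?S X \<phi> - u \<phi>))\<^sup>2 \<le> e / 2" for \<phi>
        proof -
          have "cmod (?S X \<phi> - u \<phi>) \<le> sqrt (e / 2)" using elim(1) by (auto simp: dist_norm intro: less_imp_le)
          then have "(cmod (?S X \<phi> - u \<phi>))\<^sup>2 \<le> (sqrt (e / 2))\<^sup>2" by (intro power_mono) auto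
          then show ?thesis using e by simp
        qed
        then have "msq (\<lambda>\<phi>. ?S X \<phi> - u \<phi>) \<le> angle_mean (\<lambda>_. e / 2)"
          unfolding msq_def using circle_L2_diff[OF elim(2) uL2] finite_measure.integrable_const[OF finite_measure_circle]
          by (intro angle_mean_mono) (auto simp: circle_L2_def)
        then show ?case using e msq_nonneg[of "\<lambda>\<phi>. ?S X \<phi> - u \<phi>"] by (simp add: angle_mean_const)
      qed
    qed
  qed (rule uL2)
  then have "((\<lambda>X. \<Sum>n\<in>X. (cmod (d n))\<^sup>2) \<longlongrightarrow> msq u) ?F"
    by (rule Lim_transform_eventually) (use fin in eventually_elim, simp add: msq_trig_sum)
  then show "((\<lambda>n. (cmod (d n))\<^sup>2) has_sum msq u) UNIV" by (simp add: has_sum_def)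
qed

lemma nn_integral_circle_eq_ms:
  assumes "h \<in> circle_L2"
  shows "(\<integral>\<^sup>+\<phi>. ennreal ((cmod (h \<phi>))\<^sup>2) \<partial>circle_measure) = ennreal (2 * pi * msq h)"
  using assms by (subst nn_integral_eq_integral) (auto simp: circle_L2_def msq_def angle_mean_eq)

text \<open>The geometric rate makes the sum of \<open>2 ^ j * |u j - u (j + 1)|\<^sup>2\<close> integrable, hence finite almost
  everywhere, which forces pointwise convergence there. Fatou's lemma carries the bounds over to the
  pointwise limit.\<close>

lemma circle_Riesz_Fischer:
  assumes L2: "\<And>j. u j \<in> circle_L2" and C: "\<And>i j. j \<le> i \<Longrightarrow> msq (\<lambda>\<phi>. u j \<phi> - u i \<phi>) \<le> (1 / 4) ^ j"
  shows "\<exists>h\<in>circle_L2. \<forall>j. msq (\<lambda>\<phi>. u j \<phi> - h \<phi>) \<le> (1 / 4) ^ j"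
proof -
  let ?M = circle_measure
  define D where "D = (\<lambda>j \<phi>. ennreal (2 ^ j * (cmod (u j \<phi> - u (Suc j) \<phi>))\<^sup>2))"
  have meas[measurable]: "u j \<in> borel_measurable ?M" for j using L2 by (auto simp: circle_L2_def)
  have Dm[measurable]: "D j \<in> borel_measurable ?M" for j unfolding D_def by measurable
  have "(\<integral>\<^sup>+\<phi>. D j \<phi> \<partial>?M) \<le> ennreal (2 * pi * (1 / 2) ^ j)" for j
  proof -
    have "(\<integral>\<^sup>+\<phi>. D j \<phi> \<partial>?M) = ennreal (2 ^ j) * (\<integral>\<^sup>+\<phi>. ennreal ((cmod (u j \<phi> - u (Suc j) \<phi>))\<^sup>2) \<partial>?M)"
      unfolding D_def by (subst ennreal_mult) (auto intro!: nn_integral_cmult)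
    also have "\<dots> = ennreal (2 ^ j * (2 * pi * msq (\<lambda>\<phi>. u j \<phi> - u (Suc j) \<phi>)))"
      using nn_integral_circle_eq_ms[OF circle_L2_diff[OF L2 L2]] by (simp add: ennreal_mult msq_nonneg)
    also have "\<dots> \<le> ennreal (2 ^ j * (2 * pi * (1 / 4) ^ j))"
      using C[of j "Suc j"] by (intro ennreal_leI mult_left_mono) auto
    also have "2 ^ j * (2 * pi * (1 / 4) ^ j) = 2 * pi * ((2 * (1 / 4)) ^ j :: real)"
      by (simp only: power_mult_distrib) (simp add: mult_ac)
    finally show ?thesis by simp
  qed
  then have "(\<Sum>j. \<integral>\<^sup>+\<phi>. D j \<phi> \<partial>?M) \<le> (\<Sum>j. ennreal (2 * pi * (1 / 2) ^ j))"
    by (intro suminf_le) auto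
  also have "\<dots> = ennreal (\<Sum>j. 2 * pi * (1 / 2) ^ j)"
    by (intro suminf_ennreal2 summable_mult summable_geometric) auto
  also have "\<dots> < \<infinity>" by simp
  finally have "(\<integral>\<^sup>+\<phi>. (\<Sum>j. D j \<phi>) \<partial>?M) \<noteq> \<infinity>"
    by (subst nn_integral_suminf) auto
  then have "AE \<phi> in ?M. (\<Sum>j. D j \<phi>) \<noteq> \<infinity>"
    by (intro nn_integral_noteq_infinite) auto
  moreover have conv: "convergent (\<lambda>j. u j \<phi>)" if fin: "(\<Sum>j. D j \<phi>) \<noteq> \<infinity>" for \<phi>
  proof -
    obtain B where B: "(\<Sum>j. D j \<phi>) = ennreal B" "0 \<le> B" using fin by (cases "\<Sum>j. D j \<phi>") auto
    have bd: "cmod (u (Suc j) \<phi> - u j \<phi>) \<le> sqrt B * (1 / sqrt 2) ^ j" for j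
    proof -
      have "D j \<phi> \<le> (\<Sum>j. D j \<phi>)" using sum_le_suminf[of "\<lambda>j. D j \<phi>" "{j}"] by simp
      then have "D j \<phi> \<le> ennreal B" using B(1) by simp
      then have "2 ^ j * (cmod (u j \<phi> - u (Suc j) \<phi>))\<^sup>2 \<le> B" unfolding D_def using B(2) by (simp add: ennreal_le_iff)
      then have "(cmod (u j \<phi> - u (Suc j) \<phi>))\<^sup>2 \<le> B / 2 ^ j" by (simp add: field_simps)
      then have "cmod (u j \<phi> - u (Suc j) \<phi>) \<le> sqrt (B / 2 ^ j)" by (rule real_le_rsqrt)
      then show ?thesis by (simp add: real_sqrt_divide real_sqrt_power power_divide norm_minus_commute)
    qed
    have "summable (\<lambda>j. u (Suc j) \<phi> - u j \<phi>)"
      using bd by (intro summable_comparison_test[OF _ summable_mult[OF summable_geometric[of "1 / sqrt 2"], of "sqrt B"]]) auto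
    then have "convergent (\<lambda>n. \<Sum>j<n. u (Suc j) \<phi> - u j \<phi>)" by (simp add: summable_iff_convergent)
    then have "convergent (\<lambda>n. u n \<phi> - u 0 \<phi>)" by (simp add: sum_lessThan_telescope[of "\<lambda>n. u n \<phi>"])
    then obtain l where "(\<lambda>n. u n \<phi> - u 0 \<phi>) \<longlonglongrightarrow> l" by (auto simp: convergent_def)
    then have "(\<lambda>n. (u n \<phi> - u 0 \<phi>) + u 0 \<phi>) \<longlonglongrightarrow> l + u 0 \<phi>" by (intro tendsto_intros)
    then show ?thesis by (auto simp: convergent_def)
  qed
  ultimately have AE: "AE \<phi> in ?M. (\<lambda>j. u j \<phi>) \<longlonglongrightarrow> lim (\<lambda>j. u j \<phi>)"
    by (auto simp: convergent_LIMSEQ_iff[symmetric])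
  define h where "h = (\<lambda>\<phi>. lim (\<lambda>j. u j \<phi>))"
  have hm[measurable]: "h \<in> borel_measurable ?M"
    unfolding h_def by (intro borel_measurable_lim_metric) auto
  have le: "(\<integral>\<^sup>+\<phi>. ennreal ((cmod (u j \<phi> - h \<phi>))\<^sup>2) \<partial>?M) \<le> ennreal (2 * pi * (1 / 4) ^ j)" for j
  proof -
    have "(\<integral>\<^sup>+\<phi>. ennreal ((cmod (u j \<phi> - h \<phi>))\<^sup>2) \<partial>?M)
        = (\<integral>\<^sup>+\<phi>. liminf (\<lambda>i. ennreal ((cmod (u j \<phi> - u i \<phi>))\<^sup>2)) \<partial>?M)"
    proof (rule nn_integral_cong_AE)
      show "AE \<phi> in ?M. ennreal ((cmod (u j \<phi> - h \<phi>))\<^sup>2) = liminf (\<lambda>i. ennreal ((cmod (u j \<phi> - u i \<phi>))\<^sup>2))"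
        using AE
      proof eventually_elim
        case (elim \<phi>)
        then have "(\<lambda>i. ennreal ((cmod (u j \<phi> - u i \<phi>))\<^sup>2)) \<longlonglongrightarrow> ennreal ((cmod (u j \<phi> - h \<phi>))\<^sup>2)"
          unfolding h_def by (intro tendsto_intros)
        then show ?case by (intro lim_imp_Liminf[symmetric]) auto
      qed
    qed
    also have "\<dots> \<le> liminf (\<lambda>i. \<integral>\<^sup>+\<phi>. ennreal ((cmod (u j \<phi> - u i \<phi>))\<^sup>2) \<partial>?M)"
      by (intro nn_integral_liminf) auto
    also have "\<dots> \<le> liminf (\<lambda>i. ennreal (2 * pi * (1 / 4) ^ j))"
    proof (rule Liminf_mono)
      show "\<forall>\<^sub>F i in sequentially. (\<integral>\<^sup>+\<phi>. ennreal ((cmod (u j \<phi> - u i \<phi>))\<^sup>2) \<partial>?M) \<le> ennreal (2 * pi * (1 / 4) ^ j)"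
        using eventually_ge_at_top[of j]
      proof eventually_elim
        case (elim i)
        then show ?case using C[OF elim] unfolding nn_integral_circle_eq_ms[OF circle_L2_diff[OF L2 L2]]
          by (intro ennreal_leI mult_left_mono) auto
      qed
    qed
    also have "\<dots> = ennreal (2 * pi * (1 / 4) ^ j)" by (intro lim_imp_Liminf) auto
    finally show ?thesis .
  qed
  have dL2: "(\<lambda>\<phi>. u j \<phi> - h \<phi>) \<in> circle_L2" for j
    unfolding circle_L2_def using le[of j] by (auto intro!: integrableI_bounded order.strict_trans1[OF le[of j]])
  have "h \<in> circle_L2" using circle_L2_diff[OF L2[of 0] dL2[of 0]] by simp
  moreover have "msq (\<lambda>\<phi>. u j \<phi> - h \<phi>) \<le> (1 / 4) ^ j" for j
    using le[of j] unfolding nn_integral_circle_eq_ms[OF dL2] by (simp add: ennreal_le_iff)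
  ultimately show ?thesis by blast
qed

section \<open>Boundary values and norms of Hardy functions\<close>

definition circle_slice :: "(complex \<Rightarrow> complex) \<Rightarrow> real \<Rightarrow> real \<Rightarrow> complex" where
  "circle_slice f r = (\<lambda>\<phi>. f (rcis r \<phi>))"

definition annulus_coeff :: "real \<Rightarrow> real \<Rightarrow> (complex \<Rightarrow> complex) \<Rightarrow> int \<Rightarrow> complex" where
  "annulus_coeff a b f = laurent_coeff f ((a + b) / 2)"

text \<open>In Parseval's identity for the two boundary circles together, this is the factor of \<open>|c n|\<^sup>2\<close>.\<close>

definition annulus_weight :: "real \<Rightarrow> real \<Rightarrow> int \<Rightarrow> real" where
  "annulus_weight a b n = (a powi n)\<^sup>2 + (b powi n)\<^sup>2"

lemma rcis_powi: "rcis r \<phi> powi n = of_real (r powi n) * cis (of_int n * \<phi>)"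
  by (simp add: rcis_def power_int_mult_distrib cis_power_int of_real_power_int)

lemma powi_le_max:
  fixes a b r :: real
  assumes "0 < a" "a \<le> r" "r \<le> b"
  shows "r powi n \<le> max (a powi n) (b powi n)"
proof (cases "n \<ge> 0")
  case True
  then have "r powi n \<le> b powi n" using assms by (intro power_int_mono) auto
  then show ?thesis by simp
next
  case False
  then have "r powi n \<le> a powi n" using assms by (intro power_int_antimono) auto
  then show ?thesis by simp
qed

text \<open>According to the sign of \<open>n\<close> the function \<open>r \<mapsto> r powi n\<close> is monotone one way or the other, so its
  values lie between \<open>0\<close> and the larger of the values at \<open>a\<close> and \<open>b\<close>. Thus one summable majorant serves
  for all radii up to the boundary.\<close>

lemma powi_diff_sq_le_weight:
  assumes "0 < a" "a \<le> r" "r \<le> b" "a \<le> s" "s \<le> b"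
  shows "(r powi n - s powi n)\<^sup>2 \<le> annulus_weight a b n"
proof -
  let ?m = "max (a powi n) (b powi n)"
  have "0 \<le> r powi n" "0 \<le> s powi n" using assms by auto
  moreover have "r powi n \<le> ?m" "s powi n \<le> ?m" using assms powi_le_max by blast+
  ultimately have "\<bar>r powi n - s powi n\<bar> \<le> ?m" by linarith
  then have "(r powi n - s powi n)\<^sup>2 \<le> ?m\<^sup>2" by (metis abs_ge_zero power2_abs power_mono)
  also have "\<dots> \<le> annulus_weight a b n" by (auto simp: annulus_weight_def max_def)
  finally show ?thesis .
qed

lemma powi_sq_le_weight:
  assumes "0 < a" "a \<le> r" "r \<le> b"
  shows "(r powi n)\<^sup>2 \<le> annulus_weight a b n"
proof -
  let ?m = "max (a powi n) (b powi n)"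
  have "(r powi n)\<^sup>2 \<le> ?m\<^sup>2" using powi_le_max[OF assms] assms by (intro power_mono) auto
  also have "\<dots> \<le> annulus_weight a b n" by (auto simp: annulus_weight_def max_def)
  finally show ?thesis .
qed

lemma at_end_within_nontrivial:
  fixes a b s :: real
  assumes "a < b" "s = a \<or> s = b"
  shows "at s within {a<..<b} \<noteq> bot"
proof -
  have "s islimpt {a<..<b}"
    using assms islimpt_greaterThanLessThan1 islimpt_greaterThanLessThan2 by blast
  then show ?thesis by (simp add: trivial_limit_within)
qed

text \<open>By the Weierstrass test; it allows to pass to the boundary circles in sums over Laurent
  coefficients.\<close>

lemma continuous_on_infsum:
  fixes g :: "'i \<Rightarrow> real \<Rightarrow> real"
  assumes "\<And>n. continuous_on S (g n)" "\<And>n r. r \<in> S \<Longrightarrow> \<bar>g n r\<bar> \<le> M n" "M summable_on UNIV"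
  shows "continuous_on S (\<lambda>r. \<Sum>\<^sub>\<infinity>n. g n r)"
proof (rule uniform_limit_theorem)
  show "uniform_limit S (\<lambda>X y. \<Sum>x\<in>X. g x y) (\<lambda>y. \<Sum>\<^sub>\<infinity>x. g x y) (finite_subsets_at_top UNIV)"
    by (rule Weierstrass_m_test_general) (use assms in auto)
  show "\<forall>\<^sub>F X in finite_subsets_at_top UNIV. continuous_on S (\<lambda>y. \<Sum>x\<in>X. g x y)"
    by (intro always_eventually allI continuous_intros assms)
qed auto

locale hardy_annulus =
  fixes a b :: real
  assumes a_pos: "0 < a" and a_less_b: "a < b"
begin

abbreviation "c \<equiv> annulus_coeff a b"
abbreviation "W \<equiv> annulus_weight a b"

lemma circle_slice_has_sum:
  assumes "f holomorphic_on annulus a b" "a < r" "r < b"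
  shows "((\<lambda>n. (c f n * of_real (r powi n)) * cis (of_int n * \<phi>)) has_sum circle_slice f r \<phi>) UNIV"
proof -
  have "rcis r \<phi> \<in> annulus a b" using assms a_pos by (simp add: annulus_def)
  from annulus_Laurent_expansion[OF _ assms(1) _ _ this, of "(a + b) / 2"] show ?thesis
    using a_pos a_less_b by (simp add: rcis_powi circle_slice_def annulus_coeff_def mult.assoc)
qed

lemma circle_coeff_summable:
  assumes "f holomorphic_on annulus a b" "a < r" "r < b"
  shows "(\<lambda>n. c f n * of_real (r powi n)) summable_on UNIV"
  using circle_slice_has_sum[OF assms, of 0] by (auto simp: summable_on_def)

lemma circle_slice_L2:
  assumes "f holomorphic_on annulus a b" "a < r" "r < b"
  shows "circle_slice f r \<in> circle_L2"
  using Parseval_has_sum(2)[OF circle_coeff_summable circle_slice_has_sum] assms by blast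

lemma msq_circle_slice:
  assumes "f holomorphic_on annulus a b" "a < r" "r < b"
  shows "((\<lambda>n. (cmod (c f n))\<^sup>2 * (r powi n)\<^sup>2) has_sum msq (circle_slice f r)) UNIV"
  using Parseval_has_sum(1)[OF circle_coeff_summable[OF assms] circle_slice_has_sum[OF assms]]
  by (simp only: norm_mult power_mult_distrib norm_of_real power2_abs)

lemma msq_circle_slice_diff:
  assumes "f holomorphic_on annulus a b" "a < r" "r < b" "a < s" "s < b"
  shows "((\<lambda>n. (cmod (c f n))\<^sup>2 * (r powi n - s powi n)\<^sup>2) has_sum msq (\<lambda>\<phi>. circle_slice f r \<phi> - circle_slice f s \<phi>)) UNIV"
proof -
  let ?d = "\<lambda>n. c f n * of_real (r powi n - s powi n)"
  have "((\<lambda>n. ?d n * cis (of_int n * \<phi>)) has_sum (circle_slice f r \<phi> - circle_slice f s \<phi>)) UNIV" for \<phi>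
    using has_sum_add[OF circle_slice_has_sum[OF assms(1-3), of \<phi>] has_sum_cmult_right[OF circle_slice_has_sum[OF assms(1,4,5), of \<phi>], of "-1"]]
    by (simp add: algebra_simps)
  moreover from this[of 0] have "?d summable_on UNIV" by (auto simp: summable_on_def)
  ultimately have "((\<lambda>n. (cmod (?d n))\<^sup>2) has_sum msq (\<lambda>\<phi>. circle_slice f r \<phi> - circle_slice f s \<phi>)) UNIV"
    by (rule Parseval_has_sum(1)[rotated])
  then show ?thesis by (simp only: norm_mult power_mult_distrib norm_of_real power2_abs)
qed

lemma H2_iff: "f \<in> H2 a b \<longleftrightarrow> f holomorphic_on annulus a b \<and> (\<exists>B. \<forall>r\<in>{a<..<b}. msq (circle_slice f r) \<le> B)"
  by (auto simp: H2_def msq_def circle_slice_def bdd_above_def)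

lemma H2_holomorphic: "f \<in> H2 a b \<Longrightarrow> f holomorphic_on annulus a b"
  by (simp add: H2_def)

text \<open>Each finite part of the Parseval sum at radius \<open>r\<close> is at most the bound of the Hardy condition, and
  finite parts are continuous up to \<open>r = a\<close> and \<open>r = b\<close>.\<close>

lemma H2_coeff_summable:
  assumes "f \<in> H2 a b"
  shows "(\<lambda>n. (cmod (c f n))\<^sup>2 * W n) summable_on UNIV"
proof -
  have hol: "f holomorphic_on annulus a b" using assms by (rule H2_holomorphic)
  obtain B where B: "\<And>r. r \<in> {a<..<b} \<Longrightarrow> msq (circle_slice f r) \<le> B" using assms H2_iff by blast
  have bd: "(\<Sum>n\<in>X. (cmod (c f n))\<^sup>2 * (s powi n)\<^sup>2) \<le> B" if "finite X" "s = a \<or> s = b" for X s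
  proof (rule tendsto_upperbound)
    have "s \<noteq> 0" using that a_pos a_less_b by auto
    then show "((\<lambda>r. \<Sum>n\<in>X. (cmod (c f n))\<^sup>2 * (r powi n)\<^sup>2) \<longlongrightarrow> (\<Sum>n\<in>X. (cmod (c f n))\<^sup>2 * (s powi n)\<^sup>2)) (at s within {a<..<b})"
      by (intro tendsto_intros) auto
    have "(\<Sum>n\<in>X. (cmod (c f n))\<^sup>2 * (r powi n)\<^sup>2) \<le> B" if "r \<in> {a<..<b}" for r
    proof -
      have hs: "((\<lambda>n. (cmod (c f n))\<^sup>2 * (r powi n)\<^sup>2) has_sum msq (circle_slice f r)) UNIV"
        using msq_circle_slice[OF hol] that by auto
      have "(\<Sum>n\<in>X. (cmod (c f n))\<^sup>2 * (r powi n)\<^sup>2) \<le> msq (circle_slice f r)"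
        using has_sum_mono_neutral[OF has_sum_finite[OF \<open>finite X\<close>, of "\<lambda>n. (cmod (c f n))\<^sup>2 * (r powi n)\<^sup>2"] hs] by auto
      then show ?thesis using B[OF that] by simp
    qed
    then show "\<forall>\<^sub>F r in at s within {a<..<b}. (\<Sum>n\<in>X. (cmod (c f n))\<^sup>2 * (r powi n)\<^sup>2) \<le> B"
      by (auto simp: eventually_at_filter intro!: always_eventually)
  qed (use at_end_within_nontrivial[OF a_less_b] that in auto)
  show ?thesis
  proof (rule nonneg_bdd_above_summable_on)
    show "bdd_above (sum (\<lambda>n. (cmod (c f n))\<^sup>2 * W n) ` {F. F \<subseteq> UNIV \<and> finite F})"
    proof (rule bdd_aboveI2)
      fix X :: "int set" assume "X \<in> {F. F \<subseteq> UNIV \<and> finite F}"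
      then show "(\<Sum>n\<in>X. (cmod (c f n))\<^sup>2 * W n) \<le> B + B"
        unfolding annulus_weight_def distrib_left sum.distrib by (intro add_mono bd) auto
    qed
  qed (auto simp: annulus_weight_def)
qed

text \<open>The square mean of the difference between the slice at \<open>r\<close> and the boundary value at \<open>s\<close>, written in
  Laurent coefficients so that it makes sense before the boundary value is known to exist.\<close>

definition slice_gap :: "(complex \<Rightarrow> complex) \<Rightarrow> real \<Rightarrow> real \<Rightarrow> real" where
  "slice_gap f s r = (\<Sum>\<^sub>\<infinity>n. (cmod (c f n))\<^sup>2 * (r powi n - s powi n)\<^sup>2)"

lemma slice_gap_summable:
  assumes "f \<in> H2 a b" "r \<in> {a..b}" "s \<in> {a..b}"
  shows "(\<lambda>n. (cmod (c f n))\<^sup>2 * (r powi n - s powi n)\<^sup>2) summable_on UNIV"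
  using H2_coeff_summable[OF assms(1)]
  by (rule summable_on_comparison_test) (use assms a_pos in \<open>auto intro!: mult_left_mono powi_diff_sq_le_weight\<close>)

lemma slice_gap_tendsto_0:
  assumes "f \<in> H2 a b" "s \<in> {a..b}"
  shows "(slice_gap f s \<longlongrightarrow> 0) (at s within {a<..<b})"
proof -
  have "continuous_on {a..b} (slice_gap f s)"
    unfolding slice_gap_def
  proof (rule continuous_on_infsum)
    show "continuous_on {a..b} (\<lambda>r. (cmod (c f n))\<^sup>2 * (r powi n - s powi n)\<^sup>2)" for n
      using a_pos by (intro continuous_intros) auto
    show "\<bar>(cmod (c f n))\<^sup>2 * (r powi n - s powi n)\<^sup>2\<bar> \<le> (cmod (c f n))\<^sup>2 * W n" if "r \<in> {a..b}" for n r
      using that assms a_pos by (auto simp: abs_mult intro!: mult_left_mono powi_diff_sq_le_weight)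
  qed (rule H2_coeff_summable[OF assms(1)])
  then have "(slice_gap f s \<longlongrightarrow> slice_gap f s s) (at s within {a..b})"
    using assms by (simp add: continuous_on_def)
  then have "(slice_gap f s \<longlongrightarrow> slice_gap f s s) (at s within {a<..<b})"
    by (rule tendsto_within_subset) auto
  then show ?thesis by (simp add: slice_gap_def)
qed

lemma msq_slice_diff_le:
  assumes "f \<in> H2 a b" "s \<in> {a..b}" "r \<in> {a<..<b}" "t \<in> {a<..<b}"
  shows "msq (\<lambda>\<phi>. circle_slice f r \<phi> - circle_slice f t \<phi>) \<le> 2 * slice_gap f s r + 2 * slice_gap f s t"
proof -
  have le: "(x - y)\<^sup>2 \<le> 2 * (x - z)\<^sup>2 + 2 * (y - z)\<^sup>2" for x y z :: real
    using zero_le_power2[of "x + y - 2 * z"] by (simp add: power2_eq_square algebra_simps)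
  have 1: "((\<lambda>n. (cmod (c f n))\<^sup>2 * (r powi n - t powi n)\<^sup>2) has_sum msq (\<lambda>\<phi>. circle_slice f r \<phi> - circle_slice f t \<phi>)) UNIV"
    using msq_circle_slice_diff[OF H2_holomorphic[OF assms(1)], of r t] assms by auto
  have g: "((\<lambda>n. (cmod (c f n))\<^sup>2 * (x powi n - s powi n)\<^sup>2) has_sum slice_gap f s x) UNIV" if "x \<in> {a<..<b}" for x
    unfolding slice_gap_def using that by (intro has_sum_infsum slice_gap_summable assms) auto
  have 2: "((\<lambda>n. 2 * ((cmod (c f n))\<^sup>2 * (r powi n - s powi n)\<^sup>2) + 2 * ((cmod (c f n))\<^sup>2 * (t powi n - s powi n)\<^sup>2)) has_sum
      2 * slice_gap f s r + 2 * slice_gap f s t) UNIV"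
    by (intro has_sum_add has_sum_cmult_right g assms)
  show ?thesis
  proof (rule has_sum_mono[OF 1 2])
    fix n
    show "(cmod (c f n))\<^sup>2 * (r powi n - t powi n)\<^sup>2 \<le> 2 * ((cmod (c f n))\<^sup>2 * (r powi n - s powi n)\<^sup>2) + 2 * ((cmod (c f n))\<^sup>2 * (t powi n - s powi n)\<^sup>2)"
      using mult_left_mono[OF le[of "r powi n" "t powi n" "s powi n"], of "(cmod (c f n))\<^sup>2"] by (simp add: algebra_simps)
  qed
qed

lemma is_boundary_value_iff:
  "is_boundary_value a b f s h \<longleftrightarrow> h \<in> circle_L2 \<and>
     ((\<lambda>r. msq (\<lambda>\<phi>. circle_slice f r \<phi> - h \<phi>)) \<longlongrightarrow> 0) (at s within {a<..<b})"
  unfolding is_boundary_value_def circle_L2_iff msq_def circle_slice_def by blast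

text \<open>Along radii \<open>r j\<close> chosen with \<open>slice_gap f s (r j) \<le> (1 / 4) ^ (j + 1)\<close> the slices form a sequence
  to which \<open>circle_Riesz_Fischer\<close> applies. Convergence along all radii follows by comparison with
  \<open>r j\<close>, as \<open>slice_gap f s\<close> tends to \<open>0\<close> at \<open>s\<close>.\<close>

lemma boundary_value_exists:
  assumes f: "f \<in> H2 a b" and s: "s = a \<or> s = b"
  shows "\<exists>h. is_boundary_value a b f s h"
proof -
  have s': "s \<in> {a..b}" using s a_less_b by auto
  let ?F = "at s within {a<..<b}"
  have nt: "?F \<noteq> bot" using at_end_within_nontrivial[OF a_less_b s] .
  have "\<exists>r\<in>{a<..<b}. slice_gap f s r \<le> (1 / 4) ^ Suc j" for j
  proof -
    have "\<forall>\<^sub>F r in ?F. slice_gap f s r < (1 / 4) ^ Suc j"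
      by (rule order_tendstoD(2)[OF slice_gap_tendsto_0[OF f s']]) auto
    then have "\<forall>\<^sub>F r in ?F. slice_gap f s r < (1 / 4) ^ Suc j \<and> r \<in> {a<..<b}"
      by (auto simp: eventually_at_filter elim: eventually_mono)
    from eventually_happens'[OF nt this] obtain r where "slice_gap f s r < (1 / 4) ^ Suc j" "r \<in> {a<..<b}" by blast
    then show ?thesis by (intro bexI[of _ r] less_imp_le)
  qed
  then obtain r where r: "\<And>j. r j \<in> {a<..<b}" "\<And>j. slice_gap f s (r j) \<le> (1 / 4) ^ Suc j" by metis
  have L2: "circle_slice f t \<in> circle_L2" if "t \<in> {a<..<b}" for t
    using circle_slice_L2[OF H2_holomorphic[OF f]] that by auto
  have "msq (\<lambda>\<phi>. circle_slice f (r j) \<phi> - circle_slice f (r i) \<phi>) \<le> (1 / 4) ^ j" if "j \<le> i" for i j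
  proof -
    have "slice_gap f s (r i) \<le> (1 / 4) ^ Suc j"
      by (rule order_trans[OF r(2)[of i] power_decreasing]) (use that in auto)
    then show ?thesis using msq_slice_diff_le[OF f s' r(1)[of j] r(1)[of i]] r(2)[of j] by simp
  qed
  from circle_Riesz_Fischer[OF L2[OF r(1)] this]
  obtain h where h: "h \<in> circle_L2" "\<And>j. msq (\<lambda>\<phi>. circle_slice f (r j) \<phi> - h \<phi>) \<le> (1 / 4) ^ j" by blast
  have le: "msq (\<lambda>\<phi>. circle_slice f t \<phi> - h \<phi>) \<le> 4 * slice_gap f s t" if t: "t \<in> {a<..<b}" for t
  proof (rule tendsto_lowerbound)
    have "(\<lambda>j. 4 * slice_gap f s t + 3 * (1 / 4) ^ j) \<longlonglongrightarrow> 4 * slice_gap f s t + 3 * 0"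
      by (intro tendsto_intros LIMSEQ_realpow_zero) auto
    then show "(\<lambda>j. 4 * slice_gap f s t + 3 * (1 / 4) ^ j) \<longlonglongrightarrow> 4 * slice_gap f s t" by simp
    have "msq (\<lambda>\<phi>. circle_slice f t \<phi> - h \<phi>) \<le> 4 * slice_gap f s t + 3 * (1 / 4) ^ j" for j
    proof -
      have "msq (\<lambda>\<phi>. circle_slice f t \<phi> - h \<phi>) = msq (\<lambda>\<phi>. (circle_slice f t \<phi> - circle_slice f (r j) \<phi>) + (circle_slice f (r j) \<phi> - h \<phi>))"
        by simp
      also have "\<dots> \<le> 2 * msq (\<lambda>\<phi>. circle_slice f t \<phi> - circle_slice f (r j) \<phi>) + 2 * msq (\<lambda>\<phi>. circle_slice f (r j) \<phi> - h \<phi>)"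
        by (intro msq_add_le circle_L2_diff L2 r t h)
      also have "\<dots> \<le> 2 * (2 * slice_gap f s t + 2 * slice_gap f s (r j)) + 2 * (1 / 4) ^ j"
        by (intro add_mono mult_left_mono msq_slice_diff_le f s' t r h) auto
      also have "\<dots> \<le> 4 * slice_gap f s t + 3 * (1 / 4) ^ j" using r(2)[of j] by simp
      finally show ?thesis .
    qed
    then show "\<forall>\<^sub>F j in sequentially. msq (\<lambda>\<phi>. circle_slice f t \<phi> - h \<phi>) \<le> 4 * slice_gap f s t + 3 * (1 / 4) ^ j" by simp
  qed auto
  have "((\<lambda>r. msq (\<lambda>\<phi>. circle_slice f r \<phi> - h \<phi>)) \<longlongrightarrow> 0) ?F"
  proof (rule Lim_null_comparison)
    show "\<forall>\<^sub>F t in ?F. norm (msq (\<lambda>\<phi>. circle_slice f t \<phi> - h \<phi>)) \<le> 4 * slice_gap f s t"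
      using le msq_nonneg by (auto simp: eventually_at_filter intro!: always_eventually)
    show "((\<lambda>t. 4 * slice_gap f s t) \<longlongrightarrow> 0) ?F"
      using tendsto_mult_right_zero[OF slice_gap_tendsto_0[OF f s'], of 4] by simp
  qed
  then show ?thesis using h(1) is_boundary_value_iff by blast
qed

lemma boundary_value:
  assumes f: "f \<in> H2 a b" and s: "s = a \<or> s = b"
  shows "boundary_value a b f s \<in> circle_L2"
    "((\<lambda>r. msq (\<lambda>\<phi>. circle_slice f r \<phi> - boundary_value a b f s \<phi>)) \<longlongrightarrow> 0) (at s within {a<..<b})"
  using someI_ex[OF boundary_value_exists[OF assms]] unfolding boundary_value_def is_boundary_value_iff by blast+

definition slice_inner :: "(complex \<Rightarrow> complex) \<Rightarrow> (complex \<Rightarrow> complex) \<Rightarrow> real \<Rightarrow> complex" where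
  "slice_inner f g r = angle_mean (\<lambda>\<phi>. circle_slice f r \<phi> * cnj (circle_slice g r \<phi>))"

definition boundary_inner :: "(complex \<Rightarrow> complex) \<Rightarrow> (complex \<Rightarrow> complex) \<Rightarrow> real \<Rightarrow> complex" where
  "boundary_inner f g s = angle_mean (\<lambda>\<phi>. boundary_value a b f s \<phi> * cnj (boundary_value a b g s \<phi>))"

lemma eventually_slice_L2:
  assumes "f \<in> H2 a b"
  shows "\<forall>\<^sub>F r in at s within {a<..<b}. circle_slice f r \<in> circle_L2"
  using circle_slice_L2[OF H2_holomorphic[OF assms]] by (auto simp: eventually_at_filter intro!: always_eventually)

text \<open>Boundary values are chosen and only determined up to null sets. Inner products of slices determine
  their inner products as limits, and the algebraic laws are obtained from those of the slices.\<close>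

lemma slice_inner_tendsto:
  assumes "f \<in> H2 a b" "g \<in> H2 a b" "s = a \<or> s = b"
  shows "(slice_inner f g \<longlongrightarrow> boundary_inner f g s) (at s within {a<..<b})"
  unfolding slice_inner_def boundary_inner_def using assms
  by (intro angle_mean_mult_cnj_tendsto eventually_slice_L2 boundary_value)

lemma H2_inner_eq: "H2_inner a b f g = boundary_inner f g a + boundary_inner f g b"
  by (simp add: H2_inner_def boundary_inner_def)

lemma boundary_inner_eqI:
  assumes "f \<in> H2 a b" "g \<in> H2 a b" "s = a \<or> s = b" "(slice_inner f g \<longlongrightarrow> l) (at s within {a<..<b})"
  shows "boundary_inner f g s = l"
  using tendsto_unique[OF at_end_within_nontrivial[OF a_less_b assms(3)] slice_inner_tendsto[OF assms(1-3)] assms(4)] .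

lemma slice_inner_self: "slice_inner f f r = of_real (msq (circle_slice f r))"
  unfolding slice_inner_def by (rule angle_mean_mult_cnj_self)

lemma boundary_inner_self:
  assumes f: "f \<in> H2 a b" and s: "s = a \<or> s = b"
  shows "boundary_inner f f s = of_real (\<Sum>\<^sub>\<infinity>n. (cmod (c f n))\<^sup>2 * (s powi n)\<^sup>2)"
proof (rule boundary_inner_eqI[OF f f s])
  let ?g = "\<lambda>r. \<Sum>\<^sub>\<infinity>n. (cmod (c f n))\<^sup>2 * (r powi n)\<^sup>2"
  have "continuous_on {a..b} ?g"
  proof (rule continuous_on_infsum)
    show "continuous_on {a..b} (\<lambda>r. (cmod (c f n))\<^sup>2 * (r powi n)\<^sup>2)" for n
      using a_pos by (intro continuous_intros) auto
    show "\<bar>(cmod (c f n))\<^sup>2 * (r powi n)\<^sup>2\<bar> \<le> (cmod (c f n))\<^sup>2 * W n" if "r \<in> {a..b}" for n r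
      using that a_pos by (auto simp: abs_mult intro!: mult_left_mono powi_sq_le_weight)
  qed (rule H2_coeff_summable[OF f])
  then have "(?g \<longlongrightarrow> ?g s) (at s within {a..b})"
    using s a_less_b by (auto simp: continuous_on_def)
  then have "(?g \<longlongrightarrow> ?g s) (at s within {a<..<b})"
    by (rule tendsto_within_subset) auto
  then have "((\<lambda>r. complex_of_real (?g r)) \<longlongrightarrow> of_real (?g s)) (at s within {a<..<b})"
    by (intro tendsto_intros)
  then show "(slice_inner f f \<longlongrightarrow> of_real (?g s)) (at s within {a<..<b})"
  proof (rule Lim_transform_eventually)
    show "\<forall>\<^sub>F r in at s within {a<..<b}. complex_of_real (?g r) = slice_inner f f r"
      using msq_circle_slice[OF H2_holomorphic[OF f]]
      by (auto simp: eventually_at_filter slice_inner_self infsumI intro!: always_eventually)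
  qed
qed

lemma H2_norm_sq:
  assumes "f \<in> H2 a b"
  shows "((\<lambda>n. (cmod (c f n))\<^sup>2 * W n) has_sum (H2_norm a b f)\<^sup>2) UNIV"
    and "H2_inner a b f f = of_real ((H2_norm a b f)\<^sup>2)"
proof -
  have sm: "(\<lambda>n. (cmod (c f n))\<^sup>2 * (s powi n)\<^sup>2) summable_on UNIV" if "s \<in> {a..b}" for s
    using H2_coeff_summable[OF assms(1)]
    by (rule summable_on_comparison_test) (use that a_pos in \<open>auto intro!: mult_left_mono powi_sq_le_weight\<close>)
  have eq: "H2_inner a b f f = of_real (\<Sum>\<^sub>\<infinity>n. (cmod (c f n))\<^sup>2 * W n)"
    unfolding H2_inner_eq annulus_weight_def distrib_left
    using a_less_b by (subst infsum_add) (auto intro!: sm simp: boundary_inner_self[OF assms])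
  moreover have "0 \<le> (\<Sum>\<^sub>\<infinity>n. (cmod (c f n))\<^sup>2 * W n)" by (intro infsum_nonneg) (auto simp: annulus_weight_def)
  ultimately have n: "(H2_norm a b f)\<^sup>2 = (\<Sum>\<^sub>\<infinity>n. (cmod (c f n))\<^sup>2 * W n)"
    by (simp add: H2_norm_def)
  show "((\<lambda>n. (cmod (c f n))\<^sup>2 * W n) has_sum (H2_norm a b f)\<^sup>2) UNIV"
    unfolding n by (intro has_sum_infsum H2_coeff_summable assms)
  show "H2_inner a b f f = of_real ((H2_norm a b f)\<^sup>2)" using eq n by simp
qed

section \<open>The Hardy space of the annulus as an inner product space\<close>

lemma circle_slice_add: "circle_slice (f + g) r = (\<lambda>\<phi>. circle_slice f r \<phi> + circle_slice g r \<phi>)"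
  by (simp add: circle_slice_def)

lemma circle_slice_scale: "circle_slice (\<lambda>x. k * f x) r = (\<lambda>\<phi>. k * circle_slice f r \<phi>)"
  by (simp add: circle_slice_def)

lemma msq_scale: "msq (\<lambda>\<phi>. k * h \<phi>) = (cmod k)\<^sup>2 * msq h"
  by (simp add: msq_def norm_mult power_mult_distrib angle_mean_cmult)

lemma H2_add:
  assumes "f \<in> H2 a b" "g \<in> H2 a b"
  shows "f + g \<in> H2 a b"
proof -
  obtain B B' where B: "\<forall>r\<in>{a<..<b}. msq (circle_slice f r) \<le> B" "\<forall>r\<in>{a<..<b}. msq (circle_slice g r) \<le> B'"
    using assms H2_iff by blast
  have "msq (circle_slice (f + g) r) \<le> 2 * B + 2 * B'" if "r \<in> {a<..<b}" for r
  proof -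
    have "msq (circle_slice (f + g) r) \<le> 2 * msq (circle_slice f r) + 2 * msq (circle_slice g r)"
      unfolding circle_slice_add using that assms by (intro msq_add_le circle_slice_L2 H2_holomorphic) auto
    also have "\<dots> \<le> 2 * B + 2 * B'" using B that by (intro add_mono mult_left_mono) auto
    finally show ?thesis .
  qed
  moreover have "f + g holomorphic_on annulus a b"
    unfolding plus_fun_def using assms by (intro holomorphic_intros H2_holomorphic)
  ultimately show ?thesis using H2_iff by blast
qed

lemma H2_scale:
  assumes "f \<in> H2 a b"
  shows "(\<lambda>x. k * f x) \<in> H2 a b"
proof -
  obtain B where B: "\<forall>r\<in>{a<..<b}. msq (circle_slice f r) \<le> B"
    using assms H2_iff by blast
  then have "\<forall>r\<in>{a<..<b}. msq (circle_slice (\<lambda>x. k * f x) r) \<le> (cmod k)\<^sup>2 * B"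
    unfolding circle_slice_scale msq_scale by (auto intro: mult_left_mono)
  moreover have "(\<lambda>x. k * f x) holomorphic_on annulus a b"
    using assms by (intro holomorphic_intros H2_holomorphic)
  ultimately show ?thesis using H2_iff by blast
qed

lemma H2_zero: "0 \<in> H2 a b"
proof -
  have "msq (circle_slice 0 r) = 0" for r by (simp add: msq_def circle_slice_def angle_mean_const)
  then show ?thesis unfolding H2_iff by (auto simp: zero_fun_def)
qed

lemma diff_eq_add_scale: "f - g = f + (\<lambda>x. (-1) * g x)" for f g :: "'x \<Rightarrow> complex"
  by (simp add: fun_eq_iff)

lemma H2_diff: "f \<in> H2 a b \<Longrightarrow> g \<in> H2 a b \<Longrightarrow> f - g \<in> H2 a b"
  unfolding diff_eq_add_scale by (intro H2_add H2_scale)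

lemma H2_inner_add_left:
  assumes "f \<in> H2 a b" "g \<in> H2 a b" "h \<in> H2 a b"
  shows "H2_inner a b (f + g) h = H2_inner a b f h + H2_inner a b g h"
proof -
  have "boundary_inner (f + g) h s = boundary_inner f h s + boundary_inner g h s" if s: "s = a \<or> s = b" for s
  proof (rule boundary_inner_eqI[OF H2_add[OF assms(1,2)] assms(3) s])
    show "(slice_inner (f + g) h \<longlongrightarrow> boundary_inner f h s + boundary_inner g h s) (at s within {a<..<b})"
    proof (rule Lim_transform_eventually)
      show "((\<lambda>r. slice_inner f h r + slice_inner g h r) \<longlongrightarrow> boundary_inner f h s + boundary_inner g h s) (at s within {a<..<b})"
        by (intro tendsto_add slice_inner_tendsto assms s)
      show "\<forall>\<^sub>F r in at s within {a<..<b}. slice_inner f h r + slice_inner g h r = slice_inner (f + g) h r"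
        using eventually_slice_L2[OF assms(1), of s] eventually_slice_L2[OF assms(2), of s] eventually_slice_L2[OF assms(3), of s]
        by eventually_elim (simp add: slice_inner_def circle_slice_add distrib_right angle_mean_add integrable_circle_mult_cnj)
    qed
  qed
  then show ?thesis by (simp add: H2_inner_eq)
qed

lemma H2_inner_scale_left:
  assumes "f \<in> H2 a b" "h \<in> H2 a b"
  shows "H2_inner a b (\<lambda>x. k * f x) h = k * H2_inner a b f h"
proof -
  have "boundary_inner (\<lambda>x. k * f x) h s = k * boundary_inner f h s" if s: "s = a \<or> s = b" for s
  proof (rule boundary_inner_eqI[OF H2_scale[OF assms(1)] assms(2) s])
    have "slice_inner (\<lambda>x. k * f x) h = (\<lambda>r. k * slice_inner f h r)"
      by (rule ext) (simp only: slice_inner_def circle_slice_scale mult.assoc angle_mean_cmult)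
    then show "(slice_inner (\<lambda>x. k * f x) h \<longlongrightarrow> k * boundary_inner f h s) (at s within {a<..<b})"
      using tendsto_mult_left[OF slice_inner_tendsto[OF assms s], of k] by simp
  qed
  then show ?thesis by (simp add: H2_inner_eq distrib_left)
qed

lemma H2_inner_cnj: "H2_inner a b g f = cnj (H2_inner a b f g)"
  by (simp add: H2_inner_def angle_mean_cnj[symmetric] mult.commute)

lemma H2_norm_sq_boundary:
  assumes "f \<in> H2 a b"
  shows "(H2_norm a b f)\<^sup>2 = msq (boundary_value a b f a) + msq (boundary_value a b f b)"
proof -
  have "complex_of_real ((H2_norm a b f)\<^sup>2) = of_real (msq (boundary_value a b f a) + msq (boundary_value a b f b))"
    using H2_norm_sq(2)[OF assms] unfolding H2_inner_def angle_mean_mult_cnj_self by simp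
  then show ?thesis using of_real_eq_iff by blast
qed

lemma H2_norm_nonneg:
  assumes "f \<in> H2 a b"
  shows "0 \<le> H2_norm a b f"
proof -
  have "0 \<le> Re (H2_inner a b f f)"
    by (simp only: H2_norm_sq(2)[OF assms] Re_complex_of_real zero_le_power2)
  then show ?thesis by (simp add: H2_norm_def)
qed

lemma H2_inner_le:
  assumes "f \<in> H2 a b" "g \<in> H2 a b"
  shows "cmod (H2_inner a b f g) \<le> ((H2_norm a b f)\<^sup>2 + (H2_norm a b g)\<^sup>2) / 2"
proof -
  have le: "cmod (angle_mean (\<lambda>\<phi>. x \<phi> * cnj (y \<phi>))) \<le> (msq x + msq y) / 2" if "x \<in> circle_L2" "y \<in> circle_L2" for x y
    using angle_mean_Cauchy_Schwarz[OF that] arith_geo_mean_sqrt[OF msq_nonneg[of x] msq_nonneg[of y]] real_le_rsqrt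
    by (meson order_trans)
  show ?thesis
    unfolding H2_norm_sq_boundary[OF assms(1)] H2_norm_sq_boundary[OF assms(2)] H2_inner_def
    using le[OF boundary_value(1)[OF assms(1)] boundary_value(1)[OF assms(2)], of a a]
      le[OF boundary_value(1)[OF assms(1)] boundary_value(1)[OF assms(2)], of b b]
    by (intro norm_triangle_le) (simp add: add_divide_distrib)
qed

lemma H2_norm_scale_sq:
  assumes "f \<in> H2 a b"
  shows "(H2_norm a b (\<lambda>x. k * f x))\<^sup>2 = (cmod k)\<^sup>2 * (H2_norm a b f)\<^sup>2"
proof -
  have "complex_of_real ((H2_norm a b (\<lambda>x. k * f x))\<^sup>2) = k * H2_inner a b f (\<lambda>x. k * f x)"
    using H2_norm_sq(2)[OF H2_scale[OF assms], of k] H2_inner_scale_left[OF assms H2_scale[OF assms]] by simp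
  also have "\<dots> = k * cnj (H2_inner a b (\<lambda>x. k * f x) f)" by (subst H2_inner_cnj) simp
  also have "\<dots> = k * cnj k * cnj (H2_inner a b f f)"
    using H2_inner_scale_left[OF assms assms] by simp
  also have "\<dots> = of_real ((cmod k)\<^sup>2 * (H2_norm a b f)\<^sup>2)"
    unfolding H2_norm_sq(2)[OF assms] by (simp only: of_real_mult complex_norm_square complex_cnj_complex_of_real)
  finally show ?thesis using of_real_eq_iff by blast
qed

text \<open>For the topological arguments below this takes the place of the triangle inequality.\<close>

lemma H2_norm_add_sq_le:
  assumes f: "f \<in> H2 a b" and g: "g \<in> H2 a b"
  shows "(H2_norm a b (f + g))\<^sup>2 \<le> 2 * (H2_norm a b f)\<^sup>2 + 2 * (H2_norm a b g)\<^sup>2"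
proof -
  note H = H2_add[OF f g]
  have right: "H2_inner a b x (f + g) = H2_inner a b x f + H2_inner a b x g" if "x \<in> H2 a b" for x
    using H2_inner_add_left[OF f g that] by (metis H2_inner_cnj complex_cnj_add complex_cnj_cnj)
  have "(H2_norm a b (f + g))\<^sup>2 = Re (H2_inner a b (f + g) (f + g))"
    by (simp add: H2_norm_sq(2)[OF H])
  also have "\<dots> = Re (H2_inner a b f f + H2_inner a b f g + (H2_inner a b g f + H2_inner a b g g))"
    by (simp add: H2_inner_add_left[OF f g H] right f g)
  also have "\<dots> = (H2_norm a b f)\<^sup>2 + Re (H2_inner a b f g) + Re (H2_inner a b g f) + (H2_norm a b g)\<^sup>2"
    by (simp add: H2_norm_sq(2) f g)
  also have "\<dots> \<le> 2 * (H2_norm a b f)\<^sup>2 + 2 * (H2_norm a b g)\<^sup>2"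
    using order_trans[OF complex_Re_le_cmod H2_inner_le[OF f g]] order_trans[OF complex_Re_le_cmod H2_inner_le[OF g f]] by argo
  finally show ?thesis .
qed

lemma H2_norm_diff_commute:
  assumes "f \<in> H2 a b" "g \<in> H2 a b"
  shows "(H2_norm a b (f - g))\<^sup>2 = (H2_norm a b (g - f))\<^sup>2"
proof -
  have "f - g = (\<lambda>x. (-1) * (g - f) x)" by (simp add: fun_eq_iff)
  then show ?thesis using H2_norm_scale_sq[OF H2_diff[OF assms(2,1)], of "-1"] by simp
qed

lemma annulus_cong_slice:
  assumes "\<And>z. z \<in> annulus a b \<Longrightarrow> f z = g z" "r \<in> {a<..<b}"
  shows "circle_slice f r = circle_slice g r"
  unfolding circle_slice_def using assms a_pos by (intro ext assms(1)) (auto simp: annulus_def)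

text \<open>The predicate that characterises boundary values sees \<open>f\<close> on the annulus only, so even the chosen
  boundary values coincide.\<close>

lemma boundary_value_cong:
  assumes "\<And>z. z \<in> annulus a b \<Longrightarrow> f z = g z"
  shows "boundary_value a b f s = boundary_value a b g s"
proof -
  have "is_boundary_value a b f s h = is_boundary_value a b g s h" for h
  proof -
    have "\<forall>\<^sub>F r in at s within {a<..<b}. msq (\<lambda>\<phi>. circle_slice f r \<phi> - h \<phi>) = msq (\<lambda>\<phi>. circle_slice g r \<phi> - h \<phi>)"
      using annulus_cong_slice[OF assms] by (auto simp: eventually_at_filter intro!: always_eventually)
    from tendsto_cong[OF this] show ?thesis unfolding is_boundary_value_iff by blast
  qed
  then show ?thesis by (simp add: boundary_value_def)
qed

lemma H2_inner_cong:
  assumes "\<And>z. z \<in> annulus a b \<Longrightarrow> f z = f' z" "\<And>z. z \<in> annulus a b \<Longrightarrow> g z = g' z"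
  shows "H2_inner a b f g = H2_inner a b f' g'"
  unfolding H2_inner_def using boundary_value_cong[of f f'] boundary_value_cong[of g g'] assms by simp

lemma H2_norm_cong:
  assumes "\<And>z. z \<in> annulus a b \<Longrightarrow> f z = f' z"
  shows "H2_norm a b f = H2_norm a b f'"
  unfolding H2_norm_def using H2_inner_cong[of f f' f f'] assms by simp

lemma msq_slice_le_norm:
  assumes f: "f \<in> H2 a b" and r: "r \<in> {a<..<b}"
  shows "msq (circle_slice f r) \<le> (H2_norm a b f)\<^sup>2"
proof (rule has_sum_mono[OF _ H2_norm_sq(1)[OF f]])
  show "((\<lambda>n. (cmod (c f n))\<^sup>2 * (r powi n)\<^sup>2) has_sum msq (circle_slice f r)) UNIV"
    using msq_circle_slice[OF H2_holomorphic[OF f]] r by simp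
qed (use r a_pos in \<open>auto intro!: mult_left_mono powi_sq_le_weight\<close>)

text \<open>The squared norm is the sum of the limits of the slice norms at the two ends, hence the factor \<open>2\<close>.\<close>

lemma H2_norm_le_slices:
  assumes f: "f \<in> H2 a b" and le: "\<And>r. r \<in> {a<..<b} \<Longrightarrow> msq (circle_slice f r) \<le> e"
  shows "(H2_norm a b f)\<^sup>2 \<le> 2 * e"
proof -
  have "Re (boundary_inner f f s) \<le> e" if s: "s = a \<or> s = b" for s
  proof (rule tendsto_upperbound)
    show "((\<lambda>r. Re (slice_inner f f r)) \<longlongrightarrow> Re (boundary_inner f f s)) (at s within {a<..<b})"
      by (intro tendsto_Re slice_inner_tendsto f s)
    show "\<forall>\<^sub>F r in at s within {a<..<b}. Re (slice_inner f f r) \<le> e"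
      using le by (auto simp: eventually_at_filter slice_inner_self intro!: always_eventually)
  qed (rule at_end_within_nontrivial[OF a_less_b s])
  from this[of a] this[of b] have "Re (H2_inner a b f f) \<le> 2 * e" by (simp add: H2_inner_eq)
  then show ?thesis by (simp add: H2_norm_sq(2)[OF f])
qed

text \<open>One term of the sum for the squared norm gives \<open>|c n| * a powi n \<le> \<parallel>f\<parallel>\<close> and \<open>|c n| * b powi n \<le> \<parallel>f\<parallel>\<close>.
  So the Laurent series is dominated by \<open>\<parallel>f\<parallel>\<close> times a geometric series with ratio \<open>\<beta> / b\<close> for \<open>n \<ge> 0\<close>
  and one with ratio \<open>a / \<alpha>\<close> for \<open>n < 0\<close>.\<close>

lemma H2_evaluation_bound:
  assumes \<alpha>: "a < \<alpha>" and \<beta>: "\<beta> < b" "0 < \<beta>"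
  shows "\<exists>C>0. \<forall>f\<in>H2 a b. \<forall>z. \<alpha> \<le> cmod z \<and> cmod z \<le> \<beta> \<longrightarrow> cmod (f z) \<le> C * H2_norm a b f"
proof -
  define G where "G = (\<lambda>n::int. if n \<ge> 0 then (\<beta> / b) powi n else (\<alpha> / a) powi n)"
  have \<alpha>0: "0 < \<alpha>" using \<alpha> a_pos by simp
  have pos: "((\<lambda>n. G (int n)) has_sum (\<Sum>n. (\<beta> / b) ^ n)) UNIV"
  proof -
    have "summable (\<lambda>n. (\<beta> / b) ^ n)" using \<beta> by (intro summable_geometric) auto
    then show ?thesis using \<beta> by (intro norm_summable_imp_has_sum) (auto simp: G_def abs_of_pos norm_power)
  qed
  have neg: "((\<lambda>n. G (- int n - 1)) has_sum (\<Sum>n. (a / \<alpha>) * (a / \<alpha>) ^ n)) UNIV"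
  proof -
    have eq: "G (- int n - 1) = (a / \<alpha>) * (a / \<alpha>) ^ n" for n
    proof -
      have "- int n - 1 = - int (Suc n)" by simp
      then have "(\<alpha> / a) powi (- int n - 1) = inverse ((\<alpha> / a) ^ Suc n)" by (simp only: power_int_minus power_int_of_nat)
      also have "\<dots> = (a / \<alpha>) ^ Suc n" by (simp only: power_inverse[symmetric] inverse_divide)
      finally show ?thesis by (simp add: G_def)
    qed
    have "summable (\<lambda>n. (a / \<alpha>) * (a / \<alpha>) ^ n)" using \<alpha> a_pos by (intro summable_mult summable_geometric) auto
    then show ?thesis unfolding eq using \<alpha>0 a_pos by (intro norm_summable_imp_has_sum) (auto simp: abs_mult power_abs)
  qed
  obtain C where C: "(G has_sum C) UNIV" using has_sum_int_halves[OF pos neg] by blast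
  have G0: "0 \<le> G n" for n using \<alpha>0 a_pos \<beta> a_less_b by (simp add: G_def)
  have C0: "0 \<le> C" using has_sum_nonneg[OF C] G0 by auto
  have "cmod (f z) \<le> (C + 1) * H2_norm a b f" if f: "f \<in> H2 a b" and z: "\<alpha> \<le> cmod z" "cmod z \<le> \<beta>" for f z
  proof -
    have N0: "0 \<le> H2_norm a b f" by (rule H2_norm_nonneg[OF f])
    have zA: "z \<in> annulus a b" using z assms by (auto simp: annulus_def)
    have "((\<lambda>n. c f n * z powi n) has_sum f z) UNIV"
      unfolding annulus_coeff_def using a_pos a_less_b by (intro annulus_Laurent_expansion[OF _ H2_holomorphic[OF f]] zA) auto
    moreover have "((\<lambda>n. H2_norm a b f * G n) has_sum H2_norm a b f * C) UNIV"
      by (rule has_sum_cmult_right[OF C])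
    moreover have "cmod (c f n * z powi n) \<le> H2_norm a b f * G n" for n
    proof -
      have single: "(cmod (c f n))\<^sup>2 * W n \<le> (H2_norm a b f)\<^sup>2"
        using has_sum_mono_neutral[OF has_sum_finite[of "{n}" "\<lambda>n. (cmod (c f n))\<^sup>2 * W n"] H2_norm_sq(1)[OF f]]
        by (auto simp: annulus_weight_def)
      have cs: "cmod (c f n) * s powi n \<le> H2_norm a b f" if "s = a \<or> s = b" for s
      proof (rule power2_le_imp_le[OF _ N0])
        have "(cmod (c f n) * s powi n)\<^sup>2 \<le> (cmod (c f n))\<^sup>2 * W n"
          unfolding power_mult_distrib using that by (intro mult_left_mono) (auto simp: annulus_weight_def)
        then show "(cmod (c f n) * s powi n)\<^sup>2 \<le> (H2_norm a b f)\<^sup>2" using single by linarith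
      qed
      show ?thesis
      proof (cases "n \<ge> 0")
        case True
        have "cmod z powi n \<le> \<beta> powi n" using True z by (intro power_int_mono) auto
        also have "\<dots> = b powi n * G n" using True a_pos a_less_b by (simp add: G_def power_int_divide_distrib)
        finally have "cmod (c f n * z powi n) \<le> cmod (c f n) * (b powi n * G n)"
          by (simp add: norm_mult norm_power_int mult_left_mono)
        also have "\<dots> \<le> H2_norm a b f * G n" using mult_right_mono[OF cs[of b] G0[of n]] by (simp add: mult.assoc)
        finally show ?thesis .
      next
        case False
        have "cmod z powi n \<le> \<alpha> powi n" using False z \<alpha>0 by (intro power_int_antimono) auto
        also have "\<dots> = a powi n * G n" using False a_pos by (simp add: G_def power_int_divide_distrib)
        finally have "cmod (c f n * z powi n) \<le> cmod (c f n) * (a powi n * G n)"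
          by (simp add: norm_mult norm_power_int mult_left_mono)
        also have "\<dots> \<le> H2_norm a b f * G n" using mult_right_mono[OF cs[of a] G0[of n]] by (simp add: mult.assoc)
        finally show ?thesis .
      qed
    qed
    ultimately have "cmod (f z) \<le> H2_norm a b f * C" by (rule norm_infsum_le)
    then show ?thesis using N0 by (simp add: algebra_simps)
  qed
  \<comment> \<open>Adding 1 makes the constant positive whatever the value \<open>C \<ge> 0\<close> of the sum.\<close>
  then show ?thesis using C0 by (intro exI[of _ "C + 1"]) auto
qed

section \<open>Completeness of the Hardy space and of its components\<close>

lemma msq_le_of_bound:
  assumes "h \<in> circle_L2" "\<And>\<phi>. cmod (h \<phi>) \<le> e"
  shows "msq h \<le> e\<^sup>2"
proof -
  have "msq h \<le> angle_mean (\<lambda>_. e\<^sup>2)"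
    unfolding msq_def using assms finite_measure.integrable_const[OF finite_measure_circle]
    by (intro angle_mean_mono power_mono) (auto simp: circle_L2_def)
  then show ?thesis by (simp add: angle_mean_const)
qed

text \<open>By the evaluation bound a Cauchy sequence converges locally uniformly to a holomorphic \<open>f\<close>. On each
  single circle the convergence is uniform, so a bound for the slices of \<open>u n - u m\<close> that does not
  depend on the radius survives the limit in \<open>m\<close>; this gives both \<open>f \<in> H2 a b\<close> and convergence in
  norm.\<close>

lemma H2_complete:
  assumes u: "\<And>n. u n \<in> H2 a b"
    and Cau: "\<And>\<epsilon>. \<epsilon> > 0 \<Longrightarrow> \<exists>N. \<forall>m\<ge>N. \<forall>n\<ge>N. H2_norm a b (u m - u n) < \<epsilon>"
  shows "\<exists>f\<in>H2 a b. (\<lambda>n. H2_norm a b (u n - f)) \<longlonglongrightarrow> 0"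
proof -
  have unif: "\<exists>N. \<forall>m\<ge>N. \<forall>n\<ge>N. \<forall>z. \<alpha> \<le> cmod z \<and> cmod z \<le> \<beta> \<longrightarrow> cmod (u m z - u n z) < \<epsilon>"
    if ab: "a < \<alpha>" "\<beta> < b" "0 < \<beta>" and eps: "\<epsilon> > 0" for \<alpha> \<beta> \<epsilon>
  proof -
    obtain C where C: "C > 0" "\<And>f z. f \<in> H2 a b \<Longrightarrow> \<alpha> \<le> cmod z \<Longrightarrow> cmod z \<le> \<beta> \<Longrightarrow> cmod (f z) \<le> C * H2_norm a b f"
      using H2_evaluation_bound[OF ab] by blast
    obtain N where N: "\<And>m n. m \<ge> N \<Longrightarrow> n \<ge> N \<Longrightarrow> H2_norm a b (u m - u n) < \<epsilon> / C"
      using Cau[OF divide_pos_pos[OF eps C(1)]] by blast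
    have "cmod (u m z - u n z) < \<epsilon>" if "m \<ge> N" "n \<ge> N" "\<alpha> \<le> cmod z" "cmod z \<le> \<beta>" for m n z
      using C(2)[OF H2_diff[OF u u] that(3,4), of m n] N[OF that(1,2)] C(1) by (simp add: field_simps)
    then show ?thesis by blast
  qed
  have "convergent (\<lambda>n. u n z)" if z: "z \<in> annulus a b" for z
  proof -
    have "\<exists>M. \<forall>m\<ge>M. \<forall>n\<ge>M. norm (u m z - u n z) < \<epsilon>" if "\<epsilon> > 0" for \<epsilon>
    proof -
      have "a < cmod z" "cmod z < b" "0 < cmod z" using z a_pos by (auto simp: annulus_def)
      from unif[OF this that] show ?thesis by blast
    qed
    then have "Cauchy (\<lambda>n. u n z)" by (intro CauchyI)
    then show ?thesis by (rule Cauchy_convergent)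
  qed
  then obtain f where f: "\<And>z. z \<in> annulus a b \<Longrightarrow> (\<lambda>n. u n z) \<longlonglongrightarrow> f z"
    unfolding convergent_def by metis
  have unif_lim: "\<exists>N. \<forall>n\<ge>N. \<forall>z. \<alpha> \<le> cmod z \<and> cmod z \<le> \<beta> \<longrightarrow> cmod (u n z - f z) \<le> \<epsilon>"
    if ab: "a < \<alpha>" "\<beta> < b" "0 < \<beta>" and \<epsilon>: "\<epsilon> > 0" for \<alpha> \<beta> \<epsilon>
  proof -
    obtain N where N: "\<And>m n z. m \<ge> N \<Longrightarrow> n \<ge> N \<Longrightarrow> \<alpha> \<le> cmod z \<Longrightarrow> cmod z \<le> \<beta> \<Longrightarrow> cmod (u m z - u n z) < \<epsilon>"
      using unif[OF ab \<epsilon>] by blast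
    have "cmod (u n z - f z) \<le> \<epsilon>" if n: "n \<ge> N" and z: "\<alpha> \<le> cmod z" "cmod z \<le> \<beta>" for n z
    proof (rule Lim_bounded)
      show "(\<lambda>m. cmod (u n z - u m z)) \<longlonglongrightarrow> cmod (u n z - f z)"
        using z ab by (intro tendsto_intros f) (auto simp: annulus_def)
      show "\<forall>m\<ge>N. cmod (u n z - u m z) \<le> \<epsilon>" using N[OF n _ z] by (auto intro: less_imp_le)
    qed
    then show ?thesis by blast
  qed
  have hol: "f holomorphic_on annulus a b"
  proof (rule holomorphic_uniform_sequence[OF open_annulus])
    show "u n holomorphic_on annulus a b" for n by (rule H2_holomorphic[OF u])
    fix x assume x: "x \<in> annulus a b"
    obtain d where d: "0 < d" "cball x d \<subseteq> annulus a b"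
      using open_contains_cball open_annulus x by metis
    define e where "e = min d (min ((cmod x - a) / 2) ((b - cmod x) / 2))"
    have e: "0 < e" "e \<le> d" "e \<le> (cmod x - a) / 2" "e \<le> (b - cmod x) / 2"
    proof -
      show "0 < e" using d x by (auto simp: e_def annulus_def)
      show "e \<le> d" unfolding e_def by (rule min.cobounded1)
      show "e \<le> (cmod x - a) / 2" unfolding e_def by (rule min.coboundedI2[OF min.cobounded1])
      show "e \<le> (b - cmod x) / 2" unfolding e_def by (rule min.coboundedI2[OF min.cobounded2])
    qed
    have in_band: "(a + cmod x) / 2 \<le> cmod z \<and> cmod z \<le> (b + cmod x) / 2" if "z \<in> cball x e" for z
    proof -
      have "cmod (x - z) \<le> e" using that by (simp add: dist_norm)
      then have "cmod z \<le> cmod x + e" "cmod x - e \<le> cmod z"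
        using norm_triangle_ineq2[of x z] norm_triangle_ineq3[of x z] by linarith+
      then show ?thesis using e by argo
    qed
    have "uniform_limit (cball x e) u f sequentially"
    proof (rule uniform_limitI)
      fix \<epsilon> :: real assume "\<epsilon> > 0"
      then obtain N where N: "\<And>n z. n \<ge> N \<Longrightarrow> (a + cmod x) / 2 \<le> cmod z \<Longrightarrow> cmod z \<le> (b + cmod x) / 2 \<Longrightarrow> cmod (u n z - f z) \<le> \<epsilon> / 2"
        using unif_lim[of "(a + cmod x) / 2" "(b + cmod x) / 2" "\<epsilon> / 2"] x a_pos by (auto simp: annulus_def)
      have "dist (u n z) (f z) < \<epsilon>" if "n \<ge> N" "z \<in> cball x e" for n z
        using N[OF that(1)] in_band[OF that(2)] \<open>\<epsilon> > 0\<close> by (fastforce simp: dist_norm)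
      then show "\<forall>\<^sub>F n in sequentially. \<forall>z\<in>cball x e. dist (u n z) (f z) < \<epsilon>"
        unfolding eventually_sequentially by blast
    qed
    then show "\<exists>d. 0 < d \<and> cball x d \<subseteq> annulus a b \<and> uniform_limit (cball x d) u f sequentially"
      using e d by (intro exI[of _ e]) auto
  qed
  have slices: "\<exists>N. \<forall>n\<ge>N. \<forall>r\<in>{a<..<b}. msq (circle_slice (u n - f) r) \<le> \<epsilon>\<^sup>2" if \<epsilon>: "\<epsilon> > 0" for \<epsilon>
  proof -
    obtain N where N: "\<And>m n. m \<ge> N \<Longrightarrow> n \<ge> N \<Longrightarrow> H2_norm a b (u m - u n) < \<epsilon>" using Cau[OF \<epsilon>] by blast
    have "msq (circle_slice (u n - f) r) \<le> \<epsilon>\<^sup>2" if n: "n \<ge> N" and r: "r \<in> {a<..<b}" for n r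
    proof (rule Lim_bounded)
      have L2: "circle_slice (g - h) r \<in> circle_L2" if "g holomorphic_on annulus a b" "h holomorphic_on annulus a b" for g h
      proof -
        have "g - h holomorphic_on annulus a b" unfolding fun_diff_def using that by (intro holomorphic_intros)
        then show ?thesis using circle_slice_L2 r by auto
      qed
      note hu = H2_holomorphic[OF u]
      show "(\<lambda>m. msq (circle_slice (u n - u m) r)) \<longlonglongrightarrow> msq (circle_slice (u n - f) r)"
      proof (rule msq_tendsto)
        show "(\<lambda>m. msq (\<lambda>\<phi>. circle_slice (u n - u m) r \<phi> - circle_slice (u n - f) r \<phi>)) \<longlonglongrightarrow> 0"
        proof (rule LIMSEQ_I)
          fix e :: real assume e: "0 < e"
          obtain M where M: "\<And>m z. m \<ge> M \<Longrightarrow> r \<le> cmod z \<Longrightarrow> cmod z \<le> r \<Longrightarrow> cmod (u m z - f z) \<le> sqrt (e / 2)"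
            using unif_lim[of r r "sqrt (e / 2)"] r a_pos e by auto
          have "msq (\<lambda>\<phi>. circle_slice (u n - u m) r \<phi> - circle_slice (u n - f) r \<phi>) \<le> (sqrt (e / 2))\<^sup>2" if "m \<ge> M" for m
          proof (rule msq_le_of_bound)
            show "(\<lambda>\<phi>. circle_slice (u n - u m) r \<phi> - circle_slice (u n - f) r \<phi>) \<in> circle_L2"
              by (intro circle_L2_diff L2 hu hol)
            show "cmod (circle_slice (u n - u m) r \<phi> - circle_slice (u n - f) r \<phi>) \<le> sqrt (e / 2)" for \<phi>
              using M[OF that, of "rcis r \<phi>"] r a_pos by (simp add: circle_slice_def norm_minus_commute)
          qed
          then have "norm (msq (\<lambda>\<phi>. circle_slice (u n - u m) r \<phi> - circle_slice (u n - f) r \<phi>) - 0) < e" if "m \<ge> M" for m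
            using that e msq_nonneg[of "\<lambda>\<phi>. circle_slice (u n - u m) r \<phi> - circle_slice (u n - f) r \<phi>"] by fastforce
          then show "\<exists>M. \<forall>m\<ge>M. norm (msq (\<lambda>\<phi>. circle_slice (u n - u m) r \<phi> - circle_slice (u n - f) r \<phi>) - 0) < e" by blast
        qed
      qed (auto intro!: always_eventually L2 hu hol)
      show "\<forall>m\<ge>N. msq (circle_slice (u n - u m) r) \<le> \<epsilon>\<^sup>2"
      proof (intro allI impI)
        fix m assume m: "m \<ge> N"
        have "msq (circle_slice (u n - u m) r) \<le> (H2_norm a b (u n - u m))\<^sup>2" by (rule msq_slice_le_norm[OF H2_diff[OF u u] r])
        also have "\<dots> \<le> \<epsilon>\<^sup>2" using N[OF n m] H2_norm_nonneg[OF H2_diff[OF u u]] by (intro power_mono) auto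
        finally show "msq (circle_slice (u n - u m) r) \<le> \<epsilon>\<^sup>2" .
      qed
    qed
    then show ?thesis by blast
  qed
  have dH2: "u n - f \<in> H2 a b" if "\<forall>r\<in>{a<..<b}. msq (circle_slice (u n - f) r) \<le> e" for n e
  proof -
    have "u n - f holomorphic_on annulus a b" unfolding fun_diff_def using hol H2_holomorphic[OF u] by (intro holomorphic_intros)
    then show ?thesis using that H2_iff by blast
  qed
  have fH2: "f \<in> H2 a b"
  proof -
    obtain n where "u n - f \<in> H2 a b" using slices[of 1] dH2 by (metis order_refl zero_less_one)
    from H2_diff[OF u[of n] this] show ?thesis by simp
  qed
  have "(\<lambda>n. H2_norm a b (u n - f)) \<longlonglongrightarrow> 0"
  proof (rule LIMSEQ_I)
    fix e :: real assume e: "0 < e"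
    obtain N where N: "\<And>n r. n \<ge> N \<Longrightarrow> r \<in> {a<..<b} \<Longrightarrow> msq (circle_slice (u n - f) r) \<le> (e / 2)\<^sup>2"
      using slices[OF half_gt_zero[OF e]] by blast
    have "H2_norm a b (u n - f) < e" if "n \<ge> N" for n
    proof (rule power2_less_imp_less)
      have "(H2_norm a b (u n - f))\<^sup>2 \<le> 2 * (e / 2)\<^sup>2"
        by (intro H2_norm_le_slices H2_diff u fH2 N that)
      also have "\<dots> < e\<^sup>2" using e by (simp add: power2_eq_square)
      finally show "(H2_norm a b (u n - f))\<^sup>2 < e\<^sup>2" .
    qed (use e in auto)
    then show "\<exists>N. \<forall>n\<ge>N. norm (H2_norm a b (u n - f) - 0) < e"
      using H2_norm_nonneg[OF H2_diff[OF u fH2]] by auto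
  qed
  then show ?thesis using fH2 by blast
qed

lemma powi_in_H2: "(\<lambda>z. z powi m) \<in> H2 a b"
proof -
  have "msq (circle_slice (\<lambda>z. z powi m) r) \<le> annulus_weight a b m" if "r \<in> {a<..<b}" for r
  proof -
    have "msq (circle_slice (\<lambda>z. z powi m) r) = (r powi m)\<^sup>2"
      by (simp add: msq_def circle_slice_def rcis_powi norm_mult angle_mean_const del: of_real_power_int)
    also have "\<dots> \<le> annulus_weight a b m" using that a_pos by (intro powi_sq_le_weight) auto
    finally show ?thesis .
  qed
  moreover have "(\<lambda>z. z powi m) holomorphic_on annulus a b"
    using a_pos by (intro powi_holomorphic) (auto simp: annulus_def)
  ultimately show ?thesis using H2_iff by blast
qed

lemma H2_subspace: "cfun.subspace (H2 a b)"
  unfolding cfun.subspace_def using H2_zero H2_add H2_scale by auto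

lemma V_space_H2: "V_space d k \<subseteq> H2 a b"
  unfolding V_space_def
proof (rule cfun.span_minimal[OF _ H2_subspace])
  show "range (\<lambda>j z. z ^ (k + 2 * j)) \<union> range (\<lambda>j z. z powi (- int d - int k + 2 + 2 * int j)) \<subseteq> H2 a b"
  proof -
    have "(\<lambda>z. z ^ n) \<in> H2 a b" for n using powi_in_H2[of "int n"] by simp
    then show ?thesis using powi_in_H2 by blast
  qed
qed

lemma V_space_subspace: "cfun.subspace (V_space d k)"
  unfolding V_space_def by (rule cfun.subspace_span)

lemma component_H2: "f \<in> H2_component d a b k \<Longrightarrow> f \<in> H2 a b"
  by (simp add: H2_component_def)

lemma component_approx:
  assumes "f \<in> H2_component d a b k" "\<epsilon> > 0"
  shows "\<exists>g\<in>V_space d k. (H2_norm a b (f - g))\<^sup>2 < \<epsilon>"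
proof -
  obtain g where g: "g \<in> V_space d k" "H2_norm a b (f - g) < sqrt \<epsilon>"
    using assms real_sqrt_gt_zero unfolding H2_component_def by blast
  have "0 \<le> H2_norm a b (f - g)"
    using g V_space_H2 component_H2[OF assms(1)] by (intro H2_norm_nonneg H2_diff) auto
  then have "(H2_norm a b (f - g))\<^sup>2 < (sqrt \<epsilon>)\<^sup>2" using g by (intro power_strict_mono) auto
  then show ?thesis using g assms by auto
qed

lemma component_sq_I:
  assumes "f \<in> H2 a b" "\<And>\<epsilon>. \<epsilon> > 0 \<Longrightarrow> \<exists>g\<in>V_space d k. (H2_norm a b (f - g))\<^sup>2 < \<epsilon>"
  shows "f \<in> H2_component d a b k"
proof -
  have "\<exists>g\<in>V_space d k. H2_norm a b (f - g) < \<epsilon>" if eps: "\<epsilon> > 0" for \<epsilon>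
  proof -
    obtain g where g: "g \<in> V_space d k" "(H2_norm a b (f - g))\<^sup>2 < \<epsilon>\<^sup>2"
      using assms(2)[of "\<epsilon>\<^sup>2"] eps by auto
    then show ?thesis using power2_less_imp_less[OF g(2)] eps by auto
  qed
  then show ?thesis using assms by (simp add: H2_component_def)
qed

lemma component_add:
  assumes f: "f \<in> H2_component d a b k" and g: "g \<in> H2_component d a b k"
  shows "f + g \<in> H2_component d a b k"
proof (rule component_sq_I)
  show "f + g \<in> H2 a b" using assms by (intro H2_add component_H2)
  fix \<epsilon> :: real assume "\<epsilon> > 0"
  then obtain p q where pq: "p \<in> V_space d k" "(H2_norm a b (f - p))\<^sup>2 < \<epsilon> / 4" "q \<in> V_space d k" "(H2_norm a b (g - q))\<^sup>2 < \<epsilon> / 4"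
    using component_approx[OF f, of "\<epsilon> / 4"] component_approx[OF g, of "\<epsilon> / 4"] by auto
  have "(f + g) - (p + q) = (f - p) + (g - q)" by (simp add: fun_eq_iff)
  moreover have "f - p \<in> H2 a b" "g - q \<in> H2 a b"
    using pq V_space_H2 component_H2[OF f] component_H2[OF g] by (auto intro!: H2_diff)
  ultimately have "(H2_norm a b ((f + g) - (p + q)))\<^sup>2 \<le> 2 * (H2_norm a b (f - p))\<^sup>2 + 2 * (H2_norm a b (g - q))\<^sup>2"
    using H2_norm_add_sq_le by metis
  then show "\<exists>h\<in>V_space d k. (H2_norm a b (f + g - h))\<^sup>2 < \<epsilon>"
    using pq cfun.subspace_add[OF V_space_subspace pq(1,3)] by (intro bexI[of _ "p + q"]) auto
qed

lemma component_scale: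
  assumes f: "f \<in> H2_component d a b k"
  shows "(\<lambda>x. c0 * f x) \<in> H2_component d a b k"
proof (rule component_sq_I)
  show "(\<lambda>x. c0 * f x) \<in> H2 a b" using assms by (intro H2_scale component_H2)
  fix \<epsilon> :: real assume \<epsilon>: "\<epsilon> > 0"
  \<comment> \<open>The summand 1 keeps the divisor positive when the scalar is 0.\<close>
  define M where "M = (cmod c0)\<^sup>2 + 1"
  have M: "0 < M" "(cmod c0)\<^sup>2 \<le> M" by (auto simp: M_def add_nonneg_pos)
  obtain p where p: "p \<in> V_space d k" "(H2_norm a b (f - p))\<^sup>2 < \<epsilon> / M"
    using component_approx[OF f, of "\<epsilon> / M"] \<epsilon> M by auto
  have "(\<lambda>x. c0 * f x) - (\<lambda>x. c0 * p x) = (\<lambda>x. c0 * (f - p) x)" by (simp add: fun_eq_iff algebra_simps)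
  moreover have "f - p \<in> H2 a b"
    using p V_space_H2 component_H2[OF f] by (auto intro!: H2_diff)
  ultimately have "(H2_norm a b ((\<lambda>x. c0 * f x) - (\<lambda>x. c0 * p x)))\<^sup>2 = (cmod c0)\<^sup>2 * (H2_norm a b (f - p))\<^sup>2"
    using H2_norm_scale_sq by metis
  also have "\<dots> \<le> M * (H2_norm a b (f - p))\<^sup>2" using M by (intro mult_right_mono) auto
  also have "\<dots> < \<epsilon>" using p M by (simp add: field_simps)
  finally show "\<exists>h\<in>V_space d k. (H2_norm a b ((\<lambda>x. c0 * f x) - h))\<^sup>2 < \<epsilon>"
    using cfun.subspace_scale[OF V_space_subspace p(1)] by blast
qed

lemma component_zero: "0 \<in> H2_component d a b k"
proof (rule component_sq_I[OF H2_zero])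
  fix \<epsilon> :: real assume "\<epsilon> > 0"
  moreover have "(H2_norm a b (0 - 0))\<^sup>2 = 0" using H2_norm_scale_sq[OF H2_zero, of 0] by (simp add: zero_fun_def)
  ultimately show "\<exists>g\<in>V_space d k. (H2_norm a b (0 - g))\<^sup>2 < \<epsilon>"
    using cfun.subspace_0[OF V_space_subspace] by (intro bexI[of _ 0]) auto
qed

lemma component_diff:
  "f \<in> H2_component d a b k \<Longrightarrow> g \<in> H2_component d a b k \<Longrightarrow> f - g \<in> H2_component d a b k"
  unfolding diff_eq_add_scale by (intro component_add component_scale)

lemma component_complete:
  assumes u: "\<And>n. u n \<in> H2_component d a b k"
    and Cau: "\<And>\<epsilon>. \<epsilon> > 0 \<Longrightarrow> \<exists>N. \<forall>m\<ge>N. \<forall>n\<ge>N. H2_norm a b (u m - u n) < \<epsilon>"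
  shows "\<exists>f\<in>H2_component d a b k. (\<lambda>n. H2_norm a b (u n - f)) \<longlonglongrightarrow> 0"
proof -
  note uH = component_H2[OF u]
  obtain f where f: "f \<in> H2 a b" "(\<lambda>n. H2_norm a b (u n - f)) \<longlonglongrightarrow> 0"
    using H2_complete[OF uH Cau] by blast
  have "f \<in> H2_component d a b k"
  proof (rule component_sq_I[OF f(1)])
    fix \<epsilon> :: real assume \<epsilon>: "\<epsilon> > 0"
    have "(\<lambda>n. (H2_norm a b (u n - f))\<^sup>2) \<longlonglongrightarrow> 0\<^sup>2" by (intro tendsto_intros f)
    then have "\<forall>\<^sub>F n in sequentially. (H2_norm a b (u n - f))\<^sup>2 < \<epsilon> / 4"
      using order_tendstoD(2)[of _ _ _ "\<epsilon> / 4"] \<epsilon> by fastforce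
    then obtain n where n: "(H2_norm a b (u n - f))\<^sup>2 < \<epsilon> / 4" by (auto simp: eventually_sequentially)
    obtain g where g: "g \<in> V_space d k" "(H2_norm a b (u n - g))\<^sup>2 < \<epsilon> / 4"
      using component_approx[OF u, of "\<epsilon> / 4"] \<epsilon> by auto
    have gH: "g \<in> H2 a b" using g V_space_H2 by blast
    have "f - g = (f - u n) + (u n - g)" by (simp add: fun_eq_iff)
    then have "(H2_norm a b (f - g))\<^sup>2 \<le> 2 * (H2_norm a b (f - u n))\<^sup>2 + 2 * (H2_norm a b (u n - g))\<^sup>2"
      using H2_norm_add_sq_le[OF H2_diff[OF f(1) uH] H2_diff[OF uH gH]] by metis
    then show "\<exists>g\<in>V_space d k. (H2_norm a b (f - g))\<^sup>2 < \<epsilon>"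
      using n g H2_norm_diff_commute[OF f(1) uH, of n] by (intro bexI[of _ g]) auto
  qed
  then show ?thesis using f by blast
qed

end

section \<open>Polynomials along lines and Markov type bounds\<close>

lemma poly_eq_sum_atMost:
  fixes q :: "complex poly"
  assumes "degree q \<le> k"
  shows "poly q x = (\<Sum>j\<le>k. coeff q j * x ^ j)"
  unfolding poly_altdef using assms
  by (intro sum.mono_neutral_left) (auto simp: coeff_eq_0)

text \<open>The map \<open>w \<mapsto> \<sigma> * (w - 1 / w) / (2 * \<i>)\<close> sends the unit circle to the interval \<open>[-1, 1]\<close>. The sum is
  \<open>w ^ k\<close> times \<open>q\<close> at that point, with denominators cleared, so on the circle it is bounded by \<open>M\<close>, and
  the maximum principle extends the bound to the disc. The sign \<open>\<sigma> = -1\<close> corresponds to replacing \<open>w\<close>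
  by \<open>1 / w\<close>, which transports the bound to the outside of the disc.\<close>

lemma joukowski_poly_bound:
  fixes q :: "complex poly" and \<sigma> :: real
  assumes deg: "degree q \<le> k" and M: "\<And>t::real. \<bar>t\<bar> \<le> 1 \<Longrightarrow> cmod (poly q (of_real t)) \<le> M"
    and \<sigma>: "\<bar>\<sigma>\<bar> = 1" and w: "cmod w \<le> 1"
  shows "cmod (\<Sum>j\<le>k. coeff q j * (of_real \<sigma> * (w\<^sup>2 - 1) / (2 * \<i>)) ^ j * w ^ (k - j)) \<le> M"
proof -
  let ?G = "\<lambda>w. \<Sum>j\<le>k. coeff q j * (of_real \<sigma> * (w\<^sup>2 - 1) / (2 * \<i>)) ^ j * w ^ (k - j)"
  show "cmod (?G w) \<le> M"
  proof (rule maximum_modulus_frontier[where S = "cball 0 1" and f = ?G])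
  show "?G holomorphic_on interior (cball 0 1)" by (intro holomorphic_intros) auto
  show "continuous_on (closure (cball 0 1)) ?G" by (intro continuous_intros) auto
  fix z :: complex assume "z \<in> frontier (cball 0 1)"
  then have z: "cmod z = 1" by simp
  then have z0: "z \<noteq> 0" by auto
  have "z * cnj z = 1" using z by (simp add: complex_norm_square[symmetric])
  then have "z\<^sup>2 - 1 = z * (z - cnj z)" by (simp add: power2_eq_square right_diff_distrib)
  also have "\<dots> = z * (2 * \<i> * of_real (Im z))" by (simp add: complex_eq_iff)
  finally have eq: "of_real \<sigma> * (z\<^sup>2 - 1) / (2 * \<i>) = z * of_real (\<sigma> * Im z)" by (simp add: field_simps)
  have "?G z = (\<Sum>j\<le>k. z ^ k * (coeff q j * of_real (\<sigma> * Im z) ^ j))"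
  proof (intro sum.cong refl)
    fix j assume "j \<in> {..k}"
    then have "z ^ j * z ^ (k - j) = z ^ k" by (simp add: power_add[symmetric])
    then show "coeff q j * (of_real \<sigma> * (z\<^sup>2 - 1) / (2 * \<i>)) ^ j * z ^ (k - j) = z ^ k * (coeff q j * of_real (\<sigma> * Im z) ^ j)"
      unfolding eq power_mult_distrib by (metis (no_types, opaque_lifting) mult.assoc mult.commute)
  qed
  also have "\<dots> = z ^ k * poly q (of_real (\<sigma> * Im z))"
    by (simp add: poly_eq_sum_atMost[OF deg] sum_distrib_left)
  finally have "cmod (?G z) = cmod (poly q (of_real (\<sigma> * Im z)))"
    by (simp add: norm_mult norm_power z)
  also have "\<dots> \<le> M" using abs_Im_le_cmod[of z] z \<sigma> by (intro M) (simp add: abs_mult)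
  finally show "cmod (?G z) \<le> M" .
  qed (use w in auto)
qed

text \<open>For \<open>G w = w ^ k * q ((w - 1 / w) / (2 * \<i>))\<close> one finds \<open>G' 1 = k * q 0 - \<i> * q' 0\<close>. On the disc of radius
  \<open>1 / (2 * k + 1)\<close> about \<open>1\<close> the modulus of \<open>G\<close> is at most \<open>(1 + 1 / (2 * k + 1)) ^ (2 * k) * M \<le> 3 * M\<close>,
  so Cauchy's estimate bounds \<open>G' 1\<close> by \<open>3 * (2 * k + 1) * M\<close>.\<close>

lemma Markov_at_0:
  fixes q :: "complex poly"
  assumes deg: "degree q \<le> k" and M: "\<And>t::real. \<bar>t\<bar> \<le> 1 \<Longrightarrow> cmod (poly q (of_real t)) \<le> M"
  shows "cmod (coeff q 1) \<le> 7 * (real k + 1) * M"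
proof -
  define G where "G = (\<lambda>\<sigma>::real. \<lambda>w. \<Sum>j\<le>k. coeff q j * (of_real \<sigma> * (w\<^sup>2 - 1) / (2 * \<i>)) ^ j * w ^ (k - j))"
  have M0: "0 \<le> M" using order_trans[OF norm_ge_zero M[of 0]] by simp
  have G1: "cmod (G \<sigma> w) \<le> M" if "cmod w \<le> 1" "\<bar>\<sigma>\<bar> = 1" for \<sigma> w
    unfolding G_def using joukowski_poly_bound[OF deg M] that by blast
  have G2: "cmod (G 1 w) \<le> cmod w ^ (2 * k) * M" if "cmod w \<ge> 1" for w
  proof -
    have w0: "w \<noteq> 0" using that by auto
    have "w ^ (2 * k) * G (-1) (1 / w) = G 1 w"
      unfolding G_def sum_distrib_left
    proof (intro sum.cong refl)
      fix j assume j: "j \<in> {..k}"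
      have e: "of_real (-1) * ((1 / w)\<^sup>2 - 1) / (2 * \<i>) = (of_real 1 * (w\<^sup>2 - 1) / (2 * \<i>)) / w\<^sup>2"
        using w0 by (simp add: field_simps)
      have f1: "w ^ (2 * k) = w ^ (2 * j) * w ^ (k - j) * w ^ (k - j)"
        using j by (simp add: power_add[symmetric] mult_2)
      have f2: "w ^ (2 * j) * ((of_real 1 * (w\<^sup>2 - 1) / (2 * \<i>)) / w\<^sup>2) ^ j = (of_real 1 * (w\<^sup>2 - 1) / (2 * \<i>)) ^ j"
        using w0 by (simp only: power_divide power_mult) simp
      have f3: "w ^ (k - j) * (1 / w) ^ (k - j) = 1"
        using w0 by (simp add: power_one_over)
      have f4: "x * y * z * (c * s * t) = c * (x * s) * z * (y * t)" for x y z c s t :: complex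
        by (simp add: mult_ac)
      show "w ^ (2 * k) * (coeff q j * (of_real (-1) * ((1 / w)\<^sup>2 - 1) / (2 * \<i>)) ^ j * (1 / w) ^ (k - j)) =
          coeff q j * (of_real 1 * (w\<^sup>2 - 1) / (2 * \<i>)) ^ j * w ^ (k - j)"
        unfolding e f1 f4 f2 f3 by (rule mult.right_neutral)
    qed
    then have "cmod (G 1 w) = cmod w ^ (2 * k) * cmod (G (-1) (1 / w))"
      by (metis norm_mult norm_power)
    also have "\<dots> \<le> cmod w ^ (2 * k) * M"
      using that by (intro mult_left_mono G1) (auto simp: norm_divide divide_le_eq_1)
    finally show ?thesis .
  qed
  define \<epsilon> :: real where "\<epsilon> = 1 / (2 * k + 1)"
  have \<epsilon>: "0 < \<epsilon>" "2 * k * \<epsilon> \<le> 1" by (auto simp: \<epsilon>_def field_simps)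
  have G3: "cmod (G 1 w) \<le> 3 * M" if "cmod w \<le> 1 + \<epsilon>" for w
  proof (cases "cmod w \<le> 1")
    case True then show ?thesis using G1[of w 1] M0 by simp
  next
    case False
    have "(1 + \<epsilon>) ^ (2 * k) \<le> exp \<epsilon> ^ (2 * k)" using \<epsilon> by (intro power_mono) auto
    also have "\<dots> = exp (2 * k * \<epsilon>)" by (simp add: exp_of_nat_mult[symmetric])
    also have "\<dots> \<le> exp 1" using \<epsilon> by simp
    finally have "(1 + \<epsilon>) ^ (2 * k) \<le> 3" using exp_le by linarith
    moreover have "cmod w ^ (2 * k) \<le> (1 + \<epsilon>) ^ (2 * k)" using that by (intro power_mono) auto
    ultimately have "cmod w ^ (2 * k) * M \<le> 3 * M" using M0 by (intro mult_right_mono) auto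
    then show ?thesis using G2[of w] False by linarith
  qed
  have cau: "cmod ((deriv ^^ 1) (G 1) 1) \<le> fact 1 * (3 * M) / \<epsilon> ^ 1"
  proof (rule Cauchy_inequality)
    show "G 1 holomorphic_on ball 1 \<epsilon>" unfolding G_def by (intro holomorphic_intros) auto
    show "continuous_on (cball 1 \<epsilon>) (G 1)" unfolding G_def by (intro continuous_intros) auto
    fix x :: complex assume "cmod (1 - x) = \<epsilon>"
    then have "cmod x \<le> 1 + \<epsilon>" using norm_triangle_ineq4[of 1 "1 - x"] by simp
    then show "cmod (G 1 x) \<le> 3 * M" by (rule G3)
  qed (use \<epsilon> in auto)
  have der: "(G 1 has_field_derivative (\<Sum>j\<le>k. (if j = 1 then - \<i> * coeff q 1 else 0) + (if j = 0 then of_nat k * coeff q 0 else 0))) (at 1)"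
    unfolding G_def
  proof (rule DERIV_sum)
    fix j
    show "((\<lambda>w. coeff q j * (of_real 1 * (w\<^sup>2 - 1) / (2 * \<i>)) ^ j * w ^ (k - j)) has_field_derivative
        (if j = 1 then - \<i> * coeff q 1 else 0) + (if j = 0 then of_nat k * coeff q 0 else 0)) (at 1)"
      by (rule derivative_eq_intros refl | force)+ (auto simp: field_simps power_0_left)
  qed
  have "(\<Sum>j\<le>k. (if j = 1 then - \<i> * coeff q 1 else 0) + (if j = 0 then of_nat k * coeff q 0 else 0))
       = - \<i> * coeff q 1 + of_nat k * coeff q 0"
  proof (cases "k = 0")
    case True
    then have "coeff q 1 = 0" using deg by (intro coeff_eq_0) auto
    then show ?thesis using True by simp
  next
    case False
    then show ?thesis unfolding sum.distrib by (subst (1 2) sum.delta) auto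
  qed
  with der have "deriv (G 1) 1 = - \<i> * coeff q 1 + of_nat k * coeff q 0" by (simp add: DERIV_imp_deriv)
  then have "deriv (G 1) 1 - of_nat k * coeff q 0 = - \<i> * coeff q 1" by simp
  then have "coeff q 1 = \<i> * (deriv (G 1) 1 - of_nat k * coeff q 0)" by simp
  then have "cmod (coeff q 1) = cmod (deriv (G 1) 1 - of_nat k * coeff q 0)" by (metis mult_1 norm_ii norm_mult)
  also have "\<dots> \<le> cmod (deriv (G 1) 1) + k * cmod (coeff q 0)"
    by (metis norm_mult norm_of_nat norm_triangle_ineq4)
  also have "\<dots> \<le> 3 * M * (2 * k + 1) + k * M"
    using cau M[of 0] by (intro add_mono mult_left_mono) (auto simp: \<epsilon>_def poly_0_coeff_0)
  also have "\<dots> \<le> 7 * (real k + 1) * M" using M0 by (simp add: algebra_simps)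
  finally show ?thesis by simp
qed

lemma Markov_at_0_scaled:
  fixes q :: "complex poly"
  assumes "degree q \<le> k" "0 < \<delta>" and M: "\<And>t::real. \<bar>t\<bar> \<le> \<delta> \<Longrightarrow> cmod (poly q (of_real t)) \<le> M"
  shows "cmod (coeff q 1) \<le> 7 * (real k + 1) * M / \<delta>"
proof -
  have "cmod (coeff (pcompose q [:0, of_real \<delta>:]) 1) \<le> 7 * (real k + 1) * M"
  proof (rule Markov_at_0)
    show "degree (pcompose q [:0, complex_of_real \<delta>:]) \<le> k" using assms(1,2) by (simp add: degree_pcompose)
    fix t :: real assume "\<bar>t\<bar> \<le> 1"
    then have "\<bar>t * \<delta>\<bar> \<le> \<delta>" using assms mult_right_mono[of "\<bar>t\<bar>" 1 \<delta>] by (simp add: abs_mult)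
    from M[OF this] show "cmod (poly (pcompose q [:0, of_real \<delta>:]) (of_real t)) \<le> M"
      by (simp add: poly_pcompose)
  qed
  then show ?thesis using assms by (simp add: coeff_pcompose_linear norm_mult field_simps)
qed

text \<open>The reversed polynomial \<open>s ^ n * q (1 / s)\<close>, with \<open>n\<close> the degree of \<open>q\<close>, has the leading coefficient
  of \<open>q\<close> as its value at \<open>0\<close>. Growth of order \<open>k < n\<close> would force this value to be \<open>0\<close>.\<close>

lemma degree_le_of_growth:
  fixes q :: "complex poly"
  assumes "\<And>t::real. t \<ge> 1 \<Longrightarrow> cmod (poly q (of_real t)) \<le> C * (1 + t) ^ k"
  shows "degree q \<le> k"
proof (rule ccontr)
  assume "\<not> degree q \<le> k"
  then obtain m where m: "degree q = k + Suc m" by (metis add_Suc_right less_imp_Suc_add not_le)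
  let ?f = "\<lambda>s::real. cmod (poly (reflect_poly q) (of_real s))"
  have "(?f \<longlongrightarrow> ?f 0) (at_right 0)"
  proof -
    have "continuous_on UNIV ?f" by (intro continuous_intros)
    then have "isCont ?f 0" by (simp add: continuous_on_eq_continuous_at)
    then show ?thesis by (metis filterlim_at_split isCont_def)
  qed
  moreover have "(?f \<longlongrightarrow> 0) (at_right 0)"
  proof (rule Lim_null_comparison)
    show "\<forall>\<^sub>F s in at_right 0. norm (?f s) \<le> C * (s + 1) ^ k * s ^ Suc m"
      unfolding eventually_at_right_field
    proof (intro exI[of _ 1] conjI allI impI)
      fix s :: real assume s: "0 < s" "s < 1"
      have "?f s = s ^ degree q * cmod (poly q (of_real (1 / s)))"
        using s by (simp add: poly_reflect_poly_nz norm_mult norm_power field_simps)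
      also have "\<dots> \<le> s ^ degree q * (C * (1 + 1 / s) ^ k)"
        using s by (intro mult_left_mono assms) auto
      also have "\<dots> = C * (s * (1 + 1 / s)) ^ k * s ^ Suc m"
        by (simp add: m power_add power_mult_distrib)
      also have "s * (1 + 1 / s) = s + 1" using s by (simp add: field_simps)
      finally show "norm (?f s) \<le> C * (s + 1) ^ k * s ^ Suc m" by simp
    qed simp
    have "((\<lambda>s::real. C * (s + 1) ^ k * s ^ Suc m) \<longlongrightarrow> C * (0 + 1) ^ k * 0 ^ Suc m) (at_right 0)"
      by (intro tendsto_intros)
    then show "((\<lambda>s::real. C * (s + 1) ^ k * s ^ Suc m) \<longlongrightarrow> 0) (at_right 0)" by simp
  qed
  ultimately have "?f 0 = 0" using tendsto_unique trivial_limit_at_right_real by blast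
  then have "q = 0" by simp
  then show False using m by simp
qed

lemma real_polynomial_function_has_derivative:
  assumes "real_polynomial_function p"
  shows "\<exists>p'. (\<forall>x. (p has_derivative p' x) (at x)) \<and> (\<forall>v. real_polynomial_function (\<lambda>x. p' x v))"
  using assms
proof induction
  case (linear f)
  then show ?case
    by (intro exI[of _ "\<lambda>_. f"]) (auto simp: bounded_linear_imp_has_derivative)
next
  case (const c)
  then show ?case by (intro exI[of _ "\<lambda>_ _. 0"]) auto
next
  case (add f g)
  then obtain f' g' where "\<forall>x. (f has_derivative f' x) (at x)" "\<forall>v. real_polynomial_function (\<lambda>x. f' x v)"
     "\<forall>x. (g has_derivative g' x) (at x)" "\<forall>v. real_polynomial_function (\<lambda>x. g' x v)" by blast
  then show ?case 
    by (intro exI[of _ "\<lambda>x v. f' x v + g' x v"]) (auto intro!: has_derivative_add)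
next
  case (mult f g)
  then obtain f' g' where "\<forall>x. (f has_derivative f' x) (at x)" "\<forall>v. real_polynomial_function (\<lambda>x. f' x v)"
     "\<forall>x. (g has_derivative g' x) (at x)" "\<forall>v. real_polynomial_function (\<lambda>x. g' x v)" by blast
  then have "\<forall>x. ((\<lambda>x. f x * g x) has_derivative (\<lambda>v. f x * g' x v + f' x v * g x)) (at x)"
    by (blast intro: has_derivative_mult)
  moreover have "\<forall>v. real_polynomial_function (\<lambda>x. f x * g' x v + f' x v * g x)"
    using mult.hyps \<open>\<forall>v. real_polynomial_function (\<lambda>x. f' x v)\<close> \<open>\<forall>v. real_polynomial_function (\<lambda>x. g' x v)\<close>
    by (intro allI real_polynomial_function.intros(3,4)) auto
  ultimately show ?case by (intro exI[of _ "\<lambda>x v. f x * g' x v + f' x v * g x"] conjI)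
qed

lemma polynomial_function_complex_iff:
  fixes p :: "'a::real_normed_vector \<Rightarrow> complex"
  shows "polynomial_function p \<longleftrightarrow> real_polynomial_function (\<lambda>x. Re (p x)) \<and> real_polynomial_function (\<lambda>x. Im (p x))"
proof
  assume "polynomial_function p"
  then show "real_polynomial_function (\<lambda>x. Re (p x)) \<and> real_polynomial_function (\<lambda>x. Im (p x))"
    using bounded_linear_Re bounded_linear_Im unfolding polynomial_function_def o_def by blast
next
  assume "real_polynomial_function (\<lambda>x. Re (p x)) \<and> real_polynomial_function (\<lambda>x. Im (p x))"
  then have "polynomial_function (\<lambda>x. Re (p x) *\<^sub>R 1 + Im (p x) *\<^sub>R \<i>)"
    by (intro polynomial_function_add polynomial_function_mult) (auto simp: real_polynomial_function_eq)
  moreover have "(\<lambda>x. Re (p x) *\<^sub>R 1 + Im (p x) *\<^sub>R \<i>) = p" by (auto simp: complex_eq_iff)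
  ultimately show "polynomial_function p" by simp
qed

lemma polynomial_function_frechet_derivative:
  fixes p :: "'a::euclidean_space \<Rightarrow> complex"
  assumes "polynomial_function p"
  shows "polynomial_function (\<lambda>x. frechet_derivative p (at x) v)"
proof -
  obtain f' g' where d: "\<forall>x. ((\<lambda>x. Re (p x)) has_derivative f' x) (at x)" "\<forall>v. real_polynomial_function (\<lambda>x. f' x v)"
     "\<forall>x. ((\<lambda>x. Im (p x)) has_derivative g' x) (at x)" "\<forall>v. real_polynomial_function (\<lambda>x. g' x v)"
    using assms real_polynomial_function_has_derivative unfolding polynomial_function_complex_iff by metis
  have "(p has_derivative (\<lambda>v. f' x v *\<^sub>R 1 + g' x v *\<^sub>R \<i>)) (at x)" for x
  proof -
    have "((\<lambda>x. Re (p x) *\<^sub>R 1 + Im (p x) *\<^sub>R \<i>) has_derivative (\<lambda>v. f' x v *\<^sub>R 1 + g' x v *\<^sub>R \<i>)) (at x)"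
      using d by (intro has_derivative_add has_derivative_scaleR_left) auto
    moreover have "(\<lambda>x. Re (p x) *\<^sub>R 1 + Im (p x) *\<^sub>R \<i>) = p" by (auto simp: complex_eq_iff)
    ultimately show ?thesis by simp
  qed
  then have "frechet_derivative p (at x) v = f' x v *\<^sub>R 1 + g' x v *\<^sub>R \<i>" for x
    using frechet_derivative_at by metis
  then show ?thesis using d by (simp add: polynomial_function_complex_iff)
qed

lemma polynomial_function_line_ex:
  fixes p :: "'a::euclidean_space \<Rightarrow> complex"
  assumes "polynomial_function p"
  shows "\<exists>q. \<forall>t::real. p (x + t *\<^sub>R v) = poly q (of_real t)"
proof -
  have l: "polynomial_function (\<lambda>t::real. x + t *\<^sub>R v)"
    by (intro polynomial_function_add polynomial_function_const polynomial_function_mult polynomial_function_id)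
  have 1: "real_polynomial_function (\<lambda>t::real. Re (p (x + t *\<^sub>R v)))" "real_polynomial_function (\<lambda>t::real. Im (p (x + t *\<^sub>R v)))"
    using real_polynomial_function_compose[OF l] assms unfolding polynomial_function_complex_iff o_def by auto
  then obtain a n b m where "(\<lambda>t::real. Re (p (x + t *\<^sub>R v))) = (\<lambda>t. \<Sum>i\<le>n. a i * t ^ i)"
      "(\<lambda>t::real. Im (p (x + t *\<^sub>R v))) = (\<lambda>t. \<Sum>i\<le>m. b i * t ^ i)"
    unfolding real_polynomial_function_iff_sum by blast
  then have ab: "Re (p (x + t *\<^sub>R v)) = (\<Sum>i\<le>n. a i * t ^ i)" "Im (p (x + t *\<^sub>R v)) = (\<Sum>i\<le>m. b i * t ^ i)" for t
    by metis+
  show ?thesis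
    by (rule exI[of _ "(\<Sum>i\<le>n. monom (of_real (a i)) i) + smult \<i> (\<Sum>i\<le>m. monom (of_real (b i)) i)"])
      (simp add: complex_eq_iff ab poly_sum poly_monom flip: of_real_power of_real_mult)
qed

text \<open>The restriction of a polynomial function to a line, as a polynomial with complex coefficients:
  degree and coefficient arguments in one variable then apply.\<close>

definition line_poly :: "('a::euclidean_space \<Rightarrow> complex) \<Rightarrow> 'a \<Rightarrow> 'a \<Rightarrow> complex poly" where
  "line_poly p x v = (SOME q. \<forall>t::real. p (x + t *\<^sub>R v) = poly q (of_real t))"

lemma line_poly:
  assumes "polynomial_function p"
  shows "p (x + t *\<^sub>R v) = poly (line_poly p x v) (of_real t)"
  using someI_ex[OF polynomial_function_line_ex[OF assms]] unfolding line_poly_def by blast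

lemma line_poly_has_vector_derivative:
  assumes "polynomial_function p"
  shows "((\<lambda>t. p (x + t *\<^sub>R v)) has_vector_derivative poly (pderiv (line_poly p x v)) (of_real t)) (at t)"
proof -
  have "((\<lambda>t. poly (line_poly p x v) (of_real t)) has_vector_derivative poly (pderiv (line_poly p x v)) (of_real t)) (at t)"
    by (rule field_vector_diff_chain_at[of of_real 1, unfolded o_def, simplified])
      (auto intro!: derivative_eq_intros poly_DERIV simp: has_vector_derivative_of_real)
  then show ?thesis by (simp add: line_poly[OF assms])
qed

text \<open>Along the line in its own direction, a directional derivative is the derivative of the restricted
  polynomial; applied twice, this turns the Laplacian into a sum of coefficients of degree 2.\<close>

lemma partial_deriv_line_poly:
  assumes "polynomial_function p"
  shows "partial_deriv v p (x + t *\<^sub>R v) = poly (pderiv (line_poly p x v)) (of_real t)"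
proof -
  have "((\<lambda>s. t + s) has_vector_derivative 1) (at 0)" by (auto intro!: derivative_eq_intros)
  then have "((\<lambda>s. p (x + (t + s) *\<^sub>R v)) has_vector_derivative poly (pderiv (line_poly p x v)) (of_real t)) (at 0)"
    using vector_diff_chain_at[of "\<lambda>s. t + s" 1 0 "\<lambda>t. p (x + t *\<^sub>R v)" "poly (pderiv (line_poly p x v)) (of_real t)"]
      line_poly_has_vector_derivative[OF assms]
    by (simp add: o_def)
  then show ?thesis unfolding partial_deriv_def
    by (simp add: vector_derivative_at algebra_simps)
qed

lemma partial_deriv_eq_frechet_derivative:
  fixes p :: "'a::euclidean_space \<Rightarrow> complex"
  assumes "polynomial_function p"
  shows "partial_deriv v p x = frechet_derivative p (at x) v"
proof -
  have "(p has_derivative frechet_derivative p (at x)) (at x)"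
    using differentiable_at_polynomial_function[OF assms] frechet_derivative_works by blast
  then have "((\<lambda>t::real. p (x + t *\<^sub>R v)) has_derivative (\<lambda>t. frechet_derivative p (at x) (t *\<^sub>R v))) (at 0)"
    by (intro has_derivative_compose[where g = p and f="\<lambda>t. x + t *\<^sub>R v"] derivative_eq_intros) (auto intro!: derivative_eq_intros)
  moreover have "linear (frechet_derivative p (at x))"
    using differentiable_at_polynomial_function[OF assms] by (rule linear_frechet_derivative)
  ultimately have "((\<lambda>t::real. p (x + t *\<^sub>R v)) has_vector_derivative (frechet_derivative p (at x) v)) (at 0)"
    by (simp add: has_vector_derivative_def linear_cmul)
  then show ?thesis unfolding partial_deriv_def by (rule vector_derivative_at)
qed

lemma partial_deriv_eq_coeff:
  assumes "polynomial_function p"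
  shows "partial_deriv v p x = coeff (line_poly p x v) 1"
  using partial_deriv_line_poly[OF assms, of v x 0] by (simp add: poly_0_coeff_0 coeff_pderiv)

lemma partial_deriv_twice_eq_coeff:
  assumes "polynomial_function p"
  shows "partial_deriv v (partial_deriv v p) x = 2 * coeff (line_poly p x v) 2"
proof -
  have "((\<lambda>t. poly (pderiv (line_poly p x v)) (of_real t)) has_vector_derivative poly (pderiv (pderiv (line_poly p x v))) (of_real 0)) (at 0)"
    by (rule field_vector_diff_chain_at[of of_real 1, unfolded o_def, simplified])
      (auto intro!: derivative_eq_intros poly_DERIV simp: has_vector_derivative_of_real)
  then have "partial_deriv v (partial_deriv v p) x = poly (pderiv (pderiv (line_poly p x v))) 0"
    unfolding partial_deriv_def[of v "partial_deriv v p"] partial_deriv_line_poly[OF assms]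
    by (simp add: vector_derivative_at)
  then show ?thesis by (simp add: poly_0_coeff_0 coeff_pderiv numeral_2_eq_2)
qed

section \<open>Supremum and square mean on the sphere\<close>

text \<open>The growth condition expresses that the degree is at most \<open>k\<close>. In this form it passes to partial
  derivatives by the Markov type bound.\<close>

definition poly_growth :: "nat \<Rightarrow> ('a::euclidean_space \<Rightarrow> complex) \<Rightarrow> bool" where
  "poly_growth k p \<longleftrightarrow> polynomial_function p \<and> (\<exists>C. \<forall>y. cmod (p y) \<le> C * (1 + norm y) ^ k)"

lemma poly_growth_degree_line_poly:
  assumes "poly_growth k p"
  shows "degree (line_poly p x v) \<le> k"
proof -
  obtain C where p: "polynomial_function p" and C: "\<And>y. cmod (p y) \<le> C * (1 + norm y) ^ k"
    using assms by (auto simp: poly_growth_def)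
  have C0: "0 \<le> C" using order_trans[OF norm_ge_zero C[of 0]] by simp
  show ?thesis
  proof (rule degree_le_of_growth)
    fix t :: real assume t: "1 \<le> t"
    have "norm (x + t *\<^sub>R v) \<le> norm x + t * norm v" using norm_triangle_ineq[of x "t *\<^sub>R v"] t by simp
    also have "1 + \<dots> \<le> (1 + norm x + norm v) * (1 + t)"
      using t by (simp add: algebra_simps)
    finally have "C * (1 + norm (x + t *\<^sub>R v)) ^ k \<le> C * ((1 + norm x + norm v) * (1 + t)) ^ k"
      using C0 by (intro mult_left_mono power_mono) auto
    then show "cmod (poly (line_poly p x v) (of_real t)) \<le> (C * (1 + norm x + norm v) ^ k) * (1 + t) ^ k"
      using C[of "x + t *\<^sub>R v"] by (simp add: line_poly[OF p, symmetric] power_mult_distrib)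
  qed
qed

lemma Markov_directional:
  assumes p: "poly_growth k p" and "0 < \<delta>" and M: "\<And>t. \<bar>t\<bar> \<le> \<delta> \<Longrightarrow> cmod (p (y + t *\<^sub>R v)) \<le> M"
  shows "cmod (frechet_derivative p (at y) v) \<le> 7 * (real k + 1) * M / \<delta>"
proof -
  have pp: "polynomial_function p" using p by (simp add: poly_growth_def)
  show ?thesis
    unfolding partial_deriv_eq_frechet_derivative[OF pp, symmetric] partial_deriv_eq_coeff[OF pp]
    by (rule Markov_at_0_scaled[OF poly_growth_degree_line_poly[OF p] \<open>0 < \<delta>\<close>])
      (use M in \<open>simp add: line_poly[OF pp, symmetric]\<close>)
qed

lemma poly_growth_frechet_derivative:
  assumes p: "poly_growth k p"
  shows "poly_growth k (\<lambda>x. frechet_derivative p (at x) v)"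
proof -
  obtain C where pp: "polynomial_function p" and C: "\<And>y. cmod (p y) \<le> C * (1 + norm y) ^ k"
    using assms by (auto simp: poly_growth_def)
  have C0: "0 \<le> C" using order_trans[OF norm_ge_zero C[of 0]] by simp
  have "cmod (frechet_derivative p (at y) v) \<le> 7 * (real k + 1) * (C * (1 + norm v) ^ k) * (1 + norm y) ^ k" for y
  proof -
    have "cmod (frechet_derivative p (at y) v) \<le> 7 * (real k + 1) * (C * ((1 + norm v) * (1 + norm y)) ^ k) / 1"
    proof (rule Markov_directional[OF p])
      fix t :: real assume t: "\<bar>t\<bar> \<le> 1"
      have "norm (y + t *\<^sub>R v) \<le> norm y + \<bar>t\<bar> * norm v" using norm_triangle_ineq[of y "t *\<^sub>R v"] by simp
      also have "\<dots> \<le> norm y + 1 * norm v" using t by (intro add_mono mult_right_mono) auto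
      finally have "norm (y + t *\<^sub>R v) \<le> norm y + 1 * norm v" .
      moreover have "(1 + norm v) * (1 + norm y) = 1 + norm v + norm y + norm v * norm y"
        by (simp add: algebra_simps)
      ultimately have "1 + norm (y + t *\<^sub>R v) \<le> (1 + norm v) * (1 + norm y)"
        using mult_nonneg_nonneg[OF norm_ge_zero[of v] norm_ge_zero[of y]] by linarith
      then have "C * (1 + norm (y + t *\<^sub>R v)) ^ k \<le> C * ((1 + norm v) * (1 + norm y)) ^ k"
        using C0 by (intro mult_left_mono power_mono) auto
      then show "cmod (p (y + t *\<^sub>R v)) \<le> C * ((1 + norm v) * (1 + norm y)) ^ k"
        using C[of "y + t *\<^sub>R v"] by linarith
    qed simp
    then show ?thesis by (simp add: power_mult_distrib mult_ac)
  qed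
  then show ?thesis using polynomial_function_frechet_derivative[OF pp] by (auto simp: poly_growth_def)
qed

definition homogeneous_poly :: "nat \<Rightarrow> (real^'d \<Rightarrow> complex) \<Rightarrow> bool" where
  "homogeneous_poly k p \<longleftrightarrow> polynomial_function p \<and> (\<forall>t x. p (t *\<^sub>R x) = of_real t ^ k * p x)"

lemma homogeneous_poly_norm:
  assumes "homogeneous_poly k p" "x \<noteq> 0"
  shows "cmod (p x) = norm x ^ k * cmod (p (sgn x))"
proof -
  have "p x = p (norm x *\<^sub>R sgn x)" using assms by (simp add: sgn_div_norm)
  also have "\<dots> = of_real (norm x) ^ k * p (sgn x)" using assms by (auto simp: homogeneous_poly_def)
  finally show ?thesis by (simp add: norm_mult norm_power)
qed

lemma homogeneous_poly_bound:
  assumes p: "homogeneous_poly k p" and M: "\<And>\<theta>. \<theta> \<in> sphere 0 1 \<Longrightarrow> cmod (p \<theta>) \<le> M"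
  shows "cmod (p x) \<le> M * norm x ^ k"
proof (cases "x = 0")
  case False
  then show ?thesis using homogeneous_poly_norm[OF p False] M[of "sgn x"]
    by (simp add: norm_sgn mult.commute mult_right_mono)
next
  case True
  show ?thesis
  proof (cases "k = 0")
    case True
    have "p (0 *\<^sub>R axis undefined 1) = of_real 0 ^ k * p (axis undefined 1)"
      using p unfolding homogeneous_poly_def by blast
    then show ?thesis using True \<open>x = 0\<close> M[of "axis undefined 1"] by simp
  next
    case False
    have "p (0 *\<^sub>R 0) = of_real 0 ^ k * p 0" using p unfolding homogeneous_poly_def by blast
    then show ?thesis using True False by (simp add: power_0_left)
  qed
qed

lemma sphere_max_exists:
  fixes p :: "real^'d \<Rightarrow> complex"
  assumes "continuous_on UNIV p"
  obtains \<theta> where "\<theta> \<in> sphere 0 1" "\<And>\<eta>. \<eta> \<in> sphere 0 1 \<Longrightarrow> cmod (p \<eta>) \<le> cmod (p \<theta>)"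
proof -
  have "sphere (0::real^'d) 1 \<noteq> {}" by simp
  moreover have "continuous_on (sphere 0 1) (\<lambda>x. cmod (p x))"
    by (intro continuous_intros continuous_on_subset[OF assms]) auto
  ultimately show ?thesis
    using continuous_attains_sup[of "sphere 0 1" "\<lambda>x. cmod (p x)"] that by auto
qed

lemma homogeneous_poly_growth:
  assumes p: "homogeneous_poly k p"
  shows "poly_growth k p"
proof -
  have pp: "polynomial_function p" using p by (simp add: homogeneous_poly_def)
  obtain \<theta> where th: "\<theta> \<in> sphere 0 1" "\<And>\<eta>. \<eta> \<in> sphere 0 1 \<Longrightarrow> cmod (p \<eta>) \<le> cmod (p \<theta>)"
    using sphere_max_exists[OF continuous_on_polymonial_function[OF pp]] by blast
  have "cmod (p y) \<le> cmod (p \<theta>) * (1 + norm y) ^ k" for y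
  proof -
    have "cmod (p y) \<le> cmod (p \<theta>) * norm y ^ k" by (rule homogeneous_poly_bound[OF p th(2)])
    also have "\<dots> \<le> cmod (p \<theta>) * (1 + norm y) ^ k" by (intro mult_left_mono power_mono) auto
    finally show ?thesis .
  qed
  then show ?thesis using pp by (auto simp: poly_growth_def)
qed

lemma power_one_plus_inverse_le_3: "(1 + 1 / (real k + 1)) ^ k \<le> 3"
proof -
  have "(1 + 1 / (real k + 1)) ^ k \<le> exp (1 / (real k + 1)) ^ k" by (intro power_mono) auto
  also have "\<dots> = exp (real k * (1 / (real k + 1)))" by (simp only: exp_of_nat_mult)
  also have "\<dots> \<le> exp 1" by simp
  finally show ?thesis using exp_le by linarith
qed

text \<open>The Markov type bound is applied at points of the unit ball, up to distance \<open>1 / (k + 1)\<close> from them;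
  leaving the ball by that much increases \<open>|p|\<close> at most by the factor \<open>(1 + 1 / (k + 1)) ^ k \<le> 3\<close>.\<close>

lemma homogeneous_poly_Lipschitz:
  fixes p :: "real^'d \<Rightarrow> complex"
  assumes p: "homogeneous_poly k p" and M: "\<And>\<theta>. \<theta> \<in> sphere 0 1 \<Longrightarrow> cmod (p \<theta>) \<le> M"
    and xy: "norm x \<le> 1" "norm y \<le> 1"
  shows "cmod (p x - p y) \<le> 21 * (real k + 1)\<^sup>2 * M * norm (x - y)"
proof -
  have pp: "polynomial_function p" using p by (simp add: homogeneous_poly_def)
  have M0: "0 \<le> M" using order_trans[OF norm_ge_zero M[of "axis undefined 1"]] by simp
  have der: "(p has_derivative frechet_derivative p (at z)) (at z)" for z
    using differentiable_at_polynomial_function[OF pp] frechet_derivative_works by blast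
  have unit: "cmod (frechet_derivative p (at z) v) \<le> 21 * (real k + 1)\<^sup>2 * M" if z: "norm z \<le> 1" and v: "norm v = 1" for z v
  proof -
    let ?\<delta> = "1 / (real k + 1)"
    have "cmod (frechet_derivative p (at z) v) \<le> 7 * (real k + 1) * (M * 3) / ?\<delta>"
    proof (rule Markov_directional[OF homogeneous_poly_growth[OF p]])
      fix t :: real assume t: "\<bar>t\<bar> \<le> ?\<delta>"
      have "norm (z + t *\<^sub>R v) \<le> 1 + ?\<delta>" using norm_triangle_ineq[of z "t *\<^sub>R v"] z v t by simp
      then have "norm (z + t *\<^sub>R v) ^ k \<le> (1 + ?\<delta>) ^ k" by (intro power_mono) auto
      also have "\<dots> \<le> 3" by (rule power_one_plus_inverse_le_3)
      finally have "M * norm (z + t *\<^sub>R v) ^ k \<le> M * 3" using M0 by (intro mult_left_mono) auto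
      then show "cmod (p (z + t *\<^sub>R v)) \<le> M * 3"
        using homogeneous_poly_bound[OF p M, of "z + t *\<^sub>R v"] by linarith
    qed simp
    then show ?thesis by (simp add: power2_eq_square mult_ac)
  qed
  have "norm (p x - p y) \<le> 21 * (real k + 1)\<^sup>2 * M * norm (x - y)"
  proof (rule differentiable_bound[of "cball 0 1" p "\<lambda>z. frechet_derivative p (at z)"])
    fix z :: "real^'d" assume z: "z \<in> cball 0 1"
    show "(p has_derivative frechet_derivative p (at z)) (at z within cball 0 1)"
      using der by (rule has_derivative_at_withinI)
    have lin: "linear (frechet_derivative p (at z))"
      using der has_derivative_linear by blast
    show "onorm (frechet_derivative p (at z)) \<le> 21 * (real k + 1)\<^sup>2 * M"
    proof (rule onorm_le)
      fix v :: "real^'d"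
      show "norm (frechet_derivative p (at z) v) \<le> 21 * (real k + 1)\<^sup>2 * M * norm v"
      proof (cases "v = 0")
        case True then show ?thesis using lin by (simp add: linear_0)
      next
        case False
        have "frechet_derivative p (at z) v = norm v *\<^sub>R frechet_derivative p (at z) (sgn v)"
          using linear_cmul[OF lin, of "norm v" "sgn v"] False by (simp add: sgn_div_norm)
        then show ?thesis using unit[of z "sgn v"] z False
          by (simp add: norm_sgn mult.commute mult_right_mono)
      qed
    qed
  qed (use xy in auto)
  then show ?thesis .
qed

lemma sgn_measurable_sphere:
  "sgn \<in> restrict_space lborel (cball 0 1 - {0}) \<rightarrow>\<^sub>M restrict_space borel (sphere (0::real^'d) 1)"
  by (intro measurable_restrict_space2 measurable_restrict_space1)
    (auto simp: space_restrict_space norm_sgn)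

lemma sphere_measure_basic:
  shows "sets (sphere_measure :: (real^'d) measure) = sets (restrict_space borel (sphere 0 1))"
    and "space (sphere_measure :: (real^'d) measure) = sphere 0 1"
  by (simp_all add: sphere_measure_def space_scale_measure space_restrict_space)

text \<open>The surface measure is \<open>d\<close> times the volume of cones, so surface integrals are integrals over the
  unit ball of functions that are constant on rays.\<close>

lemma nn_integral_sphere_measure:
  assumes "g \<in> borel_measurable (restrict_space borel (sphere (0::real^'d) 1))"
  shows "(\<integral>\<^sup>+\<theta>. g \<theta> \<partial>sphere_measure) = of_nat CARD('d) * (\<integral>\<^sup>+x\<in>cball 0 1 - {0}. g (sgn x) \<partial>lborel)"
proof -
  have "(\<integral>\<^sup>+\<theta>. g \<theta> \<partial>sphere_measure) = of_nat CARD('d) * (\<integral>\<^sup>+x. g (sgn x) \<partial>restrict_space lborel (cball 0 1 - {0}))"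
    unfolding sphere_measure_def using assms
    by (subst nn_integral_scale_measure) (auto simp: nn_integral_distr[OF sgn_measurable_sphere])
  also have "(\<integral>\<^sup>+x. g (sgn x) \<partial>restrict_space lborel (cball 0 1 - {0})) = (\<integral>\<^sup>+x\<in>cball 0 1 - {0}. g (sgn x) \<partial>lborel)"
    by (subst nn_integral_restrict_space) auto
  finally show ?thesis .
qed

lemma finite_sphere_measure: "finite_measure (sphere_measure :: (real^'d) measure)"
proof (rule finite_measureI)
  have "emeasure (sphere_measure :: (real^'d) measure) (space sphere_measure) = (\<integral>\<^sup>+\<theta>. 1 \<partial>(sphere_measure :: (real^'d) measure))"
    by simp
  also have "\<dots> = of_nat CARD('d) * (\<integral>\<^sup>+x\<in>cball (0::real^'d) 1 - {0}. 1 \<partial>lborel)"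
    by (rule nn_integral_sphere_measure) auto
  also have "\<dots> < \<infinity>"
  proof -
    have "(\<integral>\<^sup>+x\<in>cball (0::real^'d) 1 - {0}. 1 \<partial>lborel) = emeasure lborel (cball (0::real^'d) 1 - {0})"
      by (subst nn_integral_indicator[symmetric]) (auto simp: mult.commute)
    also have "\<dots> \<le> emeasure lborel (cball (0::real^'d) 1)" by (intro emeasure_mono) auto
    also have "\<dots> < \<infinity>" by (rule emeasure_lborel_cball_finite)
    finally show ?thesis by (simp add: ennreal_mult_less_top of_nat_less_top)
  qed
  finally show "emeasure (sphere_measure :: (real^'d) measure) (space sphere_measure) \<noteq> \<infinity>" by simp
qed

lemma continuous_on_imp_integrable_sphere:
  fixes g :: "real^'d \<Rightarrow> complex"
  assumes "continuous_on UNIV g"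
  shows "integrable sphere_measure g"
proof -
  have m: "g \<in> borel_measurable (sphere_measure :: (real^'d) measure)"
  proof -
    have "g \<in> borel_measurable (restrict_space borel (sphere 0 1))"
      using assms by (intro measurable_restrict_space1 borel_measurable_continuous_onI)
    then show ?thesis by (simp add: measurable_cong_sets[OF sphere_measure_basic(1) refl])
  qed
  obtain \<theta> where "\<And>\<eta>. \<eta> \<in> sphere 0 1 \<Longrightarrow> cmod (g \<eta>) \<le> cmod (g \<theta>)"
    using sphere_max_exists[OF assms] by blast
  then show ?thesis
    using m by (intro finite_measure.integrable_const_bound[OF finite_sphere_measure, of _ "cmod (g \<theta>)"])
      (auto simp: sphere_measure_basic)
qed

lemma Re_sphere_inner_self: "Re (sphere_inner p p) = (LINT \<theta>|sphere_measure. (cmod (p \<theta>))\<^sup>2)"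
proof -
  have "sphere_inner p p = (LINT \<theta>|sphere_measure. complex_of_real ((cmod (p \<theta>))\<^sup>2))"
    by (simp only: sphere_inner_def complex_norm_square)
  then show ?thesis by (simp only: integral_complex_of_real Re_complex_of_real)
qed

lemma sphere_inner_self_nn_integral:
  fixes p :: "real^'d \<Rightarrow> complex"
  assumes "continuous_on UNIV p"
  shows "ennreal (Re (sphere_inner p p)) = of_nat CARD('d) * (\<integral>\<^sup>+x\<in>cball 0 1 - {0}. ennreal ((cmod (p (sgn x)))\<^sup>2) \<partial>lborel)"
proof -
  have "ennreal (Re (sphere_inner p p)) = ennreal (LINT \<theta>|sphere_measure. (cmod (p \<theta>))\<^sup>2)"
    unfolding Re_sphere_inner_self ..
  also have "\<dots> = (\<integral>\<^sup>+\<theta>. ennreal ((cmod (p \<theta>))\<^sup>2) \<partial>sphere_measure)"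
  proof (rule nn_integral_eq_integral[symmetric])
    have "integrable (sphere_measure :: (real^'d) measure) (\<lambda>\<theta>. Re (complex_of_real ((cmod (p \<theta>))\<^sup>2)))"
      by (intro integrable_Re continuous_on_imp_integrable_sphere continuous_intros assms)
    then show "integrable (sphere_measure :: (real^'d) measure) (\<lambda>\<theta>. (cmod (p \<theta>))\<^sup>2)" by simp
  qed auto
  also have "\<dots> = of_nat CARD('d) * (\<integral>\<^sup>+x\<in>cball 0 1 - {0}. ennreal ((cmod (p (sgn x)))\<^sup>2) \<partial>lborel)"
    using assms by (intro nn_integral_sphere_measure measurable_compose[OF _ measurable_ennreal]
        measurable_restrict_space1 borel_measurable_continuous_onI continuous_intros)
  finally show ?thesis .
qed

text \<open>The numbers come from \<open>homogeneous_poly_sup_le_L2\<close>: \<open>4\<close> from squaring \<open>M / 2\<close> and \<open>84\<close> from the radius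
  of the ball on which \<open>|p| \<ge> M / 2\<close>.\<close>

definition sphere_sup_const :: "'d::finite itself \<Rightarrow> real" where
  "sphere_sup_const _ = 4 * 84 ^ CARD('d) / measure lborel (ball (0::real^'d) 1)"

lemma sphere_sup_const_pos: "0 < sphere_sup_const TYPE('d::finite)"
  unfolding sphere_sup_const_def using content_ball_pos[of 1 "0::real^'d"] by (auto simp: zero_less_measure_iff)

text \<open>Let \<open>|p|\<close> attain its maximum \<open>M\<close> over the sphere at \<open>\<omega>\<close>. The ball of radius \<open>\<eta>\<close> about
  \<open>(1 - \<eta>) * \<omega>\<close> lies in the unit ball and consists of points at distance at most \<open>2 * \<eta>\<close> from \<open>\<omega>\<close>; for
  \<open>\<eta> = 1 / (84 * (k + 1)\<^sup>2)\<close> the Lipschitz bound yields \<open>|p| \<ge> M / 2\<close> there. Within the unit ball \<open>|p|\<close>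
  is at most its radial extension from the sphere, and the squared norm of \<open>p\<close> on the sphere is \<open>d\<close> times
  the integral of the square of that extension over the ball.\<close>

lemma homogeneous_poly_sup_le_L2:
  fixes p :: "real^'d \<Rightarrow> complex"
  assumes p: "homogeneous_poly k p" and \<theta>: "\<theta> \<in> sphere 0 1"
  shows "(cmod (p \<theta>))\<^sup>2 \<le> sphere_sup_const TYPE('d) * (real k + 1) ^ (2 * CARD('d)) * Re (sphere_inner p p)"
proof -
  have pp: "polynomial_function p" using p by (simp add: homogeneous_poly_def)
  have cont: "continuous_on UNIV p" by (rule continuous_on_polymonial_function[OF pp])
  obtain \<omega> where om: "\<omega> \<in> sphere 0 1" "\<And>\<eta>. \<eta> \<in> sphere 0 1 \<Longrightarrow> cmod (p \<eta>) \<le> cmod (p \<omega>)"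
    using sphere_max_exists[OF cont] by blast
  define M where "M = cmod (p \<omega>)"
  define \<eta> where "\<eta> = 1 / (84 * (real k + 1)\<^sup>2)"
  have k1: "1 \<le> (real k + 1)\<^sup>2" by (simp add: one_le_power)
  then have k84: "1 \<le> 84 * (real k + 1)\<^sup>2" by linarith
  have inv_le: "1 / X \<le> 1" if "1 \<le> X" for X :: real using that by simp
  have eta: "0 < \<eta>" "\<eta> \<le> 1" using inv_le[OF k84] by (auto simp only: \<eta>_def) simp
  define x0 where "x0 = (1 - \<eta>) *\<^sub>R \<omega>"
  let ?V = "measure lborel (ball (0::real^'d) 1)"
  have V: "0 < ?V" by (rule content_ball_pos) simp
  have low: "M / 2 \<le> cmod (p (sgn x))" and cb: "x \<in> cball 0 1" if x: "x \<in> ball x0 \<eta>" "x \<noteq> 0" for x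
  proof -
    have xx0: "norm (x - x0) < \<eta>" using x by (simp add: dist_norm norm_minus_commute)
    have nx0: "norm x0 = 1 - \<eta>" using om eta by (simp add: x0_def)
    have nx: "norm x \<le> 1" using norm_triangle_ineq[of "x - x0" x0] xx0 nx0 by simp
    then show "x \<in> cball 0 1" by simp
    have "norm (x0 - \<omega>) = \<eta>" using om eta by (simp add: x0_def scaleR_left_diff_distrib)
    then have "norm (x - \<omega>) \<le> 2 * \<eta>" using norm_triangle_ineq[of "x - x0" "x0 - \<omega>"] xx0 by simp
    then have "21 * (real k + 1)\<^sup>2 * M * norm (x - \<omega>) \<le> 21 * (real k + 1)\<^sup>2 * M * (2 * \<eta>)"
      by (intro mult_left_mono) (auto simp: M_def)
    also have "\<dots> = M / 2" using k1 by (simp add: \<eta>_def)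
    finally have "cmod (p x - p \<omega>) \<le> M / 2"
      using homogeneous_poly_Lipschitz[OF p om(2) nx, of \<omega>] om by (simp add: M_def)
    then have "M / 2 \<le> cmod (p x)" using norm_triangle_ineq2[of "p \<omega>" "p x"] by (simp add: M_def norm_minus_commute)
    also have "\<dots> = norm x ^ k * cmod (p (sgn x))" by (rule homogeneous_poly_norm[OF p x(2)])
    also have "\<dots> \<le> 1 * cmod (p (sgn x))" using nx by (intro mult_right_mono power_le_one) auto
    finally show "M / 2 \<le> cmod (p (sgn x))" by simp
  qed
  have "emeasure lborel (ball x0 \<eta>) = ennreal (\<eta> ^ CARD('d) * ?V)"
    using emeasure_lborel_ball_finite[of x0 \<eta>] content_ball_conv_unit_ball[of \<eta> x0] eta
    by (subst emeasure_eq_ennreal_measure) auto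
  then have "ennreal ((M / 2)\<^sup>2 * (\<eta> ^ CARD('d) * ?V)) = ennreal ((M / 2)\<^sup>2) * emeasure lborel (ball x0 \<eta>)"
    by (simp only: ennreal_mult'[OF zero_le_power2])
  also have "emeasure lborel (ball x0 \<eta>) = emeasure lborel (ball x0 \<eta> - {0})"
    by (rule emeasure_Diff_null_set[symmetric]) (auto simp: null_sets_def)
  also have "ennreal ((M / 2)\<^sup>2) * \<dots> = (\<integral>\<^sup>+x. ennreal ((M / 2)\<^sup>2) * indicator (ball x0 \<eta> - {0}) x \<partial>lborel)"
    by (rule nn_integral_cmult_indicator[symmetric]) auto
  also have "\<dots> \<le> (\<integral>\<^sup>+x\<in>cball 0 1 - {0}. ennreal ((cmod (p (sgn x)))\<^sup>2) \<partial>lborel)"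
  proof (intro nn_integral_mono)
    fix x
    show "ennreal ((M / 2)\<^sup>2) * indicator (ball x0 \<eta> - {0}) x \<le> ennreal ((cmod (p (sgn x)))\<^sup>2) * indicator (cball 0 1 - {0}) x"
    proof (cases "x \<in> ball x0 \<eta> \<and> x \<noteq> 0")
      case True
      have "(M / 2)\<^sup>2 \<le> (cmod (p (sgn x)))\<^sup>2" using low[of x] True by (intro power_mono) (auto simp: M_def)
      then show ?thesis using True cb[of x] by (auto simp: indicator_def intro!: ennreal_leI)
    qed (auto simp: indicator_def)
  qed
  also have "\<dots> \<le> of_nat CARD('d) * \<dots>"
  proof -
    have "(1::ennreal) \<le> of_nat CARD('d)" by (metis One_nat_def Suc_leI of_nat_1 of_nat_mono zero_less_card_finite)
    from mult_right_mono[OF this] show ?thesis by simp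
  qed
  also have "\<dots> = ennreal (Re (sphere_inner p p))" by (rule sphere_inner_self_nn_integral[OF cont, symmetric])
  finally have e: "ennreal ((M / 2)\<^sup>2 * (\<eta> ^ CARD('d) * ?V)) \<le> ennreal (Re (sphere_inner p p))" .
  have R0: "0 \<le> Re (sphere_inner p p)" unfolding Re_sphere_inner_self by simp
  have "(M / 2)\<^sup>2 * (\<eta> ^ CARD('d) * ?V) \<le> Re (sphere_inner p p)" using e R0 by (simp add: ennreal_le_iff)
  then have "M\<^sup>2 * (\<eta> ^ CARD('d) * ?V) \<le> 4 * Re (sphere_inner p p)" by (simp add: power_divide)
  then have "M\<^sup>2 \<le> 4 * Re (sphere_inner p p) / (\<eta> ^ CARD('d) * ?V)" using eta V by (simp add: pos_le_divide_eq)
  also have "\<dots> = sphere_sup_const TYPE('d) * (real k + 1) ^ (2 * CARD('d)) * Re (sphere_inner p p)"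
    unfolding power_mult using V by (simp add: sphere_sup_const_def \<eta>_def power_divide power_mult_distrib field_simps)
  finally have "M\<^sup>2 \<le> sphere_sup_const TYPE('d) * (real k + 1) ^ (2 * CARD('d)) * Re (sphere_inner p p)" .
  moreover have "(cmod (p \<theta>))\<^sup>2 \<le> M\<^sup>2" using om(2)[OF \<theta>] by (intro power_mono) (auto simp: M_def)
  ultimately show ?thesis by linarith
qed

section \<open>Uniqueness of series of homogeneous harmonic polynomials\<close>

lemma polynomial_function_partial_deriv:
  fixes p :: "'a::euclidean_space \<Rightarrow> complex"
  assumes "polynomial_function p"
  shows "polynomial_function (partial_deriv v p)"
  using polynomial_function_frechet_derivative[OF assms, of v]
  by (simp add: partial_deriv_eq_frechet_derivative[OF assms, symmetric])

lemma partial_deriv_add: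
  fixes p q :: "'a::euclidean_space \<Rightarrow> complex"
  assumes "polynomial_function p" "polynomial_function q"
  shows "partial_deriv v (\<lambda>x. p x + q x) = (\<lambda>x. partial_deriv v p x + partial_deriv v q x)"
proof
  fix x
  have "((\<lambda>t. p (x + t *\<^sub>R v) + q (x + t *\<^sub>R v)) has_vector_derivative
      poly (pderiv (line_poly p x v)) (of_real 0) + poly (pderiv (line_poly q x v)) (of_real 0)) (at 0)"
    by (intro has_vector_derivative_add line_poly_has_vector_derivative assms)
  then show "partial_deriv v (\<lambda>x. p x + q x) x = partial_deriv v p x + partial_deriv v q x"
    using partial_deriv_line_poly[OF assms(1), of v x 0] partial_deriv_line_poly[OF assms(2), of v x 0]
    by (simp add: partial_deriv_def[of v "\<lambda>x. p x + q x"] vector_derivative_at)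
qed

lemma laplacian_add:
  fixes p q :: "'a::euclidean_space \<Rightarrow> complex"
  assumes "polynomial_function p" "polynomial_function q"
  shows "laplacian (\<lambda>x. p x + q x) x = laplacian p x + laplacian q x"
  unfolding laplacian_def partial_deriv_add[OF assms]
  by (simp add: partial_deriv_add polynomial_function_partial_deriv assms sum.distrib)

lemma laplacian_sum_eq_0:
  fixes p :: "'i \<Rightarrow> 'a::euclidean_space \<Rightarrow> complex"
  assumes "finite I" "\<And>i. i \<in> I \<Longrightarrow> polynomial_function (p i)" "\<And>i x. i \<in> I \<Longrightarrow> laplacian (p i) x = 0"
  shows "polynomial_function (\<lambda>x. \<Sum>i\<in>I. p i x)" "laplacian (\<lambda>x. \<Sum>i\<in>I. p i x) x = 0"
proof -
  have "polynomial_function (\<lambda>x. \<Sum>i\<in>I. p i x) \<and> (\<forall>x. laplacian (\<lambda>x. \<Sum>i\<in>I. p i x) x = 0)"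
    using assms
  proof (induction I)
    case empty
    have "partial_deriv v (\<lambda>_::'a. 0::complex) = (\<lambda>_. 0)" for v by (simp add: partial_deriv_def fun_eq_iff vector_derivative_const_at)
    then show ?case by (simp add: laplacian_def)
  next
    case (insert i I)
    then show ?case by (simp add: laplacian_add polynomial_function_add)
  qed
  then show "polynomial_function (\<lambda>x. \<Sum>i\<in>I. p i x)" "laplacian (\<lambda>x. \<Sum>i\<in>I. p i x) x = 0" by auto
qed

text \<open>Writing \<open>q = a0 + t * (a1 + t * s)\<close>, the symmetric second difference of \<open>q\<close> at \<open>0\<close> is
  \<open>t\<^sup>2 * (s t + s (- t))\<close>, and \<open>s 0\<close> is the coefficient of degree 2.\<close>

lemma second_difference_bound:
  fixes q :: "complex poly"
  assumes "0 < \<epsilon>" and le: "\<And>t::real. 0 < t \<Longrightarrow> t < \<epsilon> \<Longrightarrow>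
      Re (c * (poly q (of_real t) + poly q (of_real (- t)) - 2 * poly q 0)) + 2 * \<kappa> * t\<^sup>2 \<le> 0"
  shows "Re (c * (2 * coeff q 2)) + 2 * \<kappa> \<le> 0"
proof -
  obtain a0 q1 where q: "q = pCons a0 q1" by (cases q)
  obtain a1 s where q1: "q1 = pCons a1 s" by (cases q1)
  have cf: "coeff q 2 = poly s 0" by (simp add: q q1 numeral_2_eq_2 poly_0_coeff_0)
  let ?h = "\<lambda>t::real. Re (c * (poly s (of_real t) + poly s (of_real (- t)))) + 2 * \<kappa>"
  have "?h t \<le> 0" if t: "0 < t" "t < \<epsilon>" for t
  proof -
    have "poly q (of_real t) + poly q (of_real (- t)) - 2 * poly q 0 = of_real (t\<^sup>2) * (poly s (of_real t) + poly s (of_real (- t)))"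
      by (simp add: q q1 power2_eq_square algebra_simps)
    then have "Re (c * (poly q (of_real t) + poly q (of_real (- t)) - 2 * poly q 0)) = t\<^sup>2 * Re (c * (poly s (of_real t) + poly s (of_real (- t))))"
      by (simp add: algebra_simps)
    then have "t\<^sup>2 * ?h t \<le> 0" using le[OF t] by (simp add: algebra_simps)
    then show ?thesis using t by (simp add: mult_le_0_iff)
  qed
  moreover have "(?h \<longlongrightarrow> ?h 0) (at_right 0)"
  proof -
    have "continuous_on UNIV ?h" by (intro continuous_intros)
    then have "isCont ?h 0" by (simp add: continuous_on_eq_continuous_at)
    then show ?thesis unfolding isCont_def filterlim_at_split by (rule conjunct2)
  qed
  ultimately have "?h 0 \<le> 0"
    by (intro tendsto_upperbound[of ?h _ "at_right 0"])
      (auto simp: eventually_at_right_field intro!: exI[of _ \<epsilon>] \<open>0 < \<epsilon>\<close>)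
  then show ?thesis using cf by (simp add: mult.commute mult.left_commute)
qed

text \<open>If \<open>|p x| > M\<close>, rotate so that \<open>c * p x = |p x|\<close>, and add a multiple \<open>\<kappa> * |y|\<^sup>2\<close> so small that
  \<open>Re (c * p y) + \<kappa> * |y|\<^sup>2\<close> still exceeds its boundary values somewhere inside. At an interior maximum
  all second differences are nonpositive, but the Laplacian of this function is positive.\<close>

lemma harmonic_maximum_principle:
  fixes p :: "'a::euclidean_space \<Rightarrow> complex"
  assumes p: "polynomial_function p" and harm: "\<And>x. laplacian p x = 0"
    and M: "\<And>x. norm x = 1 \<Longrightarrow> cmod (p x) \<le> M" and x: "norm x \<le> 1"
  shows "cmod (p x) \<le> M"
proof (rule ccontr)
  assume "\<not> cmod (p x) \<le> M"
  then have gt: "M < cmod (p x)" by simp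
  define c where "c = cnj (sgn (p x))"
  define \<kappa> where "\<kappa> = (cmod (p x) - M) / 2"
  have \<kappa>: "0 < \<kappa>" "M + \<kappa> < cmod (p x)" using gt by (auto simp: \<kappa>_def field_simps)
  have c1: "cmod c \<le> 1" by (simp add: c_def norm_sgn)
  have "c * p x = (p x * cnj (p x)) / of_real (cmod (p x))" by (simp add: c_def sgn_eq mult.commute)
  also have "\<dots> = of_real ((cmod (p x))\<^sup>2) / of_real (cmod (p x))" by (simp only: complex_norm_square)
  also have "\<dots> = of_real (cmod (p x))" by (simp add: power2_eq_square)
  finally have px: "Re (c * p x) = cmod (p x)" by simp
  define u where "u = (\<lambda>y. Re (c * p y) + \<kappa> * (y \<bullet> y))"
  have "continuous_on (cball 0 1) u"
    unfolding u_def using continuous_on_polymonial_function[OF p] by (intro continuous_intros)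
  then obtain y where y: "y \<in> cball 0 1" "\<And>z. z \<in> cball 0 1 \<Longrightarrow> u z \<le> u y"
    using continuous_attains_sup[of "cball (0::'a) 1" u] by auto
  have "norm y \<noteq> 1"
  proof
    assume ny: "norm y = 1"
    have "u y \<le> cmod (c * p y) + \<kappa>"
      using complex_Re_le_cmod[of "c * p y"] ny by (simp add: u_def norm_eq_1)
    also have "\<dots> \<le> 1 * M + \<kappa>"
      unfolding norm_mult using c1 M[OF ny] by (intro add_mono mult_mono) auto
    also have "\<dots> < Re (c * p x)" using \<kappa> px by simp
    also have "\<dots> \<le> u x" using \<kappa> by (simp add: u_def)
    finally show False using y(2)[of x] x by simp
  qed
  then have ny: "norm y < 1" using y(1) by simp
  have "Re (c * partial_deriv v (partial_deriv v p) y) + 2 * \<kappa> \<le> 0" if v: "v \<in> Basis" for v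
    unfolding partial_deriv_twice_eq_coeff[OF p]
  proof (rule second_difference_bound)
    show "0 < 1 - norm y" using ny by simp
    fix t :: real assume t: "0 < t" "t < 1 - norm y"
    have "norm (y + s *\<^sub>R v) \<le> 1" if "\<bar>s\<bar> = t" for s
      using norm_triangle_ineq[of y "s *\<^sub>R v"] that t v by simp
    then have le: "u (y + t *\<^sub>R v) \<le> u y" "u (y + (- t) *\<^sub>R v) \<le> u y"
      using t by (auto intro!: y(2) simp del: scaleR_minus_left)
    have p0: "p y = poly (line_poly p y v) 0" using line_poly[OF p, of y 0 v] by simp
    have vv: "v \<bullet> v = 1" using v by simp
    have q: "(y + t *\<^sub>R v) \<bullet> (y + t *\<^sub>R v) + (y + (- t) *\<^sub>R v) \<bullet> (y + (- t) *\<^sub>R v) = 2 * (y \<bullet> y) + 2 * t\<^sup>2"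
      by (simp add: inner_add_left inner_add_right inner_diff_left inner_diff_right vv inner_commute power2_eq_square)
    have "u (y + t *\<^sub>R v) + u (y + (- t) *\<^sub>R v) - 2 * u y
      = Re (c * (p (y + t *\<^sub>R v) + p (y + (- t) *\<^sub>R v) - 2 * p y)) + \<kappa> * ((y + t *\<^sub>R v) \<bullet> (y + t *\<^sub>R v) + (y + (- t) *\<^sub>R v) \<bullet> (y + (- t) *\<^sub>R v) - 2 * (y \<bullet> y))"
      unfolding u_def by (simp add: algebra_simps)
    also have "\<dots> = Re (c * (p (y + t *\<^sub>R v) + p (y + (- t) *\<^sub>R v) - 2 * p y)) + 2 * \<kappa> * t\<^sup>2"
      unfolding q by (simp add: algebra_simps)
    finally show "Re (c * (poly (line_poly p y v) (of_real t) + poly (line_poly p y v) (of_real (- t)) - 2 * poly (line_poly p y v) 0)) + 2 * \<kappa> * t\<^sup>2 \<le> 0"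
      unfolding line_poly[OF p, symmetric] p0[symmetric] using le by linarith
  qed
  then have "(\<Sum>v\<in>(Basis::'a set). Re (c * partial_deriv v (partial_deriv v p) y) + 2 * \<kappa>) \<le> 0"
    by (rule sum_nonpos)
  then have "Re (c * laplacian p y) + DIM('a) * (2 * \<kappa>) \<le> 0"
    by (simp add: sum.distrib laplacian_def sum_distrib_left)
  then have "DIM('a) * (2 * \<kappa>) \<le> 0" by (simp add: harm)
  moreover have "0 < DIM('a) * (2 * \<kappa>)" using \<kappa> DIM_positive[where 'a='a] by simp
  ultimately show False by simp
qed

text \<open>The partial sums are harmonic and on the sphere bounded by the tails of the series \<open>B\<close>; the maximum
  principle carries this over to \<open>r * \<theta>\<close>, so the power series in \<open>r\<close> with coefficients \<open>u k \<theta>\<close> vanishes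
  for \<open>0 \<le> r \<le> 1\<close>.\<close>

lemma harmonic_series_unique:
  fixes u :: "nat \<Rightarrow> real^'d \<Rightarrow> complex"
  assumes u: "\<And>k. homogeneous_poly k (u k)" "\<And>k x. laplacian (u k) x = 0"
    and B: "\<And>k \<theta>. \<theta> \<in> sphere 0 1 \<Longrightarrow> cmod (u k \<theta>) \<le> B k" "summable B"
    and s: "\<And>\<theta>. \<theta> \<in> sphere 0 1 \<Longrightarrow> (\<lambda>k. u k \<theta>) sums 0"
  shows "u k x = 0"
proof -
  have z: "u k \<theta> = 0" if th: "\<theta> \<in> sphere 0 1" for \<theta> k
  proof -
    define tail where "tail = (\<lambda>n. suminf B - (\<Sum>k<n. B k))"
    have tail0: "tail \<longlonglongrightarrow> 0"
      unfolding tail_def using summable_LIMSEQ[OF B(2)] LIM_zero_iff tendsto_diff[OF tendsto_const[of "suminf B"] summable_LIMSEQ[OF B(2)]] by simp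
    have part: "cmod (\<Sum>k<n. u k \<eta>) \<le> tail n" if "\<eta> \<in> sphere 0 1" for \<eta> n
    proof -
      have sm: "summable (\<lambda>k. norm (u k \<eta>))"
        using B(1)[OF that] by (intro summable_comparison_test[OF _ B(2)]) auto
      have "(\<Sum>k<n. u k \<eta>) = - (\<Sum>k. u (k + n) \<eta>)"
        using suminf_split_initial_segment[OF summable_norm_cancel[OF sm], of n] s[OF that] by (simp add: sums_iff algebra_simps eq_neg_iff_add_eq_0)
      then have "cmod (\<Sum>k<n. u k \<eta>) = cmod (\<Sum>k. u (k + n) \<eta>)" by simp
      also have "\<dots> \<le> (\<Sum>k. cmod (u (k + n) \<eta>))"
        by (rule summable_norm) (use sm summable_iff_shift[of "\<lambda>k. norm (u k \<eta>)" n] in simp)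
      also have "\<dots> \<le> (\<Sum>k. B (k + n))"
        by (intro suminf_le B that) (use sm summable_iff_shift[of "\<lambda>k. norm (u k \<eta>)" n] B(2) summable_iff_shift[of B n] in simp_all)
      also have "\<dots> = tail n" using suminf_split_initial_segment[OF B(2), of n] by (simp add: tail_def)
      finally show ?thesis .
    qed
    have pw: "cmod (\<Sum>k<n. u k \<theta> * of_real r ^ k) \<le> tail n" if "0 \<le> r" "r \<le> 1" for r n
    proof -
      have "cmod (\<Sum>k<n. u k (r *\<^sub>R \<theta>)) \<le> tail n"
      proof (rule harmonic_maximum_principle[where p = "\<lambda>x. \<Sum>k<n. u k x"])
        show "polynomial_function (\<lambda>x. \<Sum>k<n. u k x)" "\<And>x. laplacian (\<lambda>x. \<Sum>k<n. u k x) x = 0"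
          using u by (auto intro!: laplacian_sum_eq_0 simp: homogeneous_poly_def)
        show "norm (r *\<^sub>R \<theta>) \<le> 1" using th that by simp
      qed (use part in auto)
      moreover have "u k (r *\<^sub>R \<theta>) = u k \<theta> * of_real r ^ k" for k
        using u(1)[of k] by (simp add: homogeneous_poly_def mult.commute)
      ultimately show ?thesis by simp
    qed
    have sums0: "(\<lambda>k. u k \<theta> * of_real r ^ k) sums 0" if "0 \<le> r" "r \<le> 1" for r
      unfolding sums_def by (rule Lim_null_comparison[OF _ tail0]) (use pw that in auto)
    have "u j \<theta> = 0" for j
    proof (induction j rule: less_induct)
      case (less j)
      \<comment> \<open>divide the vanishing power series by \<open>r ^ j\<close> and let \<open>r\<close> tend to 0\<close>
      define v where "v = (\<lambda>i. u (i + j) \<theta>)"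
      have vr: "(\<lambda>i. v i * of_real r ^ i) sums 0" if "0 < r" "r \<le> 1" for r
      proof -
        have "(\<lambda>i. u (i + j) \<theta> * of_real r ^ (i + j)) sums 0"
          using sums_split_initial_segment[OF sums0[of r], of j] that less by simp
        then have "(\<lambda>i. of_real r ^ j * (v i * of_real r ^ i)) sums (of_real r ^ j * 0)"
          by (simp add: v_def power_add mult_ac)
        then show ?thesis using that by (subst (asm) sums_mult_iff) auto
      qed
      have sv: "summable (\<lambda>i. cmod (v i))"
      proof -
        have "summable (\<lambda>i. norm (u i \<theta>))" using B(1)[OF th] by (intro summable_comparison_test[OF _ B(2)]) auto
        then show ?thesis unfolding v_def using summable_iff_shift[of "\<lambda>k. norm (u k \<theta>)" j] by simp
      qed
      have "cmod (v 0) \<le> r * (\<Sum>i. cmod (v (Suc i)))" if "0 < r" "r \<le> 1" for r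
      proof -
        have sv': "summable (\<lambda>i. cmod (v (Suc i)))" using summable_Suc_iff[of "\<lambda>i. cmod (v i)"] sv by blast
        have t: "cmod (v (Suc i) * of_real r ^ Suc i) \<le> r * cmod (v (Suc i))" for i
        proof -
          have "r ^ Suc i \<le> r * 1" using that by (simp add: power_le_one mult_left_le)
          then show ?thesis using that by (simp add: norm_mult norm_power mult.commute[of r] mult_left_mono)
        qed
        have sn: "summable (\<lambda>i. norm (v (Suc i) * of_real r ^ Suc i))"
          using t by (intro summable_comparison_test[OF _ summable_mult[OF sv', of r]]) auto
        have "(\<lambda>i. v (Suc i) * of_real r ^ Suc i) sums (0 - v 0 * of_real r ^ 0)"
          using vr[OF that] sums_Suc_iff[of "\<lambda>i. v i * of_real r ^ i" "0 - v 0 * of_real r ^ 0"] by simp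
        then have "cmod (v 0) = cmod (\<Sum>i. v (Suc i) * of_real r ^ Suc i)"
          by (simp add: sums_iff)
        also have "\<dots> \<le> (\<Sum>i. norm (v (Suc i) * of_real r ^ Suc i))" by (rule summable_norm[OF sn])
        also have "\<dots> \<le> (\<Sum>i. r * cmod (v (Suc i)))" by (intro suminf_le t sn summable_mult sv')
        also have "\<dots> = r * (\<Sum>i. cmod (v (Suc i)))" by (rule suminf_mult[OF sv'])
        finally show ?thesis .
      qed
      then have "cmod (v 0) \<le> 0 * (\<Sum>i. cmod (v (Suc i)))"
        by (intro tendsto_lowerbound[of "\<lambda>r. r * (\<Sum>i. cmod (v (Suc i)))" _ "at_right 0"] tendsto_intros)
          (auto simp: eventually_at_right_field intro!: exI[of _ 1])
      then show ?case by (simp add: v_def)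
    qed
    then show ?thesis .
  qed
  have "cmod (u k x) \<le> 0 * norm x ^ k"
    by (rule homogeneous_poly_bound[OF u(1)]) (use z in auto)
  then show ?thesis by simp
qed

section \<open>Smooth sums of geometrically decaying series\<close>

lemma poly_growth_cmult_sum:
  assumes "finite I" "\<And>i. i \<in> I \<Longrightarrow> poly_growth k (p i)"
  shows "poly_growth k (\<lambda>x. \<Sum>i\<in>I. c i * p i x)"
  using assms
proof (induction I)
  case empty
  then show ?case by (auto simp: poly_growth_def intro: exI[of _ 0])
next
  case (insert i I)
  then have g: "poly_growth k (p i)" "poly_growth k (\<lambda>x. \<Sum>i\<in>I. c i * p i x)" by auto
  then obtain A B where A: "\<And>y. cmod (p i y) \<le> A * (1 + norm y) ^ k"
    and B: "\<And>y. cmod (\<Sum>i\<in>I. c i * p i y) \<le> B * (1 + norm y) ^ k"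
    unfolding poly_growth_def by blast
  have pi: "polynomial_function (p i)" "polynomial_function (\<lambda>x. \<Sum>i\<in>I. c i * p i x)"
    using g by (auto simp: poly_growth_def)
  have "polynomial_function (\<lambda>x. c i * p i x)"
    using pi(1) unfolding polynomial_function_complex_iff
    by (auto intro!: real_polynomial_function.intros(3,4) real_polynomial_function_diff real_polynomial_function.intros(2))
  moreover have "cmod (c i * p i y + (\<Sum>i\<in>I. c i * p i y)) \<le> (cmod (c i) * A + B) * (1 + norm y) ^ k" for y
  proof -
    have "cmod (c i * p i y + (\<Sum>i\<in>I. c i * p i y)) \<le> cmod (c i) * cmod (p i y) + cmod (\<Sum>i\<in>I. c i * p i y)"
      using norm_triangle_ineq by (metis norm_mult)
    also have "\<dots> \<le> cmod (c i) * (A * (1 + norm y) ^ k) + B * (1 + norm y) ^ k"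
      by (intro add_mono mult_left_mono A B) auto
    finally show ?thesis by (simp add: algebra_simps)
  qed
  ultimately show ?case using insert.hyps pi(2) by (auto simp: poly_growth_def intro!: polynomial_function_add)
qed

lemma poly_growth_has_derivative:
  assumes "poly_growth k p"
  shows "(p has_derivative frechet_derivative p (at x)) (at x)"
proof -
  have "polynomial_function p" using assms by (simp add: poly_growth_def)
  then show ?thesis
    using differentiable_at_polynomial_function frechet_derivative_works by blast
qed

lemma C_k_on_cong:
  assumes "open U" "\<And>x. x \<in> U \<Longrightarrow> f x = g x" "C_k_on n f U"
  shows "C_k_on n g U"
  using assms(2,3)
proof (induction n arbitrary: f g)
  case 0
  then show ?case using continuous_on_cong[OF refl, of U f g] by simp
next
  case (Suc n)
  have d: "f differentiable (at x)" if "x \<in> U" for x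
    using Suc.prems(2) that \<open>open U\<close> by (simp add: differentiable_on_eq_differentiable_at)
  have fd: "frechet_derivative f (at x) = frechet_derivative g (at x)" if "x \<in> U" for x
    by (rule frechet_derivative_transform_within_open[OF d[OF that] \<open>open U\<close> that Suc.prems(1)])
  have "g differentiable_on U"
  proof -
    have "g differentiable (at x)" if x: "x \<in> U" for x
    proof -
      obtain D where "(f has_derivative D) (at x)" using d[OF x] by (auto simp: differentiable_def)
      from has_derivative_transform_within_open[OF this \<open>open U\<close> x Suc.prems(1)]
      show ?thesis by (auto simp: differentiable_def)
    qed
    then show ?thesis using \<open>open U\<close> by (simp add: differentiable_on_eq_differentiable_at)
  qed
  moreover have "C_k_on n (\<lambda>x. frechet_derivative g (at x) v) U" if "v \<in> Basis" for v
    by (rule Suc.IH[of "\<lambda>x. frechet_derivative f (at x) v"]) (use Suc.prems that fd in auto)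
  ultimately show ?case by simp
qed

text \<open>The factors \<open>k + 1\<close> lost in differentiating terms of degree \<open>k\<close> are absorbed by a slightly larger
  ratio.\<close>

lemma geometric_absorb_linear:
  fixes q :: real
  assumes "0 \<le> q" "q < 1"
  shows "\<exists>q' D. 0 \<le> q' \<and> q' < 1 \<and> 0 \<le> D \<and> (\<forall>k. (real k + 1) * q ^ k \<le> D * q' ^ k)"
proof -
  \<comment> \<open>Any ratio strictly between \<open>q\<close> and 1 would do: \<open>n * (q / q') ^ n\<close> tends to 0.\<close>
  define q' where "q' = (1 + q) / 2"
  have q': "0 < q'" "q' < 1" "q < q'" using assms by (auto simp: q'_def)
  have "(\<lambda>n. of_nat n * (q / q') ^ n) \<longlonglongrightarrow> 0"
    using assms q' by (intro powser_times_n_limit_0) auto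
  then obtain D where D: "\<And>n. norm (of_nat n * (q / q') ^ n) \<le> D"
    using convergent_imp_Bseq[OF convergentI] BseqE by metis
  have "(real k + 1) * q ^ k \<le> (D + 1) * q' ^ k" for k
  proof -
    have "q ^ k = (q / q') ^ k * q' ^ k" using q' by (simp add: power_divide)
    moreover have "(real k + 1) * (q / q') ^ k \<le> D + 1"
      using D[of k] power_le_one[of "q / q'" k] assms q' by (simp add: distrib_right abs_mult)
    ultimately show ?thesis using q' mult_right_mono[of "(real k + 1) * (q / q') ^ k" "D + 1" "q' ^ k"] by (simp add: mult.assoc)
  qed
  moreover have "0 \<le> D" using D[of 0] by simp
  ultimately show ?thesis using q' by (intro exI[of _ q'] exI[of _ "D + 1"]) auto
qed

lemma geometric_absorb_power:
  fixes q :: real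
  assumes "0 \<le> q" "q < 1"
  shows "\<exists>q' D. 0 \<le> q' \<and> q' < 1 \<and> 0 \<le> D \<and> (\<forall>k. (real k + 1) ^ m * q ^ k \<le> D * q' ^ k)"
proof (induction m)
  case 0
  then show ?case using assms by (intro exI[of _ q] exI[of _ 1]) auto
next
  case (Suc m)
  then obtain q1 D1 where 1: "0 \<le> q1" "q1 < 1" "0 \<le> D1" "\<And>k. (real k + 1) ^ m * q ^ k \<le> D1 * q1 ^ k" by blast
  obtain q2 D2 where 2: "0 \<le> q2" "q2 < 1" "0 \<le> D2" "\<And>k. (real k + 1) * q1 ^ k \<le> D2 * q2 ^ k"
    using geometric_absorb_linear[OF 1(1,2)] by blast
  have "(real k + 1) ^ Suc m * q ^ k \<le> (D1 * D2) * q2 ^ k" for k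
  proof -
    have "(real k + 1) ^ Suc m * q ^ k = (real k + 1) * ((real k + 1) ^ m * q ^ k)" by simp
    also have "\<dots> \<le> (real k + 1) * (D1 * q1 ^ k)" by (intro mult_left_mono 1) auto
    also have "\<dots> = D1 * ((real k + 1) * q1 ^ k)" by simp
    also have "\<dots> \<le> D1 * (D2 * q2 ^ k)" by (intro mult_left_mono 1 2)
    finally show ?thesis by simp
  qed
  then show ?case using 1 2 by (intro exI[of _ q2] exI[of _ "D1 * D2"]) auto
qed

text \<open>Sequences of functions on the product of the annulus and a ball in Euclidean space; the parameter
  \<open>dim\<close> fixes the dimension of the latter.\<close>

locale annulus_ball =
  fixes a b \<rho> :: real and dim :: "'d::finite itself"
  assumes a_nonneg: "0 \<le> a"
begin

definition U :: "(complex \<times> (real^'d)) set" where "U = annulus a b \<times> ball 0 \<rho>"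

text \<open>Finite sums of products keep partial derivatives explicit: they act on one factor and produce a sum
  of the same kind.\<close>

definition regular_term :: "nat \<Rightarrow> (complex \<times> (real^'d) \<Rightarrow> complex) \<Rightarrow> bool" where
  "regular_term k u \<longleftrightarrow> (\<exists>(I :: nat set) F p. finite I \<and>
     (\<forall>i\<in>I. F i holomorphic_on annulus a b \<and> poly_growth k (p i)) \<and>
     (\<forall>z\<in>annulus a b. \<forall>x\<in>ball 0 \<rho>. u (z, x) = (\<Sum>i\<in>I. F i z * p i x)))"

text \<open>The bound concerns compact parts of \<open>U\<close>. Its geometric form, rather than mere summability, is what
  survives the factor \<open>k + 1\<close> of a derivative in \<open>x\<close>.\<close>

definition geometric_decay :: "(nat \<Rightarrow> complex \<times> (real^'d) \<Rightarrow> complex) \<Rightarrow> bool" where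
  "geometric_decay u \<longleftrightarrow> (\<forall>\<alpha> \<beta> R. a < \<alpha> \<and> \<beta> < b \<and> R < \<rho> \<longrightarrow>
     (\<exists>C q. 0 \<le> q \<and> q < 1 \<and> 0 \<le> C \<and>
       (\<forall>k z x. \<alpha> \<le> cmod z \<and> cmod z \<le> \<beta> \<and> norm x \<le> R \<longrightarrow> cmod (u k (z, x)) \<le> C * q ^ k)))"

definition analytic_series :: "(nat \<Rightarrow> complex \<times> (real^'d) \<Rightarrow> complex) \<Rightarrow> bool" where
  "analytic_series u \<longleftrightarrow> (\<forall>k. regular_term k (u k)) \<and> geometric_decay u"

lemma open_U: "open U"
  unfolding U_def by (intro open_Times open_annulus open_ball)

lemma regular_term_derivative:
  assumes I: "finite I" and F: "\<And>i. i \<in> I \<Longrightarrow> F i holomorphic_on annulus a b" and p: "\<And>i. i \<in> I \<Longrightarrow> poly_growth k (p i)"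
    and u: "\<And>z x. z \<in> annulus a b \<Longrightarrow> x \<in> ball 0 \<rho> \<Longrightarrow> u (z, x) = (\<Sum>i\<in>I. F i z * p i x)"
    and zx: "(z, x) \<in> U"
  shows "(u has_derivative (\<lambda>h. \<Sum>i\<in>I. F i z * frechet_derivative (p i) (at x) (snd h) + deriv (F i) z * fst h * p i x)) (at (z, x))"
proof -
  have "((\<lambda>w. \<Sum>i\<in>I. F i (fst w) * p i (snd w)) has_derivative
      (\<lambda>h. \<Sum>i\<in>I. F i z * frechet_derivative (p i) (at x) (snd h) + deriv (F i) z * fst h * p i x)) (at (z, x))"
  proof (rule has_derivative_sum)
    fix i assume i: "i \<in> I"
    have z: "z \<in> annulus a b" using zx by (simp add: U_def)
    have "(F i has_field_derivative deriv (F i) z) (at z)"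
      by (rule holomorphic_derivI[OF F[OF i] open_annulus z])
    then have "(F i has_derivative (\<lambda>h. deriv (F i) z * h)) (at (fst (z, x)))"
      by (simp add: has_field_derivative_def)
    from has_derivative_compose[OF has_derivative_fst[OF has_derivative_ident] this]
    have 1: "((\<lambda>w. F i (fst w)) has_derivative (\<lambda>h. deriv (F i) z * fst h)) (at (z, x))" by simp
    have "(p i has_derivative frechet_derivative (p i) (at x)) (at (snd (z, x)))"
      using poly_growth_has_derivative[OF p[OF i]] by simp
    from has_derivative_compose[OF has_derivative_snd[OF has_derivative_ident] this]
    have 2: "((\<lambda>w. p i (snd w)) has_derivative (\<lambda>h. frechet_derivative (p i) (at x) (snd h))) (at (z, x))" by simp
    from has_derivative_mult[OF 1 2]
    show "((\<lambda>w. F i (fst w) * p i (snd w)) has_derivative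
        (\<lambda>h. F i z * frechet_derivative (p i) (at x) (snd h) + deriv (F i) z * fst h * p i x)) (at (z, x))" by simp
  qed
  then show ?thesis
    by (rule has_derivative_transform_within_open[OF _ open_U zx]) (auto simp: U_def u)
qed

lemma geometric_decayE:
  assumes "geometric_decay u" "a < \<alpha>" "\<beta> < b" "R < \<rho>"
  obtains C q where "0 \<le> q" "q < 1" "0 \<le> C"
    "\<And>k z x. \<alpha> \<le> cmod z \<Longrightarrow> cmod z \<le> \<beta> \<Longrightarrow> norm x \<le> R \<Longrightarrow> cmod (u k (z, x)) \<le> C * q ^ k"
proof -
  from assms(1)[unfolded geometric_decay_def, rule_format, OF conjI[OF assms(2) conjI[OF assms(3,4)]]]
  show ?thesis using that by blast
qed

text \<open>The class is closed under partial derivatives, so that one differentiation can be iterated. For a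
  derivative in \<open>z\<close> Cauchy's estimate is used on a slightly larger annulus; for a derivative in \<open>x\<close> the
  Markov type bound is used on a slightly larger ball. Both estimates are applied to the whole term
  rather than to its summands. Off \<open>U\<close> the value is set to \<open>0\<close>.\<close>

lemma analytic_series_partial:
  assumes u: "analytic_series u" and v: "v \<in> Basis"
  shows "analytic_series (\<lambda>k w. if w \<in> U then frechet_derivative (u k) (at w) v else 0)"
    (is "analytic_series ?u'")
proof -
  have reg: "\<And>k. regular_term k (u k)" and geo: "geometric_decay u" using u by (auto simp: analytic_series_def)
  define represents where "represents = (\<lambda>k (I :: nat set) F p. finite I \<and>
     (\<forall>i\<in>I. F i holomorphic_on annulus a b \<and> poly_growth k (p i)) \<and>
     (\<forall>z\<in>annulus a b. \<forall>x\<in>ball 0 \<rho>. u k (z, x) = (\<Sum>i\<in>I. F i z * p i x)))"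
  have "\<exists>I F p. represents k I F p" for k
    using reg[of k] unfolding regular_term_def represents_def by blast
  then obtain I F p where rep: "\<And>k. represents k (I k) (F k) (p k)" by metis
  then have I: "\<And>k. finite (I k)" and F: "\<And>k i. i \<in> I k \<Longrightarrow> F k i holomorphic_on annulus a b"
    and p: "\<And>k i. i \<in> I k \<Longrightarrow> poly_growth k (p k i)"
    and eq: "\<And>k z x. z \<in> annulus a b \<Longrightarrow> x \<in> ball 0 \<rho> \<Longrightarrow> u k (z, x) = (\<Sum>i\<in>I k. F k i z * p k i x)"
    unfolding represents_def by blast+
  have fd: "frechet_derivative (u k) (at (z, x)) v = (\<Sum>i\<in>I k. F k i z * frechet_derivative (p k i) (at x) (snd v) + deriv (F k i) z * fst v * p k i x)"
    if "(z, x) \<in> U" for k z x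
    by (rule frechet_derivative_at[OF regular_term_derivative[OF I F p eq that], THEN fun_cong, symmetric])
  consider e where "e \<in> Basis" "v = (e, 0)" | e where "e \<in> Basis" "v = (0, e)"
    using v by (auto simp: Basis_prod_def)
  then show ?thesis
  proof cases
    case (1 e)
    have lin0: "frechet_derivative (p k i) (at x) 0 = 0" if "i \<in> I k" for k i x
      using p[OF that] by (intro linear_0 linear_frechet_derivative differentiable_at_polynomial_function) (simp add: poly_growth_def)
    have u': "?u' k (z, x) = (\<Sum>i\<in>I k. (deriv (F k i) z * e) * p k i x)" if "(z, x) \<in> U" for k z x
      using that fd[OF that] 1 by (auto intro!: sum.cong simp: lin0)
    have "regular_term k (?u' k)" for k
      unfolding regular_term_def
    proof (intro exI conjI ballI)
      show "?u' k (z, x) = (\<Sum>i\<in>I k. (\<lambda>i z. deriv (F k i) z * e) i z * p k i x)" if "z \<in> annulus a b" "x \<in> ball 0 \<rho>" for z x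
        using u'[of z x k] that by (simp add: U_def)
      show "(\<lambda>z. deriv (F k i) z * e) holomorphic_on annulus a b" if "i \<in> I k" for i
        by (intro holomorphic_intros holomorphic_deriv F that open_annulus)
    qed (use I p in auto)
    moreover have "geometric_decay ?u'"
      unfolding geometric_decay_def
    proof (intro allI impI)
      fix \<alpha> \<beta> R assume h: "a < \<alpha> \<and> \<beta> < b \<and> R < \<rho>"
      define r where "r = min ((\<alpha> - a) / 2) ((b - \<beta>) / 2)"
      have r: "0 < r" "a < \<alpha> - r" "\<beta> + r < b" using h by (auto simp: r_def min_def field_simps)
      obtain C q where Cq: "0 \<le> q" "q < 1" "0 \<le> C"
        and bd: "\<And>k z x. \<alpha> - r \<le> cmod z \<Longrightarrow> cmod z \<le> \<beta> + r \<Longrightarrow> norm x \<le> R \<Longrightarrow> cmod (u k (z, x)) \<le> C * q ^ k"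
        by (rule geometric_decayE[OF geo r(2,3), of R]) (use h in blast)+
      have "cmod (?u' k (z, x)) \<le> C / r * q ^ k" if z: "\<alpha> \<le> cmod z" "cmod z \<le> \<beta>" and x: "norm x \<le> R" for k z x
      proof -
        have zA: "z \<in> annulus a b" and xB: "x \<in> ball 0 \<rho>" using z x h by (auto simp: annulus_def)
        have band: "\<alpha> - r \<le> cmod y \<and> cmod y \<le> \<beta> + r" if "cmod (z - y) \<le> r" for y
          using that z norm_triangle_ineq2[of z y] norm_triangle_ineq2[of y z] by (simp add: norm_minus_commute)
        have sub: "cball z r \<subseteq> annulus a b"
          using band r by (fastforce simp: dist_norm annulus_def)
        let ?f = "\<lambda>y. \<Sum>i\<in>I k. F k i y * p k i x"
        have hol: "?f holomorphic_on annulus a b" by (intro holomorphic_intros F)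
        have "cmod ((deriv ^^ 1) ?f z) \<le> fact 1 * (C * q ^ k) / r ^ 1"
        proof (rule Cauchy_inequality)
          show "?f holomorphic_on ball z r" using hol sub ball_subset_cball by (meson holomorphic_on_subset order_trans)
          show "continuous_on (cball z r) ?f" using hol sub by (meson continuous_on_subset holomorphic_on_imp_continuous_on)
          show "0 < r" by fact
          fix y assume y: "cmod (z - y) = r"
          then have "y \<in> annulus a b" using sub by (auto simp: dist_norm)
          then show "cmod (?f y) \<le> C * q ^ k"
            using bd[of y x k] band[of y] y x eq[OF _ xB, of y k] by simp
        qed
        moreover have "deriv ?f z = (\<Sum>i\<in>I k. deriv (F k i) z * p k i x)"
          by (rule DERIV_imp_deriv, rule DERIV_sum)
            (auto intro!: derivative_eq_intros holomorphic_derivI[OF F open_annulus zA])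
        moreover have "?u' k (z, x) = e * (\<Sum>i\<in>I k. deriv (F k i) z * p k i x)"
          using u'[of z x k] zA xB by (simp add: U_def sum_distrib_left mult_ac)
        moreover have "cmod e = 1" using 1 by auto
        ultimately show ?thesis by (simp add: norm_mult)
      qed
      then show "\<exists>C q. 0 \<le> q \<and> q < 1 \<and> 0 \<le> C \<and> (\<forall>k z x. \<alpha> \<le> cmod z \<and> cmod z \<le> \<beta> \<and> norm x \<le> R \<longrightarrow> cmod (?u' k (z, x)) \<le> C * q ^ k)"
        using Cq r by (intro exI[of _ "C / r"] exI[of _ q]) auto
    qed
    ultimately show ?thesis by (simp add: analytic_series_def)
  next
    case (2 e)
    have u': "?u' k (z, x) = (\<Sum>i\<in>I k. F k i z * frechet_derivative (p k i) (at x) e)" if "(z, x) \<in> U" for k z x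
      using that fd[OF that] 2 by simp
    have "regular_term k (?u' k)" for k
      unfolding regular_term_def
    proof (intro exI conjI ballI)
      show "?u' k (z, x) = (\<Sum>i\<in>I k. F k i z * (\<lambda>i x. frechet_derivative (p k i) (at x) e) i x)" if "z \<in> annulus a b" "x \<in> ball 0 \<rho>" for z x
        using u'[of z x k] that by (simp add: U_def)
      show "poly_growth k (\<lambda>x. frechet_derivative (p k i) (at x) e)" if "i \<in> I k" for i
        by (intro poly_growth_frechet_derivative p that)
    qed (use I F in auto)
    moreover have "geometric_decay ?u'"
      unfolding geometric_decay_def
    proof (intro allI impI)
      fix \<alpha> \<beta> R assume h: "a < \<alpha> \<and> \<beta> < b \<and> R < \<rho>"
      define \<delta> where "\<delta> = (\<rho> - R) / 2"
      have \<delta>: "0 < \<delta>" "R + \<delta> < \<rho>" using h by (auto simp: \<delta>_def field_simps)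
      obtain C q where Cq: "0 \<le> q" "q < 1" "0 \<le> C"
        and bd: "\<And>k z x. \<alpha> \<le> cmod z \<Longrightarrow> cmod z \<le> \<beta> \<Longrightarrow> norm x \<le> R + \<delta> \<Longrightarrow> cmod (u k (z, x)) \<le> C * q ^ k"
        by (rule geometric_decayE[OF geo _ _ \<delta>(2), of \<alpha> \<beta>]) (use h in blast)+
      obtain q' D where q': "0 \<le> q'" "q' < 1" "0 \<le> D" "\<And>k. (real k + 1) * q ^ k \<le> D * q' ^ k"
        using geometric_absorb_linear[OF Cq(1,2)] by blast
      have "cmod (?u' k (z, x)) \<le> (7 * C * D / \<delta>) * q' ^ k" if z: "\<alpha> \<le> cmod z" "cmod z \<le> \<beta>" and x: "norm x \<le> R" for k z x
      proof -
        have zA: "z \<in> annulus a b" and xB: "x \<in> ball 0 \<rho>" using z x h by (auto simp: annulus_def)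
        let ?P = "\<lambda>x. \<Sum>i\<in>I k. F k i z * p k i x"
        have "cmod (frechet_derivative ?P (at x) e) \<le> 7 * (real k + 1) * (C * q ^ k) / \<delta>"
        proof (rule Markov_directional[OF poly_growth_cmult_sum[OF I p] \<delta>(1)])
          fix t :: real assume t: "\<bar>t\<bar> \<le> \<delta>"
          have "norm (x + t *\<^sub>R e) \<le> R + \<delta>"
            using norm_triangle_ineq[of x "t *\<^sub>R e"] t x 2 by simp
          moreover from this have "x + t *\<^sub>R e \<in> ball 0 \<rho>" using \<delta> by simp
          ultimately show "cmod (?P (x + t *\<^sub>R e)) \<le> C * q ^ k"
            using bd[OF z, of "x + t *\<^sub>R e" k] eq[OF zA, of "x + t *\<^sub>R e" k] by simp
        qed
        also have "frechet_derivative ?P (at x) = (\<lambda>v. \<Sum>i\<in>I k. F k i z * frechet_derivative (p k i) (at x) v)"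
        proof (rule frechet_derivative_at[symmetric], rule has_derivative_sum, rule has_derivative_mult_right)
          fix i assume "i \<in> I k"
          then show "(p k i has_derivative frechet_derivative (p k i) (at x)) (at x)"
            by (rule poly_growth_has_derivative[OF p])
        qed
        finally have "cmod (?u' k (z, x)) \<le> 7 * (real k + 1) * (C * q ^ k) / \<delta>"
          using u'[of z x k] zA xB by (simp add: U_def)
        also have "\<dots> = 7 * C / \<delta> * ((real k + 1) * q ^ k)" by simp
        also have "\<dots> \<le> 7 * C / \<delta> * (D * q' ^ k)" using Cq \<delta> by (intro mult_left_mono q') auto
        finally show ?thesis by (simp add: mult_ac)
      qed
      then show "\<exists>C q. 0 \<le> q \<and> q < 1 \<and> 0 \<le> C \<and> (\<forall>k z x. \<alpha> \<le> cmod z \<and> cmod z \<le> \<beta> \<and> norm x \<le> R \<longrightarrow> cmod (?u' k (z, x)) \<le> C * q ^ k)"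
        using Cq q' \<delta> by (intro exI[of _ "7 * C * D / \<delta>"] exI[of _ q']) auto
    qed
    ultimately show ?thesis by (simp add: analytic_series_def)
  qed
qed

lemma U_local_band:
  assumes "w \<in> U"
  obtains \<alpha> \<beta> R e where "a < \<alpha>" "\<beta> < b" "R < \<rho>" "0 < e" "ball w e \<subseteq> U"
    "\<And>z x. (z, x) \<in> ball w e \<Longrightarrow> \<alpha> \<le> cmod z \<and> cmod z \<le> \<beta> \<and> norm x \<le> R"
proof -
  obtain z0 x0 where w: "w = (z0, x0)" by (cases w)
  have wU: "a < cmod z0" "cmod z0 < b" "norm x0 < \<rho>" using assms by (auto simp: w U_def annulus_def)
  define \<alpha> where "\<alpha> = (a + cmod z0) / 2"
  define \<beta> where "\<beta> = (b + cmod z0) / 2"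
  define R where "R = (\<rho> + norm x0) / 2"
  have lt: "a < \<alpha>" "\<alpha> < cmod z0" "cmod z0 < \<beta>" "\<beta> < b" "norm x0 < R" "R < \<rho>"
    using wU by (auto simp: \<alpha>_def \<beta>_def R_def)
  have "open (annulus \<alpha> \<beta> \<times> ball (0::real^'d) R)" by (intro open_Times open_annulus open_ball)
  moreover have "w \<in> annulus \<alpha> \<beta> \<times> ball 0 R" using lt by (auto simp: w annulus_def)
  ultimately obtain e where e: "0 < e" "ball w e \<subseteq> annulus \<alpha> \<beta> \<times> ball 0 R"
    by (meson open_contains_ball)
  moreover have "annulus \<alpha> \<beta> \<times> ball 0 R \<subseteq> U" using lt by (auto simp: U_def annulus_def)
  moreover have "\<alpha> \<le> cmod z \<and> cmod z \<le> \<beta> \<and> norm x \<le> R" if "(z, x) \<in> ball w e" for z x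
    using e that by (fastforce simp: annulus_def)
  ultimately show ?thesis
    by (intro that[OF lt(1,4,6) e(1)]) (blast intro: order_trans)+
qed

lemma analytic_series_local_bound:
  assumes u: "analytic_series u" and h: "a < \<alpha>" "\<beta> < b" "R < \<rho>"
  shows "\<exists>M. summable M \<and> (\<forall>k z x. \<alpha> \<le> cmod z \<and> cmod z \<le> \<beta> \<and> norm x \<le> R \<longrightarrow> cmod (u k (z, x)) \<le> M k)"
proof -
  have "geometric_decay u" using u by (simp add: analytic_series_def)
  then obtain C q where "0 \<le> q" "q < 1" "0 \<le> C"
    "\<And>k z x. \<alpha> \<le> cmod z \<Longrightarrow> cmod z \<le> \<beta> \<Longrightarrow> norm x \<le> R \<Longrightarrow> cmod (u k (z, x)) \<le> C * q ^ k"
    by (rule geometric_decayE[OF _ h]) blast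
  then show ?thesis by (intro exI[of _ "\<lambda>k. C * q ^ k"]) (auto intro!: summable_mult summable_geometric)
qed

lemma analytic_series_differentiable_term:
  assumes "analytic_series u" "w \<in> U"
  shows "(u k has_derivative frechet_derivative (u k) (at w)) (at w)"
proof -
  obtain z x where w: "w = (z, x)" by (cases w)
  have "regular_term k (u k)" using assms(1) by (simp add: analytic_series_def)
  then obtain I F p where I: "finite (I :: nat set)"
    and Fp: "\<And>i. i \<in> I \<Longrightarrow> F i holomorphic_on annulus a b" "\<And>i. i \<in> I \<Longrightarrow> poly_growth k (p i)"
    and eq: "\<And>z x. z \<in> annulus a b \<Longrightarrow> x \<in> ball 0 \<rho> \<Longrightarrow> u k (z, x) = (\<Sum>i\<in>I. F i z * p i x)"
    unfolding regular_term_def by blast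
  have "(z, x) \<in> U" using assms(2) w by simp
  from regular_term_derivative[OF I Fp eq this] have "u k differentiable (at w)"
    unfolding w differentiable_def by blast
  then show ?thesis using frechet_derivative_works by blast
qed

text \<open>On a small ball the derivatives of the terms, as linear maps, are bounded by the sum of the bounds
  for the basis directions, which is summable. So the series of derivatives converges uniformly.\<close>

lemma analytic_series_has_derivative:
  assumes u: "analytic_series u" and w: "w \<in> U"
  shows "((\<lambda>w. \<Sum>k. u k w) has_derivative (\<lambda>h. \<Sum>k. frechet_derivative (u k) (at w) h)) (at w)"
    and "isCont (\<lambda>w. \<Sum>k. u k w) w"
proof -
  obtain \<alpha> \<beta> R e where loc: "a < \<alpha>" "\<beta> < b" "R < \<rho>" "0 < e" "ball w e \<subseteq> U"
    "\<And>z x. (z, x) \<in> ball w e \<Longrightarrow> \<alpha> \<le> cmod z \<and> cmod z \<le> \<beta> \<and> norm x \<le> R"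
    using U_local_band[OF w] by blast
  obtain M0 where M0: "summable M0" "\<And>k z x. \<alpha> \<le> cmod z \<and> cmod z \<le> \<beta> \<and> norm x \<le> R \<Longrightarrow> cmod (u k (z, x)) \<le> M0 k"
    using analytic_series_local_bound[OF u loc(1-3)] by blast
  have su: "summable (\<lambda>k. u k y)" if "y \<in> ball w e" for y
    using M0(2)[OF loc(6)[of "fst y" "snd y"]] that
    by (intro summable_comparison_test[OF _ M0(1)]) auto
  have "\<forall>v\<in>Basis. \<exists>M. summable M \<and> (\<forall>k. \<forall>y\<in>ball w e. cmod (frechet_derivative (u k) (at y) v) \<le> M k)"
  proof
    fix v :: "complex \<times> (real^'d)" assume v: "v \<in> Basis"
    obtain M where M: "summable M" "\<And>k z x. \<alpha> \<le> cmod z \<and> cmod z \<le> \<beta> \<and> norm x \<le> R \<Longrightarrow>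
        cmod (if (z, x) \<in> U then frechet_derivative (u k) (at (z, x)) v else 0) \<le> M k"
      using analytic_series_local_bound[OF analytic_series_partial[OF u v] loc(1-3)] by blast
    have "cmod (frechet_derivative (u k) (at y) v) \<le> M k" if "y \<in> ball w e" for k y
      using M(2)[of "fst y" "snd y" k] loc(5,6) that by (cases y) auto
    then show "\<exists>M. summable M \<and> (\<forall>k. \<forall>y\<in>ball w e. cmod (frechet_derivative (u k) (at y) v) \<le> M k)" using M(1) by blast
  qed
  then obtain Mv where Mv: "\<And>v. v \<in> Basis \<Longrightarrow> summable (Mv v)"
    "\<And>v k y. v \<in> Basis \<Longrightarrow> y \<in> ball w e \<Longrightarrow> cmod (frechet_derivative (u k) (at y) v) \<le> Mv v k"
    by metis
  define M where "M = (\<lambda>k. \<Sum>v\<in>(Basis :: (complex \<times> (real^'d)) set). Mv v k)"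
  have sM: "summable M" unfolding M_def by (intro summable_sum Mv)
  have lin: "cmod (frechet_derivative (u k) (at y) h) \<le> norm h * M k" if y: "y \<in> ball w e" for k y h
  proof -
    have l: "linear (frechet_derivative (u k) (at y))"
      by (rule has_derivative_linear[OF analytic_series_differentiable_term[OF u]]) (use loc(5) y in blast)
    have "frechet_derivative (u k) (at y) h = frechet_derivative (u k) (at y) (\<Sum>v\<in>Basis. (h \<bullet> v) *\<^sub>R v)"
      by (simp add: euclidean_representation)
    also have "\<dots> = (\<Sum>v\<in>Basis. (h \<bullet> v) *\<^sub>R frechet_derivative (u k) (at y) v)"
      by (simp add: linear_sum[OF l] linear_cmul[OF l])
    also have "cmod \<dots> \<le> (\<Sum>v\<in>Basis. norm h * Mv v k)"
      by (intro sum_norm_le) (auto intro!: mult_mono Mv y simp: Basis_le_norm)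
    finally show ?thesis by (simp add: M_def sum_distrib_left)
  qed
  have sd: "summable (\<lambda>k. norm (frechet_derivative (u k) (at y) h))" if "y \<in> ball w e" for y h
    using lin[OF that] by (intro summable_comparison_test[OF _ summable_mult[OF sM, of "norm h"]]) auto
  have tail: "\<forall>\<^sub>F n in sequentially. \<forall>y\<in>ball w e. \<forall>h. norm ((\<Sum>i<n. frechet_derivative (u i) (at y) h) - (\<Sum>k. frechet_derivative (u k) (at y) h)) \<le> \<epsilon> * norm h"
    if "\<epsilon> > 0" for \<epsilon>
  proof -
    have "(\<lambda>n. suminf M - (\<Sum>i<n. M i)) \<longlonglongrightarrow> suminf M - suminf M"
      by (intro tendsto_intros summable_LIMSEQ sM)
    then have "\<forall>\<^sub>F n in sequentially. suminf M - (\<Sum>i<n. M i) < \<epsilon>"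
      using that by (intro order_tendstoD(2)) auto
    then show ?thesis
    proof eventually_elim
      case (elim n)
      have "norm ((\<Sum>i<n. frechet_derivative (u i) (at y) h) - (\<Sum>k. frechet_derivative (u k) (at y) h)) \<le> \<epsilon> * norm h"
        if y: "y \<in> ball w e" for y h
      proof -
        let ?d = "\<lambda>k. frechet_derivative (u k) (at y) h"
        have "norm ((\<Sum>i<n. ?d i) - (\<Sum>k. ?d k)) = norm (\<Sum>k. ?d (k + n))"
          using suminf_split_initial_segment[OF summable_norm_cancel[OF sd[OF y]], of h n] by (simp add: norm_minus_commute)
        also have "\<dots> \<le> (\<Sum>k. norm (?d (k + n)))"
          using sd[OF y, of h] summable_iff_shift[of "\<lambda>k. norm (?d k)" n] by (intro summable_norm) blast
        also have "\<dots> \<le> (\<Sum>k. norm h * M (k + n))"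
        proof (rule suminf_le)
          show "summable (\<lambda>k. norm (?d (k + n)))" using sd[OF y, of h] summable_iff_shift[of "\<lambda>k. norm (?d k)" n] by blast
          show "summable (\<lambda>k. norm h * M (k + n))" using sM summable_iff_shift[of M n] by (intro summable_mult) blast
        qed (use lin y in auto)
        also have "\<dots> = norm h * (suminf M - (\<Sum>i<n. M i))"
          using suminf_split_initial_segment[OF sM, of n] sM summable_iff_shift[of M n] by (subst suminf_mult) auto
        also have "\<dots> \<le> norm h * \<epsilon>" using elim by (intro mult_left_mono) auto
        finally show ?thesis by (simp add: mult.commute)
      qed
      then show ?case by blast
    qed
  qed
  have wb: "w \<in> ball w e" using loc by simp
  have "\<exists>g. \<forall>y\<in>ball w e. (\<lambda>n. u n y) sums g y \<and> (g has_derivative (\<lambda>h. \<Sum>k. frechet_derivative (u k) (at y) h)) (at y within ball w e)"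
  proof (rule has_derivative_series[OF convex_ball _ tail wb])
    show "(u n has_derivative frechet_derivative (u n) (at y)) (at y within ball w e)" if "y \<in> ball w e" for n y
      using analytic_series_differentiable_term[OF u] loc(5) that by (blast intro: has_derivative_at_withinI)
    show "(\<lambda>n. u n w) sums (\<Sum>n. u n w)" using su[OF wb] by (rule summable_sums)
  qed
  then obtain g where g: "\<And>y. y \<in> ball w e \<Longrightarrow> (\<lambda>n. u n y) sums g y"
    "(g has_derivative (\<lambda>h. \<Sum>k. frechet_derivative (u k) (at w) h)) (at w within ball w e)" using wb by blast
  then have "(g has_derivative (\<lambda>h. \<Sum>k. frechet_derivative (u k) (at w) h)) (at w)"
    using at_within_open[OF wb open_ball] by simp
  then show d: "((\<lambda>w. \<Sum>k. u k w) has_derivative (\<lambda>h. \<Sum>k. frechet_derivative (u k) (at w) h)) (at w)"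
    by (rule has_derivative_transform_within_open[OF _ open_ball wb]) (use g(1) in \<open>auto simp: sums_iff\<close>)
  then show "isCont (\<lambda>w. \<Sum>k. u k w) w" by (rule has_derivative_continuous)
qed

theorem analytic_series_C_k:
  assumes "analytic_series u"
  shows "C_k_on n (\<lambda>w. \<Sum>k. u k w) U"
  using assms
proof (induction n arbitrary: u)
  case 0
  then show ?case using analytic_series_has_derivative(2) by (auto intro!: continuous_at_imp_continuous_on)
next
  case (Suc n)
  note der = analytic_series_has_derivative(1)[OF Suc.prems]
  have "(\<lambda>w. \<Sum>k. u k w) differentiable_on U"
    using der by (auto simp: differentiable_on_def differentiable_def intro: has_derivative_at_withinI)
  moreover have "C_k_on n (\<lambda>x. frechet_derivative (\<lambda>w. \<Sum>k. u k w) (at x) v) U" if v: "v \<in> Basis" for v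
  proof (rule C_k_on_cong[OF open_U _ Suc.IH[OF analytic_series_partial[OF Suc.prems v]]])
    fix x assume x: "x \<in> U"
    have "frechet_derivative (\<lambda>w. \<Sum>k. u k w) (at x) v = (\<Sum>k. frechet_derivative (u k) (at x) v)"
      by (rule frechet_derivative_at[OF der[OF x], THEN fun_cong, symmetric])
    then show "(\<Sum>k. if x \<in> U then frechet_derivative (u k) (at x) v else 0) = frechet_derivative (\<lambda>w. \<Sum>k. u k w) (at x) v"
      using x by simp
  qed
  ultimately show ?case by simp
qed

end

section \<open>Expansions in spherical harmonics\<close>

lemma sphere_inner_sum:
  fixes p :: "nat \<Rightarrow> real^'d \<Rightarrow> complex"
  assumes fin: "finite A" and cont: "\<And>l. l \<in> A \<Longrightarrow> continuous_on UNIV (p l)"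
    and orth: "\<And>l m. l \<in> A \<Longrightarrow> m \<in> A \<Longrightarrow> sphere_inner (p l) (p m) = (if l = m then 1 else 0)"
  shows "sphere_inner (\<lambda>x. \<Sum>l\<in>A. c l * p l x) (\<lambda>x. \<Sum>l\<in>A. c l * p l x) = of_real (\<Sum>l\<in>A. (cmod (c l))\<^sup>2)"
proof -
  have "(\<Sum>l\<in>A. c l * p l x) * cnj (\<Sum>l\<in>A. c l * p l x) = (\<Sum>l\<in>A. \<Sum>m\<in>A. (c l * cnj (c m)) * (p l x * cnj (p m x)))" for x
    unfolding cnj_sum sum_product by (intro sum.cong refl) (simp add: mult_ac)
  moreover have "integrable sphere_measure (\<lambda>x. p l x * cnj (p m x))" if "l \<in> A" "m \<in> A" for l m
    by (intro continuous_on_imp_integrable_sphere continuous_intros cont that)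
  ultimately have "sphere_inner (\<lambda>x. \<Sum>l\<in>A. c l * p l x) (\<lambda>x. \<Sum>l\<in>A. c l * p l x)
      = (\<Sum>l\<in>A. \<Sum>m\<in>A. (c l * cnj (c m)) * sphere_inner (p l) (p m))"
    by (simp add: sphere_inner_def del: cnj_sum)
  also have "\<dots> = (\<Sum>l\<in>A. \<Sum>m\<in>A. if m = l then c l * cnj (c l) else 0)"
    by (intro sum.cong refl) (auto simp: orth)
  also have "\<dots> = (\<Sum>l\<in>A. c l * cnj (c l))" using fin by (simp add: sum.delta)
  finally show ?thesis by (simp only: of_real_sum complex_norm_square)
qed

definition harmonic_growth :: "'d::finite itself \<Rightarrow> nat \<Rightarrow> real" where
  "harmonic_growth _ k = sphere_sup_const TYPE('d) * (real k + 1) ^ (2 * CARD('d))"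

lemma harmonic_growth_nonneg: "0 \<le> harmonic_growth TYPE('d::finite) k"
  unfolding harmonic_growth_def using sphere_sup_const_pos[where 'd='d] by auto

text \<open>The parameters \<open>J\<close> and \<open>I\<close> only name the set of all indices and the set of indices of one degree.\<close>

locale polyharmonic_hardy = hardy_annulus a b for a b +
  fixes L :: real and Y :: "nat \<Rightarrow> nat \<Rightarrow> real^'d \<Rightarrow> real" and J :: "(nat \<times> nat) set" and I :: "nat \<Rightarrow> nat set"
  assumes J_def: "J = harmonic_index TYPE('d)" and I_def: "I = (\<lambda>k. {1..harmonic_dim TYPE('d) k})"
    and L_gt_1: "1 < L" and onb: "harmonic_onb Y"
begin

definition Yc :: "nat \<Rightarrow> nat \<Rightarrow> real^'d \<Rightarrow> complex" where "Yc k l = (\<lambda>x. complex_of_real (Y k l x))"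

lemma J_eq: "J = Sigma UNIV I"
  by (auto simp: J_def harmonic_index_def I_def)

lemma J_iff: "(k, l) \<in> J \<longleftrightarrow> l \<in> I k" by (simp add: J_eq)

lemma finite_I: "finite (I k)" by (simp add: I_def)

lemma onb_span: "cfun.span (Yc k ` I k) = harmonic_polys k"
  and onb_orth: "l \<in> I k \<Longrightarrow> m \<in> I k \<Longrightarrow> sphere_inner (Yc k l) (Yc k m) = (if l = m then 1 else 0)"
proof -
  have "cfun.span (Yc k ` I k) = harmonic_polys k \<and>
     (\<forall>l\<in>I k. \<forall>m\<in>I k. sphere_inner (Yc k l) (Yc k m) = (if l = m then 1 else 0))"
    using onb[unfolded harmonic_onb_def, rule_format, of k] by (simp add: I_def Let_def Yc_def[abs_def])
  then show "cfun.span (Yc k ` I k) = harmonic_polys k"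
    and "l \<in> I k \<Longrightarrow> m \<in> I k \<Longrightarrow> sphere_inner (Yc k l) (Yc k m) = (if l = m then 1 else 0)" by auto
qed

lemma harmonic_comb: "(\<lambda>x. \<Sum>l\<in>I k. \<gamma> l * Yc k l x) \<in> harmonic_polys k"
proof -
  have "(\<lambda>x. \<Sum>l\<in>A. \<gamma> l * Yc k l x) \<in> cfun.span (Yc k ` I k)" if "finite A" "A \<subseteq> I k" for A
    using that
  proof (induction A)
    case empty
    then show ?case using cfun.span_zero[of "Yc k ` I k"] by (simp add: zero_fun_def)
  next
    case (insert l A)
    then have "(\<lambda>x. \<gamma> l * Yc k l x) \<in> cfun.span (Yc k ` I k)"
      by (intro cfun.span_scale cfun.span_base) auto
    from cfun.span_add[OF this insert.IH] insert show ?case by (simp add: plus_fun_def)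
  qed
  then show ?thesis using finite_I onb_span by blast
qed

lemma harmonic_polysD:
  assumes "p \<in> harmonic_polys k"
  shows "homogeneous_poly k p" "laplacian p x = 0"
  using assms by (auto simp: harmonic_polys_def homogeneous_poly_def)

lemma Yc_harmonic: "l \<in> I k \<Longrightarrow> Yc k l \<in> harmonic_polys k"
  using onb_span[of k] cfun.span_base[of "Yc k l" "Yc k ` I k"] by auto

lemma Yc_continuous: "l \<in> I k \<Longrightarrow> continuous_on UNIV (Yc k l)"
  by (rule continuous_on_polymonial_function) (use harmonic_polysD(1)[OF Yc_harmonic] in \<open>auto simp: homogeneous_poly_def\<close>)

lemma comb_inner: "sphere_inner (\<lambda>x. \<Sum>l\<in>I k. \<gamma> l * Yc k l x) (\<lambda>x. \<Sum>l\<in>I k. \<gamma> l * Yc k l x) = of_real (\<Sum>l\<in>I k. (cmod (\<gamma> l))\<^sup>2)"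
  by (intro sphere_inner_sum finite_I Yc_continuous onb_orth)

lemma comb_zero_imp:
  assumes "\<And>x. (\<Sum>l\<in>I k. \<gamma> l * Yc k l x) = 0" "l \<in> I k"
  shows "\<gamma> l = 0"
proof -
  have "(\<Sum>l\<in>I k. (cmod (\<gamma> l))\<^sup>2) = 0"
  proof -
    have "complex_of_real (\<Sum>l\<in>I k. (cmod (\<gamma> l))\<^sup>2) = 0"
      using comb_inner[where k=k and \<gamma>=\<gamma>, symmetric] unfolding assms(1) sphere_inner_def
      by (simp only: mult_zero_left Bochner_Integration.integral_zero)
    then show ?thesis by (simp only: of_real_eq_0_iff)
  qed
  then show ?thesis using assms(2) finite_I by (simp add: sum_nonneg_eq_0_iff)
qed

text \<open>The function \<open>p\<close>, the sum of \<open>Y k l \<theta> * Y k l\<close>, is the reproducing kernel at \<open>\<theta>\<close>: both \<open>p \<theta>\<close> and the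
  squared norm of \<open>p\<close> equal the sum in question, and the bound of \<open>|p \<theta>|\<^sup>2\<close> by the squared norm can be
  divided by it.\<close>

lemma sum_Y_sq_le:
  assumes "\<theta> \<in> sphere 0 1"
  shows "(\<Sum>l\<in>I k. (Y k l \<theta>)\<^sup>2) \<le> harmonic_growth TYPE('d) k"
proof -
  let ?p = "\<lambda>x. \<Sum>l\<in>I k. complex_of_real (Y k l \<theta>) * Yc k l x"
  let ?S = "\<Sum>l\<in>I k. (Y k l \<theta>)\<^sup>2"
  have "?p \<theta> = of_real ?S" by (simp add: Yc_def power2_eq_square)
  then have "cmod (?p \<theta>) = ?S" by (simp add: sum_nonneg del: of_real_sum)
  moreover have "(cmod (?p \<theta>))\<^sup>2 \<le> harmonic_growth TYPE('d) k * Re (sphere_inner ?p ?p)"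
    unfolding harmonic_growth_def by (rule homogeneous_poly_sup_le_L2[OF harmonic_polysD(1)[OF harmonic_comb] assms])
  moreover have "Re (sphere_inner ?p ?p) = ?S" unfolding comb_inner by simp
  ultimately have "?S * ?S \<le> harmonic_growth TYPE('d) k * ?S" by (simp add: power2_eq_square)
  moreover have "0 \<le> ?S" by (intro sum_nonneg) auto
  ultimately show ?thesis using harmonic_growth_nonneg[where 'd='d and k=k] by (cases "?S = 0") auto
qed

definition admissible :: "(nat \<Rightarrow> nat \<Rightarrow> complex \<Rightarrow> complex) \<Rightarrow> bool" where
  "admissible F \<longleftrightarrow> (\<forall>(k, l)\<in>J. F k l \<in> H2_component CARD('d) a b k) \<and>
     (\<lambda>(k, l). (H2_norm a b (F k l))\<^sup>2 * L ^ (2 * k)) summable_on J"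

definition sqnorm :: "(nat \<Rightarrow> nat \<Rightarrow> complex \<Rightarrow> complex) \<Rightarrow> real" where
  "sqnorm F = (\<Sum>\<^sub>\<infinity>(k, l)\<in>J. (H2_norm a b (F k l))\<^sup>2 * L ^ (2 * k))"

lemma is_expansion_iff:
  "is_expansion Y a b L f F \<longleftrightarrow> admissible F \<and> (\<forall>(z, \<theta>)\<in>cannulus a b.
        ((\<lambda>(k, l). F k l z * complex_of_real (Y k l \<theta>)) has_sum f (z, \<theta>)) J)"
  unfolding is_expansion_def admissible_def J_def[symmetric] by blast

lemma admissible_component: "admissible F \<Longrightarrow> l \<in> I k \<Longrightarrow> F k l \<in> H2_component CARD('d) a b k"
  unfolding admissible_def using J_iff by blast

lemma admissible_H2: "admissible F \<Longrightarrow> l \<in> I k \<Longrightarrow> F k l \<in> H2 a b"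
  using admissible_component component_H2 by blast

lemma sqnorm_nonneg: "0 \<le> sqnorm F"
  unfolding sqnorm_def using L_gt_1 by (intro infsum_nonneg) auto

lemma finite_sum_le_sqnorm:
  assumes "admissible F" "finite X" "X \<subseteq> J"
  shows "(\<Sum>(k, l)\<in>X. (H2_norm a b (F k l))\<^sup>2 * L ^ (2 * k)) \<le> sqnorm F"
  unfolding sqnorm_def using assms L_gt_1 by (intro finite_sum_le_infsum) (auto simp: admissible_def)

lemma degree_sum_le_sqnorm:
  assumes "admissible F"
  shows "(\<Sum>l\<in>I k. (H2_norm a b (F k l))\<^sup>2) * L ^ (2 * k) \<le> sqnorm F"
proof -
  have "(\<Sum>(k, l)\<in>{k} \<times> I k. (H2_norm a b (F k l))\<^sup>2 * L ^ (2 * k)) \<le> sqnorm F"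
    by (rule finite_sum_le_sqnorm[OF assms]) (auto simp: finite_I J_iff)
  then show ?thesis by (simp add: sum.cartesian_product[symmetric] sum_distrib_right)
qed

lemma admissibleI:
  assumes "\<And>k l. l \<in> I k \<Longrightarrow> F k l \<in> H2_component CARD('d) a b k"
    and B: "\<And>X. finite X \<Longrightarrow> X \<subseteq> J \<Longrightarrow> (\<Sum>(k, l)\<in>X. (H2_norm a b (F k l))\<^sup>2 * L ^ (2 * k)) \<le> B"
  shows "admissible F" "sqnorm F \<le> B"
proof -
  have sm: "(\<lambda>(k, l). (H2_norm a b (F k l))\<^sup>2 * L ^ (2 * k)) summable_on J"
    using B L_gt_1 by (intro nonneg_bdd_above_summable_on bdd_aboveI2[of _ _ B]) auto
  show "admissible F" unfolding admissible_def using assms(1) sm J_iff by auto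
  show "sqnorm F \<le> B" unfolding sqnorm_def using sm B by (intro infsum_le_finite_sums)
qed

lemma admissible_add:
  assumes F: "admissible F" and G: "admissible G"
  shows "admissible (\<lambda>k l. F k l + G k l)"
proof (rule admissibleI(1))
  show "F k l + G k l \<in> H2_component CARD('d) a b k" if "l \<in> I k" for k l
    by (intro component_add admissible_component F G that)
  fix X assume X: "finite X" "X \<subseteq> J"
  have "(\<Sum>(k, l)\<in>X. (H2_norm a b (F k l + G k l))\<^sup>2 * L ^ (2 * k))
      \<le> (\<Sum>(k, l)\<in>X. 2 * ((H2_norm a b (F k l))\<^sup>2 * L ^ (2 * k)) + 2 * ((H2_norm a b (G k l))\<^sup>2 * L ^ (2 * k)))"
  proof (intro sum_mono, clarify)
    fix k l assume "(k, l) \<in> X"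
    then have l: "l \<in> I k" using X J_iff by blast
    show "(H2_norm a b (F k l + G k l))\<^sup>2 * L ^ (2 * k) \<le> 2 * ((H2_norm a b (F k l))\<^sup>2 * L ^ (2 * k)) + 2 * ((H2_norm a b (G k l))\<^sup>2 * L ^ (2 * k))"
      using mult_right_mono[OF H2_norm_add_sq_le[OF admissible_H2[OF F l] admissible_H2[OF G l]], of "L ^ (2 * k)"] L_gt_1
      by (simp add: algebra_simps)
  qed
  also have "\<dots> = 2 * (\<Sum>(k, l)\<in>X. (H2_norm a b (F k l))\<^sup>2 * L ^ (2 * k)) + 2 * (\<Sum>(k, l)\<in>X. (H2_norm a b (G k l))\<^sup>2 * L ^ (2 * k))"
    by (simp add: sum.distrib sum_distrib_left case_prod_unfold)
  also have "\<dots> \<le> 2 * sqnorm F + 2 * sqnorm G"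
    by (intro add_mono mult_left_mono finite_sum_le_sqnorm F G X) auto
  finally show "(\<Sum>(k, l)\<in>X. (H2_norm a b (F k l + G k l))\<^sup>2 * L ^ (2 * k)) \<le> 2 * sqnorm F + 2 * sqnorm G" .
qed

lemma admissible_scale:
  assumes F: "admissible F"
  shows "admissible (\<lambda>k l x. \<gamma> * F k l x)"
proof (rule admissibleI(1))
  show "(\<lambda>x. \<gamma> * F k l x) \<in> H2_component CARD('d) a b k" if "l \<in> I k" for k l
    by (intro component_scale admissible_component F that)
  fix X assume X: "finite X" "X \<subseteq> J"
  have "(\<Sum>(k, l)\<in>X. (H2_norm a b (\<lambda>x. \<gamma> * F k l x))\<^sup>2 * L ^ (2 * k))
      = (\<Sum>(k, l)\<in>X. (cmod \<gamma>)\<^sup>2 * ((H2_norm a b (F k l))\<^sup>2 * L ^ (2 * k)))"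
    using X J_iff by (intro sum.cong refl) (auto simp: H2_norm_scale_sq[OF admissible_H2[OF F]])
  also have "\<dots> \<le> (cmod \<gamma>)\<^sup>2 * sqnorm F"
    using mult_left_mono[OF finite_sum_le_sqnorm[OF F X], of "(cmod \<gamma>)\<^sup>2"]
    by (simp add: sum_distrib_left case_prod_unfold)
  finally show "(\<Sum>(k, l)\<in>X. (H2_norm a b (\<lambda>x. \<gamma> * F k l x))\<^sup>2 * L ^ (2 * k)) \<le> (cmod \<gamma>)\<^sup>2 * sqnorm F" .
qed

lemma admissible_zero: "admissible (\<lambda>k l. 0)"
proof (rule admissibleI(1)[where B = 0])
  have "(H2_norm a b 0)\<^sup>2 = 0" using H2_norm_scale_sq[OF H2_zero, of 0] by (simp add: zero_fun_def)
  then show "(\<Sum>(k, l)\<in>X. (H2_norm a b 0)\<^sup>2 * L ^ (2 * k)) \<le> 0" for X by simp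
qed (rule component_zero)

lemma admissible_diff: "admissible F \<Longrightarrow> admissible G \<Longrightarrow> admissible (\<lambda>k l. F k l - G k l)"
  unfolding diff_eq_add_scale by (intro admissible_add admissible_scale)

text \<open>The terms of one degree, with the sphere extended to the whole space: homogeneous harmonic
  polynomials in the second variable.\<close>

definition shell :: "(nat \<Rightarrow> nat \<Rightarrow> complex \<Rightarrow> complex) \<Rightarrow> nat \<Rightarrow> complex \<times> (real^'d) \<Rightarrow> complex" where
  "shell F k = (\<lambda>(z, x). \<Sum>l\<in>I k. F k l z * Yc k l x)"

text \<open>On the sphere, by the Cauchy--Schwarz inequality within one degree: the coefficients contribute
  \<open>L ^ (- k)\<close> and the spherical harmonics the square root of \<open>harmonic_growth\<close>. Elsewhere by
  homogeneity.\<close>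

lemma shell_bound:
  assumes F: "admissible F" and ab: "a < \<alpha>" "\<beta> < b"
  shows "\<exists>C\<ge>0. \<forall>k z x. \<alpha> \<le> cmod z \<and> cmod z \<le> \<beta> \<longrightarrow> cmod (shell F k (z, x)) \<le> C * (real k + 1) ^ CARD('d) * (norm x / L) ^ k"
proof (cases "0 < \<beta>")
  case False
  have "\<not> (\<alpha> \<le> cmod z \<and> cmod z \<le> \<beta>)" for z using False ab a_pos by auto
  then show ?thesis by (intro exI[of _ 0]) blast
next
  case True
  obtain C where C: "C > 0" "\<And>f z. f \<in> H2 a b \<Longrightarrow> \<alpha> \<le> cmod z \<Longrightarrow> cmod z \<le> \<beta> \<Longrightarrow> cmod (f z) \<le> C * H2_norm a b f"
    using H2_evaluation_bound[OF ab True] by blast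
  let ?K = "sphere_sup_const TYPE('d)"
  define D where "D = C * sqrt (sqnorm F) * sqrt ?K"
  have K: "0 < ?K" by (rule sphere_sup_const_pos)
  have D0: "0 \<le> D" using C K sqnorm_nonneg by (simp add: D_def)
  have sph: "cmod (shell F k (z, \<theta>)) \<le> D * (real k + 1) ^ CARD('d) * (1 / L) ^ k"
    if z: "\<alpha> \<le> cmod z" "cmod z \<le> \<beta>" and \<theta>: "\<theta> \<in> sphere 0 1" for k z \<theta>
  proof (rule power2_le_imp_le)
    have "cmod (shell F k (z, \<theta>)) \<le> (\<Sum>l\<in>I k. cmod (F k l z) * \<bar>Y k l \<theta>\<bar>)"
      unfolding shell_def by (auto intro!: sum_norm_le simp: norm_mult Yc_def)
    then have "(cmod (shell F k (z, \<theta>)))\<^sup>2 \<le> (\<Sum>l\<in>I k. cmod (F k l z) * \<bar>Y k l \<theta>\<bar>)\<^sup>2"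
      by (intro power_mono) auto
    also have "\<dots> \<le> (\<Sum>l\<in>I k. (cmod (F k l z))\<^sup>2) * (\<Sum>l\<in>I k. \<bar>Y k l \<theta>\<bar>\<^sup>2)"
      by (rule Cauchy_Schwarz_ineq_sum)
    also have "\<dots> \<le> (C\<^sup>2 * (sqnorm F / L ^ (2 * k))) * harmonic_growth TYPE('d) k"
    proof (intro mult_mono)
      have "(\<Sum>l\<in>I k. (cmod (F k l z))\<^sup>2) \<le> (\<Sum>l\<in>I k. C\<^sup>2 * (H2_norm a b (F k l))\<^sup>2)"
        unfolding power_mult_distrib[symmetric]
        by (intro sum_mono power_mono C(2)[OF admissible_H2[OF F] z]) auto
      also have "\<dots> = C\<^sup>2 * (\<Sum>l\<in>I k. (H2_norm a b (F k l))\<^sup>2)" by (simp add: sum_distrib_left)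
      also have "\<dots> \<le> C\<^sup>2 * (sqnorm F / L ^ (2 * k))"
        using degree_sum_le_sqnorm[OF F, of k] L_gt_1 by (intro mult_left_mono) (auto simp: field_simps)
      finally show "(\<Sum>l\<in>I k. (cmod (F k l z))\<^sup>2) \<le> C\<^sup>2 * (sqnorm F / L ^ (2 * k))" .
      show "(\<Sum>l\<in>I k. \<bar>Y k l \<theta>\<bar>\<^sup>2) \<le> harmonic_growth TYPE('d) k" using sum_Y_sq_le[OF \<theta>] by simp
      show "0 \<le> C\<^sup>2 * (sqnorm F / L ^ (2 * k))" using sqnorm_nonneg L_gt_1 by simp
    qed (auto intro: sum_nonneg)
    also have "\<dots> = (D * (real k + 1) ^ CARD('d) * (1 / L) ^ k)\<^sup>2"
      using K sqnorm_nonneg[of F]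
      by (simp add: D_def harmonic_growth_def power_mult_distrib power_divide power_mult[symmetric] mult.commute[of 2])
    finally show "(cmod (shell F k (z, \<theta>)))\<^sup>2 \<le> (D * (real k + 1) ^ CARD('d) * (1 / L) ^ k)\<^sup>2" .
  qed (use D0 L_gt_1 in auto)
  have "cmod (shell F k (z, x)) \<le> D * (real k + 1) ^ CARD('d) * (norm x / L) ^ k"
    if z: "\<alpha> \<le> cmod z" "cmod z \<le> \<beta>" for k z x
  proof -
    have "homogeneous_poly k (\<lambda>x. shell F k (z, x))"
      unfolding shell_def using harmonic_polysD(1)[OF harmonic_comb] by simp
    from homogeneous_poly_bound[OF this sph[OF z], of x]
    show ?thesis by (simp add: power_divide)
  qed
  then show ?thesis using D0 by (intro exI[of _ D]) auto
qed

lemma growth_series_summable: "summable (\<lambda>k. harmonic_growth TYPE('d) k * (1 / L) ^ (2 * k))"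
proof -
  have "(1 / L)\<^sup>2 < 1" using L_gt_1 by (simp add: power_divide)
  then obtain q D where q: "0 \<le> q" "q < 1" "\<And>k. (real k + 1) ^ (2 * CARD('d)) * ((1 / L)\<^sup>2) ^ k \<le> D * q ^ k"
    using geometric_absorb_power[of "(1 / L)\<^sup>2" "2 * CARD('d)"] by auto
  have "norm (harmonic_growth TYPE('d) k * (1 / L) ^ (2 * k)) \<le> sphere_sup_const TYPE('d) * D * q ^ k" for k
  proof -
    have "norm (harmonic_growth TYPE('d) k * (1 / L) ^ (2 * k)) = sphere_sup_const TYPE('d) * ((real k + 1) ^ (2 * CARD('d)) * ((1 / L)\<^sup>2) ^ k)"
      using L_gt_1 harmonic_growth_nonneg[where 'd='d and k=k] by (simp add: harmonic_growth_def abs_mult power_mult abs_of_pos[OF sphere_sup_const_pos])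
    also have "\<dots> \<le> sphere_sup_const TYPE('d) * (D * q ^ k)"
      using sphere_sup_const_pos[where 'd='d] by (intro mult_left_mono q) auto
    finally show ?thesis by simp
  qed
  then show ?thesis
    using q by (intro summable_comparison_test[OF _ summable_mult[OF summable_geometric[of q]]]) auto
qed

lemma weighted_Y_finite_sum_le:
  assumes \<theta>: "\<theta> \<in> sphere 0 1" and X: "finite X" "X \<subseteq> J"
  shows "(\<Sum>(k, l)\<in>X. (Y k l \<theta>)\<^sup>2 * (1 / L) ^ (2 * k)) \<le> (\<Sum>k. harmonic_growth TYPE('d) k * (1 / L) ^ (2 * k))"
proof -
  let ?A = "fst ` X"
  have "(\<Sum>(k, l)\<in>X. (Y k l \<theta>)\<^sup>2 * (1 / L) ^ (2 * k)) \<le> (\<Sum>(k, l)\<in>Sigma ?A I. (Y k l \<theta>)\<^sup>2 * (1 / L) ^ (2 * k))"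
  proof (rule sum_mono2)
    show "X \<subseteq> Sigma ?A I" using X J_iff by force
    show "finite (Sigma ?A I)" using X finite_I by (intro finite_SigmaI) auto
  qed (use L_gt_1 in auto)
  also have "\<dots> = (\<Sum>k\<in>?A. (\<Sum>l\<in>I k. (Y k l \<theta>)\<^sup>2) * (1 / L) ^ (2 * k))"
    using X finite_I by (subst sum.Sigma[symmetric]) (auto simp: sum_distrib_right)
  also have "\<dots> \<le> (\<Sum>k\<in>?A. harmonic_growth TYPE('d) k * (1 / L) ^ (2 * k))"
    using L_gt_1 by (intro sum_mono mult_right_mono sum_Y_sq_le \<theta>) auto
  also have "\<dots> \<le> (\<Sum>k. harmonic_growth TYPE('d) k * (1 / L) ^ (2 * k))"
    using X L_gt_1 harmonic_growth_nonneg[where 'd='d] by (intro sum_le_suminf growth_series_summable) auto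
  finally show ?thesis .
qed

text \<open>By the Cauchy--Schwarz inequality with the weights \<open>L ^ k\<close> for the coefficients and \<open>(1 / L) ^ k\<close> for the
  spherical harmonics. Finite sums suffice for absolute convergence.\<close>

lemma expansion_abs_bound:
  assumes ab: "a < \<alpha>" "\<beta> < b" "0 < \<beta>"
  obtains C where "C > 0" "\<And>F z \<theta> X. admissible F \<Longrightarrow> \<alpha> \<le> cmod z \<Longrightarrow> cmod z \<le> \<beta> \<Longrightarrow> \<theta> \<in> sphere 0 1 \<Longrightarrow>
     finite X \<Longrightarrow> X \<subseteq> J \<Longrightarrow> (\<Sum>(k, l)\<in>X. cmod (F k l z * complex_of_real (Y k l \<theta>))) \<le> C * sqrt (sqnorm F)"
proof -
  obtain C where C: "C > 0" "\<And>f z. f \<in> H2 a b \<Longrightarrow> \<alpha> \<le> cmod z \<Longrightarrow> cmod z \<le> \<beta> \<Longrightarrow> cmod (f z) \<le> C * H2_norm a b f"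
    using H2_evaluation_bound[OF ab] by blast
  define S where "S = (\<Sum>k. harmonic_growth TYPE('d) k * (1 / L) ^ (2 * k))"
  have S0: "0 \<le> S" unfolding S_def using harmonic_growth_nonneg[where 'd='d] L_gt_1 by (intro suminf_nonneg growth_series_summable) auto
  \<comment> \<open>Adding 1 makes the constant positive even if \<open>S\<close> should vanish.\<close>
  have key: "(\<Sum>(k, l)\<in>X. cmod (F k l z * complex_of_real (Y k l \<theta>))) \<le> (C * sqrt S + 1) * sqrt (sqnorm F)"
    if F: "admissible F" and z: "\<alpha> \<le> cmod z" "cmod z \<le> \<beta>" and \<theta>: "\<theta> \<in> sphere 0 1" and X: "finite X" "X \<subseteq> J" for F z \<theta> X
  proof -
    let ?u = "\<lambda>(k, l). cmod (F k l z) * L ^ k" and ?v = "\<lambda>(k, l). \<bar>Y k l \<theta>\<bar> * (1 / L) ^ k"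
    have eq: "(\<Sum>(k, l)\<in>X. cmod (F k l z * complex_of_real (Y k l \<theta>))) = (\<Sum>p\<in>X. ?u p * ?v p)"
      using L_gt_1 by (intro sum.cong) (auto simp: norm_mult power_divide)
    have cs: "(\<Sum>p\<in>X. ?u p * ?v p)\<^sup>2 \<le> (\<Sum>p\<in>X. (?u p)\<^sup>2) * (\<Sum>p\<in>X. (?v p)\<^sup>2)"
      by (rule Cauchy_Schwarz_ineq_sum)
    have us: "(\<Sum>p\<in>X. (?u p)\<^sup>2) \<le> C\<^sup>2 * sqnorm F"
    proof -
      have "(\<Sum>p\<in>X. (?u p)\<^sup>2) \<le> (\<Sum>(k, l)\<in>X. C\<^sup>2 * ((H2_norm a b (F k l))\<^sup>2 * L ^ (2 * k)))"
      proof (intro sum_mono, clarify)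
        fix k l assume "(k, l) \<in> X"
        then have l: "l \<in> I k" using X J_iff by blast
        have "(cmod (F k l z))\<^sup>2 \<le> (C * H2_norm a b (F k l))\<^sup>2"
          by (intro power_mono C(2)[OF admissible_H2[OF F l] z]) auto
        then show "(cmod (F k l z) * L ^ k)\<^sup>2 \<le> C\<^sup>2 * ((H2_norm a b (F k l))\<^sup>2 * L ^ (2 * k))"
          using L_gt_1 by (simp add: power_mult_distrib power_mult[symmetric] mult.commute[of k] mult.assoc[symmetric] mult_right_mono)
      qed
      also have "\<dots> \<le> C\<^sup>2 * sqnorm F"
        using mult_left_mono[OF finite_sum_le_sqnorm[OF F X], of "C\<^sup>2"] by (simp add: sum_distrib_left case_prod_unfold)
      finally show ?thesis .
    qed
    have vs: "(\<Sum>p\<in>X. (?v p)\<^sup>2) \<le> S"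
    proof -
      have "(\<Sum>p\<in>X. (?v p)\<^sup>2) = (\<Sum>(k, l)\<in>X. (Y k l \<theta>)\<^sup>2 * (1 / L) ^ (2 * k))"
        by (intro sum.cong) (auto simp: power_mult_distrib power_mult[symmetric] mult.commute)
      then show ?thesis using weighted_Y_finite_sum_le[OF \<theta> X] by (simp add: S_def)
    qed
    have "(\<Sum>(k, l)\<in>X. cmod (F k l z * complex_of_real (Y k l \<theta>)))\<^sup>2 \<le> (C\<^sup>2 * sqnorm F) * S"
      unfolding eq by (rule order_trans[OF cs mult_mono[OF us vs]]) (auto intro: sum_nonneg simp: sqnorm_nonneg)
    also have "\<dots> = (C * sqrt S * sqrt (sqnorm F))\<^sup>2"
      using S0 sqnorm_nonneg[of F] by (simp add: power_mult_distrib)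
    finally have "(\<Sum>(k, l)\<in>X. cmod (F k l z * complex_of_real (Y k l \<theta>))) \<le> C * sqrt S * sqrt (sqnorm F)"
      by (rule power2_le_imp_le) (use C S0 sqnorm_nonneg in auto)
    moreover have "0 \<le> sqrt (sqnorm F)" using sqnorm_nonneg by simp
    ultimately show ?thesis unfolding distrib_right by linarith
  qed
  have "0 < C * sqrt S + 1" using C S0 by (intro add_nonneg_pos) auto
  then show ?thesis using key by (rule that)
qed

lemma expansion_summable:
  assumes F: "admissible F" and z: "z \<in> annulus a b" and \<theta>: "\<theta> \<in> sphere 0 1"
  shows "(\<lambda>(k, l). F k l z * complex_of_real (Y k l \<theta>)) summable_on J"
proof -
  have zb: "a < cmod z" "cmod z < b" "0 < cmod z" using z a_pos by (auto simp: annulus_def)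
  obtain C where "C > 0" and C': "\<And>F w \<theta> X. admissible F \<Longrightarrow> cmod z \<le> cmod w \<Longrightarrow> cmod w \<le> cmod z \<Longrightarrow> \<theta> \<in> sphere 0 1 \<Longrightarrow>
     finite X \<Longrightarrow> X \<subseteq> J \<Longrightarrow> (\<Sum>(k, l)\<in>X. cmod (F k l w * complex_of_real (Y k l \<theta>))) \<le> C * sqrt (sqnorm F)"
    by (rule expansion_abs_bound[OF zb]) (rule that, assumption, blast)
  from C'[OF F order_refl order_refl \<theta>]
  have C: "\<And>X. finite X \<Longrightarrow> X \<subseteq> J \<Longrightarrow> (\<Sum>(k, l)\<in>X. cmod (F k l z * complex_of_real (Y k l \<theta>))) \<le> C * sqrt (sqnorm F)" .
  have "(\<lambda>(k, l). cmod (F k l z * complex_of_real (Y k l \<theta>))) summable_on J"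
    using C by (intro nonneg_bdd_above_summable_on bdd_aboveI2[of _ _ "C * sqrt (sqnorm F)"]) auto
  then have "(\<lambda>p. cmod (case p of (k, l) \<Rightarrow> F k l z * complex_of_real (Y k l \<theta>))) summable_on J"
    by (simp add: case_prod_unfold)
  then show ?thesis by (rule abs_summable_summable)
qed

lemma expansion_bound:
  assumes ab: "a < \<alpha>" "\<beta> < b" "0 < \<beta>"
  shows "\<exists>C>0. \<forall>f F z \<theta>. is_expansion Y a b L f F \<and> \<alpha> \<le> cmod z \<and> cmod z \<le> \<beta> \<and> \<theta> \<in> sphere 0 1 \<longrightarrow>
     cmod (f (z, \<theta>)) \<le> C * sqrt (sqnorm F)"
proof -
  obtain C where C: "C > 0" "\<And>F z \<theta> X. admissible F \<Longrightarrow> \<alpha> \<le> cmod z \<Longrightarrow> cmod z \<le> \<beta> \<Longrightarrow> \<theta> \<in> sphere 0 1 \<Longrightarrow> finite X \<Longrightarrow> X \<subseteq> J \<Longrightarrow>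
     (\<Sum>(k, l)\<in>X. cmod (F k l z * complex_of_real (Y k l \<theta>))) \<le> C * sqrt (sqnorm F)"
    by (rule expansion_abs_bound[OF ab]) (rule that, assumption, blast)
  have "cmod (f (z, \<theta>)) \<le> C * sqrt (sqnorm F)"
    if "is_expansion Y a b L f F" and z: "\<alpha> \<le> cmod z" "cmod z \<le> \<beta>" and \<theta>: "\<theta> \<in> sphere 0 1" for f F z \<theta>
  proof -
    have F: "admissible F" using that is_expansion_iff by blast
    have "(z, \<theta>) \<in> cannulus a b" using z \<theta> ab by (auto simp: cannulus_def annulus_def)
    then have hs: "((\<lambda>(k, l). F k l z * complex_of_real (Y k l \<theta>)) has_sum f (z, \<theta>)) J"
      using that is_expansion_iff by blast
    then have "((\<lambda>X. cmod (\<Sum>(k, l)\<in>X. F k l z * complex_of_real (Y k l \<theta>))) \<longlongrightarrow> cmod (f (z, \<theta>))) (finite_subsets_at_top J)"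
      unfolding has_sum_def by (rule tendsto_norm)
    then show ?thesis
    proof (rule tendsto_upperbound)
      show "\<forall>\<^sub>F X in finite_subsets_at_top J. cmod (\<Sum>(k, l)\<in>X. F k l z * complex_of_real (Y k l \<theta>)) \<le> C * sqrt (sqnorm F)"
      proof (rule eventually_finite_subsets_at_top_weakI)
        fix X assume X: "finite X" "X \<subseteq> J"
        have "cmod (\<Sum>(k, l)\<in>X. F k l z * complex_of_real (Y k l \<theta>)) \<le> (\<Sum>(k, l)\<in>X. cmod (F k l z * complex_of_real (Y k l \<theta>)))"
          by (rule order_trans[OF norm_sum]) (simp add: case_prod_unfold)
        also have "\<dots> \<le> C * sqrt (sqnorm F)" by (rule C(2)[OF F z \<theta> X])
        finally show "cmod (\<Sum>(k, l)\<in>X. F k l z * complex_of_real (Y k l \<theta>)) \<le> C * sqrt (sqnorm F)" .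
      qed
    qed simp
  qed
  then show ?thesis using C(1) by blast
qed

lemma expansion_shell_sums:
  assumes "((\<lambda>(k, l). F k l z * complex_of_real (Y k l \<theta>)) has_sum s) J"
  shows "(\<lambda>k. shell F k (z, \<theta>)) sums s"
proof -
  have "((\<lambda>k. shell F k (z, \<theta>)) has_sum s) UNIV"
  proof (rule has_sum_SigmaD)
    let ?f = "\<lambda>(k, l). F k l z * complex_of_real (Y k l \<theta>)"
    show "(?f has_sum s) (Sigma UNIV I)" using assms J_eq by simp
    show "((\<lambda>l. ?f (k, l)) has_sum shell F k (z, \<theta>)) (I k)" for k
      using has_sum_finite[OF finite_I[of k], of "\<lambda>l. F k l z * complex_of_real (Y k l \<theta>)"] by (simp add: shell_def Yc_def)
  qed
  then show ?thesis by (rule has_sum_imp_sums)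
qed

lemma shell_summable_bound:
  assumes F: "admissible F" and z: "z \<in> annulus a b"
  shows "\<exists>B. summable B \<and> (\<forall>k. \<forall>\<theta>\<in>sphere 0 1. cmod (shell F k (z, \<theta>)) \<le> B k)"
proof -
  have "a < cmod z" "cmod z < b" using z by (auto simp: annulus_def)
  then obtain C where C: "C \<ge> 0" "\<And>k x. cmod (shell F k (z, x)) \<le> C * (real k + 1) ^ CARD('d) * (norm x / L) ^ k"
    using shell_bound[OF F, of "cmod z" "cmod z"] by blast
  obtain q D where q: "0 \<le> q" "q < 1" "\<And>k. (real k + 1) ^ CARD('d) * (1 / L) ^ k \<le> D * q ^ k"
    using geometric_absorb_power[of "1 / L" "CARD('d)"] L_gt_1 by auto
  have "cmod (shell F k (z, \<theta>)) \<le> C * (D * q ^ k)" if "\<theta> \<in> sphere 0 1" for k \<theta>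
    using C(2)[of k \<theta>] mult_left_mono[OF q(3)[of k] C(1)] that by (simp add: mult.assoc)
  moreover have "summable (\<lambda>k. C * (D * q ^ k))" using q by (intro summable_mult summable_geometric) auto
  ultimately show ?thesis by blast
qed

text \<open>For fixed \<open>z\<close> the shells are homogeneous harmonic polynomials with sum \<open>0\<close> on the sphere, hence all
  vanish, and within a degree the spherical harmonics are linearly independent.\<close>

lemma expansion_zero_unique:
  assumes F: "admissible F" and s: "\<And>z \<theta>. (z, \<theta>) \<in> cannulus a b \<Longrightarrow> ((\<lambda>(k, l). F k l z * complex_of_real (Y k l \<theta>)) has_sum 0) J"
    and l: "l \<in> I k" and z: "z \<in> annulus a b"
  shows "F k l z = 0"
proof (rule comb_zero_imp[OF _ l, where \<gamma> = "\<lambda>l. F k l z"])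
  fix x
  obtain B where B: "summable B" "\<And>k \<theta>. \<theta> \<in> sphere 0 1 \<Longrightarrow> cmod (shell F k (z, \<theta>)) \<le> B k"
    using shell_summable_bound[OF F z] by blast
  have "shell F k (z, x) = 0"
  proof (rule harmonic_series_unique[where u = "\<lambda>k x. shell F k (z, x)", OF _ _ B(2) B(1)])
    show "homogeneous_poly k (\<lambda>x. shell F k (z, x))" for k
      unfolding shell_def using harmonic_polysD(1)[OF harmonic_comb] by simp
    show "laplacian (\<lambda>x. shell F k (z, x)) x = 0" for k x
      unfolding shell_def using harmonic_polysD(2)[OF harmonic_comb] by simp
    show "(\<lambda>k. shell F k (z, \<theta>)) sums 0" if "\<theta> \<in> sphere 0 1" for \<theta>
      by (rule expansion_shell_sums, rule s) (use that z in \<open>auto simp: cannulus_def\<close>)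
  qed
  then show "(\<Sum>l\<in>I k. F k l z * Yc k l x) = 0" by (simp add: shell_def)
qed

lemma expansion_add:
  assumes "is_expansion Y a b L f F" "is_expansion Y a b L g G"
  shows "is_expansion Y a b L (f + g) (\<lambda>k l. F k l + G k l)"
proof -
  have "((\<lambda>(k, l). (F k l + G k l) z * complex_of_real (Y k l \<theta>)) has_sum (f + g) (z, \<theta>)) J" if "(z, \<theta>) \<in> cannulus a b" for z \<theta>
  proof -
    have "((\<lambda>(k, l). F k l z * complex_of_real (Y k l \<theta>)) has_sum f (z, \<theta>)) J"
      "((\<lambda>(k, l). G k l z * complex_of_real (Y k l \<theta>)) has_sum g (z, \<theta>)) J"
      using assms that unfolding is_expansion_iff by blast+
    from has_sum_add[OF this] show ?thesis by (simp add: case_prod_unfold algebra_simps)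
  qed
  then show ?thesis using assms admissible_add unfolding is_expansion_iff by blast
qed

lemma expansion_scale:
  assumes "is_expansion Y a b L f F"
  shows "is_expansion Y a b L (\<lambda>p. \<gamma> * f p) (\<lambda>k l x. \<gamma> * F k l x)"
proof -
  have "((\<lambda>(k, l). \<gamma> * F k l z * complex_of_real (Y k l \<theta>)) has_sum \<gamma> * f (z, \<theta>)) J" if "(z, \<theta>) \<in> cannulus a b" for z \<theta>
  proof -
    have "((\<lambda>(k, l). F k l z * complex_of_real (Y k l \<theta>)) has_sum f (z, \<theta>)) J"
      using assms that unfolding is_expansion_iff by blast
    from has_sum_cmult_right[OF this, of \<gamma>] show ?thesis by (simp add: case_prod_unfold mult.assoc)
  qed
  then show ?thesis using assms admissible_scale unfolding is_expansion_iff by blast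
qed

lemma expansion_diff:
  assumes "is_expansion Y a b L f F" "is_expansion Y a b L g G"
  shows "is_expansion Y a b L (f - g) (\<lambda>k l. F k l - G k l)"
  using expansion_add[OF assms(1) expansion_scale[OF assms(2), of "-1"]]
  unfolding diff_eq_add_scale .

lemma expansion_zero: "is_expansion Y a b L 0 (\<lambda>k l. 0)"
  unfolding is_expansion_iff using admissible_zero by (auto simp: case_prod_unfold intro!: has_sum_0)

lemma expansion_unique:
  assumes "is_expansion Y a b L f F" "is_expansion Y a b L f G" "l \<in> I k" "z \<in> annulus a b"
  shows "F k l z = G k l z"
proof -
  have d: "is_expansion Y a b L (f - f) (\<lambda>k l. F k l - G k l)" by (rule expansion_diff[OF assms(1,2)])
  have "(F k l - G k l) z = 0"
    by (rule expansion_zero_unique[OF _ _ assms(3,4), of "\<lambda>k l. F k l - G k l"])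
      (use d in \<open>auto simp: is_expansion_iff\<close>)
  then show ?thesis by simp
qed

lemma expansion_HL2_coeff:
  assumes "is_expansion Y a b L f F"
  shows "is_expansion Y a b L f (HL2_coeff Y a b L f)"
  unfolding HL2_coeff_def using assms by (rule someI[where P = "is_expansion Y a b L f"])

text \<open>By uniqueness any expansion may be used to compute norms and inner products, since those only see
  the coefficients on the annulus.\<close>

lemma HL2_coeff_eq:
  assumes "is_expansion Y a b L f F" "l \<in> I k" "z \<in> annulus a b"
  shows "HL2_coeff Y a b L f k l z = F k l z"
  using expansion_unique[OF expansion_HL2_coeff[OF assms(1)] assms] .

lemma HL2_norm_eq:
  assumes "is_expansion Y a b L f F"
  shows "HL2_norm Y a b L f = sqrt (sqnorm F)"
proof -
  have "H2_norm a b (HL2_coeff Y a b L f k l) = H2_norm a b (F k l)" if "l \<in> I k" for k l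
    by (rule H2_norm_cong) (rule HL2_coeff_eq[OF assms that])
  then show ?thesis unfolding HL2_norm_def sqnorm_def J_def[symmetric]
    by (intro arg_cong[of _ _ sqrt] infsum_cong) (auto simp: J_iff)
qed

lemma HL2_inner_eq:
  assumes "is_expansion Y a b L f F" "is_expansion Y a b L g G"
  shows "HL2_inner Y a b L f g = (\<Sum>\<^sub>\<infinity>(k, l)\<in>J. H2_inner a b (F k l) (G k l) * of_real (L ^ (2 * k)))"
proof -
  have "H2_inner a b (HL2_coeff Y a b L f k l) (HL2_coeff Y a b L g k l) = H2_inner a b (F k l) (G k l)" if "l \<in> I k" for k l
    by (rule H2_inner_cong) (simp_all add: HL2_coeff_eq[OF assms(1) that] HL2_coeff_eq[OF assms(2) that])
  then show ?thesis unfolding HL2_inner_def J_def[symmetric] by (intro infsum_cong) (auto simp: J_iff)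
qed

lemma HL2_E:
  assumes "f \<in> HL2 Y a b L"
  obtains F where "is_expansion Y a b L f F" "\<And>p. p \<notin> cannulus a b \<Longrightarrow> f p = 0"
  using assms unfolding HL2_def by blast

text \<open>Every admissible family is the family of coefficients of an element of the space; this produces the
  limits needed for completeness.\<close>

lemma HL2_synthesis:
  assumes "admissible F"
  shows "\<exists>f\<in>HL2 Y a b L. is_expansion Y a b L f F"
proof -
  define f where "f = (\<lambda>p. if p \<in> cannulus a b then \<Sum>\<^sub>\<infinity>(k, l)\<in>J. F k l (fst p) * complex_of_real (Y k l (snd p)) else 0)"
  have "((\<lambda>(k, l). F k l z * complex_of_real (Y k l \<theta>)) has_sum f (z, \<theta>)) J" if "(z, \<theta>) \<in> cannulus a b" for z \<theta>
  proof -
    have "(\<lambda>(k, l). F k l z * complex_of_real (Y k l \<theta>)) summable_on J"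
      using that by (intro expansion_summable assms) (auto simp: cannulus_def)
    then show ?thesis using that by (simp add: f_def has_sum_infsum)
  qed
  then have ex: "is_expansion Y a b L f F" using assms by (auto simp: is_expansion_iff)
  moreover have "f \<in> HL2 Y a b L" unfolding HL2_def using ex by (auto simp: f_def)
  ultimately show ?thesis by blast
qed

section \<open>Smoothness, completeness and the maximum principle\<close>

text \<open>Homogeneity extends the geometric decay from the sphere to all balls of radius less than \<open>L\<close>.\<close>

lemma shell_analytic_series:
  assumes F: "admissible F"
  shows "annulus_ball.analytic_series a b L (shell F)"
proof -
  interpret B: annulus_ball a b L "TYPE('d)" by unfold_locales (use a_pos in simp)
  have "B.regular_term k (shell F k)" for k
    unfolding B.regular_term_def
  proof (intro exI conjI ballI)
    show "finite (I k)" by (rule finite_I)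
    show "F k l holomorphic_on annulus a b" if "l \<in> I k" for l
      by (rule H2_holomorphic[OF admissible_H2[OF F that]])
    show "poly_growth k (Yc k l)" if "l \<in> I k" for l
      by (rule homogeneous_poly_growth[OF harmonic_polysD(1)[OF Yc_harmonic[OF that]]])
    show "shell F k (z, x) = (\<Sum>l\<in>I k. F k l z * Yc k l x)" for z x by (simp add: shell_def)
  qed
  moreover have "B.geometric_decay (shell F)"
    unfolding B.geometric_decay_def
  proof (intro allI impI)
    fix \<alpha> \<beta> R assume h: "a < \<alpha> \<and> \<beta> < b \<and> R < L"
    then have ab: "a < \<alpha>" "\<beta> < b" by auto
    from shell_bound[OF F ab] obtain C where C: "C \<ge> 0"
      "\<And>k z x. \<alpha> \<le> cmod z \<and> cmod z \<le> \<beta> \<Longrightarrow> cmod (shell F k (z, x)) \<le> C * (real k + 1) ^ CARD('d) * (norm x / L) ^ k"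
      by blast
    \<comment> \<open>For negative \<open>R\<close> no \<open>x\<close> is concerned, but the ratio still has to be nonnegative.\<close>
    define q0 where "q0 = max R 0 / L"
    have q0: "0 \<le> q0" "q0 < 1" using h L_gt_1 by (auto simp: q0_def)
    obtain q D where q: "0 \<le> q" "q < 1" "0 \<le> D" "\<And>k. (real k + 1) ^ CARD('d) * q0 ^ k \<le> D * q ^ k"
      using geometric_absorb_power[OF q0, of "CARD('d)"] by blast
    have "cmod (shell F k (z, x)) \<le> C * D * q ^ k" if z: "\<alpha> \<le> cmod z" "cmod z \<le> \<beta>" and x: "norm x \<le> R" for k z x
    proof -
      have "norm x / L \<le> q0" using x L_gt_1 by (auto simp: q0_def intro!: divide_right_mono)
      then have "(norm x / L) ^ k \<le> q0 ^ k" using L_gt_1 by (intro power_mono) auto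
      then have "C * (real k + 1) ^ CARD('d) * (norm x / L) ^ k \<le> C * (real k + 1) ^ CARD('d) * q0 ^ k"
        using C(1) by (intro mult_left_mono) auto
      also have "\<dots> = C * ((real k + 1) ^ CARD('d) * q0 ^ k)" by simp
      also have "\<dots> \<le> C * (D * q ^ k)" by (intro mult_left_mono q C(1))
      finally show ?thesis using C(2)[of z k x] z by simp
    qed
    then show "\<exists>C q. 0 \<le> q \<and> q < 1 \<and> 0 \<le> C \<and> (\<forall>k z x. \<alpha> \<le> cmod z \<and> cmod z \<le> \<beta> \<and> norm x \<le> R \<longrightarrow> cmod (shell F k (z, x)) \<le> C * q ^ k)"
      using q C(1) by (intro exI[of _ "C * D"] exI[of _ q]) auto
  qed
  ultimately show ?thesis by (simp add: B.analytic_series_def)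
qed

text \<open>The sum of the shells is smooth on the product of the annulus and the ball of radius \<open>L\<close>. As \<open>L > 1\<close>,
  this is a neighbourhood of the complexified annulus, and there the sum agrees with \<open>f\<close>.\<close>

theorem HL2_smooth:
  assumes "f \<in> HL2 Y a b L"
  shows "smooth_on f (cannulus a b)"
proof -
  interpret B: annulus_ball a b L "TYPE('d)" by unfold_locales (use a_pos in simp)
  obtain F where F: "is_expansion Y a b L f F" using assms by (rule HL2_E)
  have adm: "admissible F" using F is_expansion_iff by blast
  let ?g = "\<lambda>w. \<Sum>k. shell F k w"
  have sub: "cannulus a b \<subseteq> B.U" using L_gt_1 by (auto simp: cannulus_def B.U_def)
  have "?g q = f q" if "q \<in> cannulus a b" for q
  proof -
    obtain z \<theta> where q: "q = (z, \<theta>)" by (cases q)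
    have "((\<lambda>(k, l). F k l z * complex_of_real (Y k l \<theta>)) has_sum f (z, \<theta>)) J"
      using F that unfolding is_expansion_iff q by blast
    then have "(\<lambda>k. shell F k (z, \<theta>)) sums f (z, \<theta>)" by (rule expansion_shell_sums[where F = F])
    then show ?thesis by (simp add: q sums_iff)
  qed
  moreover have "C_k_on k ?g B.U" for k by (rule B.analytic_series_C_k[OF shell_analytic_series[OF adm]])
  ultimately show ?thesis unfolding smooth_on_def using sub B.open_U
    by (intro ballI exI[of _ B.U] exI[of _ ?g]) auto
qed

lemma HL2_I: "is_expansion Y a b L f F \<Longrightarrow> (\<And>p. p \<notin> cannulus a b \<Longrightarrow> f p = 0) \<Longrightarrow> f \<in> HL2 Y a b L"
  unfolding HL2_def by blast

lemma HL2_subspace: "cfun.subspace (HL2 Y a b L)"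
  unfolding cfun.subspace_def
proof (intro conjI ballI allI)
  show "0 \<in> HL2 Y a b L" by (rule HL2_I[OF expansion_zero]) simp
  fix f assume "f \<in> HL2 Y a b L"
  then obtain F where F: "is_expansion Y a b L f F" "\<And>p. p \<notin> cannulus a b \<Longrightarrow> f p = 0" by (rule HL2_E) blast
  show "(\<lambda>x. \<gamma> * f x) \<in> HL2 Y a b L" for \<gamma> by (rule HL2_I[OF expansion_scale[OF F(1)]]) (simp add: F(2))
  fix g assume "g \<in> HL2 Y a b L"
  then obtain G where G: "is_expansion Y a b L g G" "\<And>p. p \<notin> cannulus a b \<Longrightarrow> g p = 0" by (rule HL2_E) blast
  show "f + g \<in> HL2 Y a b L" by (rule HL2_I[OF expansion_add[OF F(1) G(1)]]) (simp add: F(2) G(2))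
qed

lemma inner_terms_summable:
  assumes F: "admissible F" and G: "admissible G"
  shows "(\<lambda>(k, l). H2_inner a b (F k l) (G k l) * complex_of_real (L ^ (2 * k))) summable_on J"
proof -
  let ?h = "\<lambda>(k, l). (H2_norm a b (F k l))\<^sup>2 * L ^ (2 * k) + (H2_norm a b (G k l))\<^sup>2 * L ^ (2 * k)"
  have "?h summable_on J"
    using summable_on_add[of "\<lambda>(k, l). (H2_norm a b (F k l))\<^sup>2 * L ^ (2 * k)" J "\<lambda>(k, l). (H2_norm a b (G k l))\<^sup>2 * L ^ (2 * k)"] F G
    by (simp add: admissible_def case_prod_unfold)
  then have "(\<lambda>p. norm (case p of (k, l) \<Rightarrow> H2_inner a b (F k l) (G k l) * complex_of_real (L ^ (2 * k)))) summable_on J"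
  proof (rule summable_on_comparison_test)
    fix p assume p: "p \<in> J"
    obtain k l where kl: "p = (k, l)" by (cases p)
    then have l: "l \<in> I k" using p J_iff by blast
    have half: "y / 2 \<le> y" if "0 \<le> y" for y :: real using that by simp
    have "cmod (H2_inner a b (F k l) (G k l)) \<le> (H2_norm a b (F k l))\<^sup>2 + (H2_norm a b (G k l))\<^sup>2"
      by (rule order_trans[OF H2_inner_le[OF admissible_H2[OF F l] admissible_H2[OF G l]] half]) simp
    then show "norm (case p of (k, l) \<Rightarrow> H2_inner a b (F k l) (G k l) * complex_of_real (L ^ (2 * k))) \<le> ?h p"
      using L_gt_1 by (simp add: kl norm_mult norm_power distrib_right[symmetric] mult_right_mono)
  qed simp
  then show ?thesis by (rule abs_summable_summable)
qed

lemma HL2_inner_self: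
  assumes "is_expansion Y a b L f F"
  shows "HL2_inner Y a b L f f = of_real (sqnorm F)"
proof -
  have F: "admissible F" using assms is_expansion_iff by blast
  have "((\<lambda>(k, l). (H2_norm a b (F k l))\<^sup>2 * L ^ (2 * k)) has_sum sqnorm F) J"
    unfolding sqnorm_def using F by (intro has_sum_infsum) (simp add: admissible_def)
  then have "((\<lambda>p. complex_of_real (case p of (k, l) \<Rightarrow> (H2_norm a b (F k l))\<^sup>2 * L ^ (2 * k))) has_sum of_real (sqnorm F)) J"
    by (rule has_sum_of_real)
  also have "?this \<longleftrightarrow> ((\<lambda>(k, l). H2_inner a b (F k l) (F k l) * of_real (L ^ (2 * k))) has_sum of_real (sqnorm F)) J"
    by (intro has_sum_cong) (auto simp: J_iff H2_norm_sq(2)[OF admissible_H2[OF F]])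
  finally show ?thesis unfolding HL2_inner_eq[OF assms assms] by (rule infsumI)
qed

lemma HL2_inner_product_space: "complex_inner_product_space (HL2 Y a b L) (HL2_inner Y a b L)"
  unfolding complex_inner_product_space_def
proof (intro conjI ballI allI impI)
  show "cfun.subspace (HL2 Y a b L)" by (rule HL2_subspace)
next
  fix f g h assume "f \<in> HL2 Y a b L" "g \<in> HL2 Y a b L" "h \<in> HL2 Y a b L"
  then obtain F G H where ex: "is_expansion Y a b L f F" "is_expansion Y a b L g G" "is_expansion Y a b L h H"
    using HL2_E by metis
  then have adm: "admissible F" "admissible G" "admissible H" using is_expansion_iff by blast+
  have "HL2_inner Y a b L (f + g) h = (\<Sum>\<^sub>\<infinity>(k, l)\<in>J. H2_inner a b (F k l + G k l) (H k l) * of_real (L ^ (2 * k)))"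
    by (rule HL2_inner_eq[OF expansion_add[OF ex(1,2)] ex(3)])
  also have "\<dots> = (\<Sum>\<^sub>\<infinity>p\<in>J. (case p of (k, l) \<Rightarrow> H2_inner a b (F k l) (H k l) * of_real (L ^ (2 * k)))
      + (case p of (k, l) \<Rightarrow> H2_inner a b (G k l) (H k l) * of_real (L ^ (2 * k))))"
    by (intro infsum_cong)
      (auto simp: J_iff H2_inner_add_left[OF admissible_H2[OF adm(1)] admissible_H2[OF adm(2)] admissible_H2[OF adm(3)]] distrib_right)
  also have "\<dots> = HL2_inner Y a b L f h + HL2_inner Y a b L g h"
    unfolding HL2_inner_eq[OF ex(1,3)] HL2_inner_eq[OF ex(2,3)]
    by (intro infsum_add inner_terms_summable adm)
  finally show "HL2_inner Y a b L (f + g) h = HL2_inner Y a b L f h + HL2_inner Y a b L g h" .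
next
  fix \<gamma> f g assume "f \<in> HL2 Y a b L" "g \<in> HL2 Y a b L"
  then obtain F G where ex: "is_expansion Y a b L f F" "is_expansion Y a b L g G"
    using HL2_E by metis
  then have adm: "admissible F" "admissible G" using is_expansion_iff by blast+
  have "HL2_inner Y a b L (\<lambda>x. \<gamma> * f x) g = (\<Sum>\<^sub>\<infinity>(k, l)\<in>J. H2_inner a b (\<lambda>x. \<gamma> * F k l x) (G k l) * of_real (L ^ (2 * k)))"
    by (rule HL2_inner_eq[OF expansion_scale[OF ex(1)] ex(2)])
  also have "\<dots> = (\<Sum>\<^sub>\<infinity>p\<in>J. \<gamma> * (case p of (k, l) \<Rightarrow> H2_inner a b (F k l) (G k l) * of_real (L ^ (2 * k))))"
    by (intro infsum_cong)
      (auto simp: J_iff H2_inner_scale_left[OF admissible_H2[OF adm(1)] admissible_H2[OF adm(2)]] mult.assoc)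
  also have "\<dots> = \<gamma> * HL2_inner Y a b L f g"
    unfolding HL2_inner_eq[OF ex] by (rule infsum_cmult_right')
  finally show "HL2_inner Y a b L (\<lambda>x. \<gamma> * f x) g = \<gamma> * HL2_inner Y a b L f g" .
next
  fix f g assume "f \<in> HL2 Y a b L" "g \<in> HL2 Y a b L"
  then obtain F G where ex: "is_expansion Y a b L f F" "is_expansion Y a b L g G"
    using HL2_E by metis
  have "HL2_inner Y a b L g f = (\<Sum>\<^sub>\<infinity>p\<in>J. cnj (case p of (k, l) \<Rightarrow> H2_inner a b (F k l) (G k l) * of_real (L ^ (2 * k))))"
    unfolding HL2_inner_eq[OF ex(2,1)]
  proof (intro infsum_cong, clarify)
    fix k l
    show "H2_inner a b (G k l) (F k l) * of_real (L ^ (2 * k)) = cnj (H2_inner a b (F k l) (G k l) * of_real (L ^ (2 * k)))"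
      by (subst H2_inner_cnj) simp
  qed
  then show "HL2_inner Y a b L g f = cnj (HL2_inner Y a b L f g)"
    unfolding HL2_inner_eq[OF ex] by (simp only: infsum_cnj)
next
  fix f assume f: "f \<in> HL2 Y a b L" and ne: "f \<noteq> 0"
  obtain F where F: "is_expansion Y a b L f F" and out: "\<And>p. p \<notin> cannulus a b \<Longrightarrow> f p = 0"
    using f by (rule HL2_E) blast
  show "HL2_inner Y a b L f f \<in> \<real>" unfolding HL2_inner_self[OF F] by simp
  have "sqnorm F \<noteq> 0"
  proof
    assume 0: "sqnorm F = 0"
    have "f p = 0" for p
    proof (cases "p \<in> cannulus a b")
      case True
      obtain z \<theta> where p: "p = (z, \<theta>)" by (cases p)
      have z: "a < cmod z" "cmod z < b" "0 < cmod z" "\<theta> \<in> sphere 0 1"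
        using True a_pos unfolding p cannulus_def annulus_def by auto
      obtain C where "\<forall>f F y \<theta>. is_expansion Y a b L f F \<and> cmod z \<le> cmod y \<and> cmod y \<le> cmod z \<and> \<theta> \<in> sphere 0 1 \<longrightarrow>
         cmod (f (y, \<theta>)) \<le> C * sqrt (sqnorm F)" using expansion_bound[OF z(1-3)] by blast
      then have "cmod (f (z, \<theta>)) \<le> C * sqrt (sqnorm F)" using F z(4) order_refl by meson
      then show ?thesis by (simp add: p 0)
    qed (rule out)
    then show False using ne by (auto simp: fun_eq_iff)
  qed
  then show "0 < Re (HL2_inner Y a b L f f)"
    unfolding HL2_inner_self[OF F] using sqnorm_nonneg[of F] by simp
qed

text \<open>The coefficients of a Cauchy sequence are Cauchy in each component space and have limits \<open>G k l\<close>
  there. For finitely many indices, the weighted sum of squared distances between the coefficients of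
  \<open>u n\<close> and \<open>G\<close> is estimated through the coefficients of a late \<open>u m\<close>; letting \<open>m\<close> tend to infinity
  leaves a bound independent of the finite set, so \<open>G\<close> is admissible and is the limit in norm.\<close>

lemma HL2_complete: "complete_wrt (HL2 Y a b L) (HL2_norm Y a b L)"
  unfolding complete_wrt_def
proof (intro allI impI, elim conjE)
  fix u :: "nat \<Rightarrow> complex \<times> (real^'d) \<Rightarrow> complex"
  assume uV: "\<forall>n. u n \<in> HL2 Y a b L" and Cau: "\<forall>\<epsilon>>0. \<exists>N. \<forall>m\<ge>N. \<forall>n\<ge>N. HL2_norm Y a b L (u m - u n) < \<epsilon>"
  have "\<exists>F. is_expansion Y a b L (u n) F" for n using uV HL2_E by metis
  then obtain F where F: "\<And>n. is_expansion Y a b L (u n) (F n)" by metis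
  have adm: "admissible (F n)" for n using F is_expansion_iff by blast
  define D where "D = (\<lambda>m n k l. F m k l - F n k l)"
  have exD: "is_expansion Y a b L (u m - u n) (D m n)" for m n
    unfolding D_def by (rule expansion_diff[OF F F])
  have admD: "admissible (D m n)" for m n using exD is_expansion_iff by blast
  have C: "\<exists>N. \<forall>m\<ge>N. \<forall>n\<ge>N. sqnorm (D m n) < \<epsilon>\<^sup>2" if \<epsilon>: "\<epsilon> > 0" for \<epsilon>
  proof -
    obtain N where N: "\<And>m n. m \<ge> N \<Longrightarrow> n \<ge> N \<Longrightarrow> sqrt (sqnorm (D m n)) < \<epsilon>"
      using Cau \<epsilon> unfolding HL2_norm_eq[OF exD] by blast
    have "sqnorm (D m n) < \<epsilon>\<^sup>2" if "m \<ge> N" "n \<ge> N" for m n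
    proof -
      have "(sqrt (sqnorm (D m n)))\<^sup>2 < \<epsilon>\<^sup>2" using N[OF that] sqnorm_nonneg by (intro power_strict_mono) auto
      then show ?thesis using sqnorm_nonneg by simp
    qed
    then show ?thesis by blast
  qed
  have single: "(H2_norm a b (G k l))\<^sup>2 \<le> sqnorm G" if "admissible G" "l \<in> I k" for G k l
  proof -
    have "(H2_norm a b (G k l))\<^sup>2 * 1 \<le> (H2_norm a b (G k l))\<^sup>2 * L ^ (2 * k)"
      using L_gt_1 by (intro mult_left_mono one_le_power) auto
    also have "\<dots> \<le> sqnorm G" using finite_sum_le_sqnorm[OF that(1), of "{(k, l)}"] that(2) J_iff by simp
    finally show ?thesis by simp
  qed
  have "\<exists>g\<in>H2_component CARD('d) a b k. (\<lambda>n. H2_norm a b (F n k l - g)) \<longlonglongrightarrow> 0" if l: "l \<in> I k" for k l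
  proof (rule component_complete)
    show "F n k l \<in> H2_component CARD('d) a b k" for n by (rule admissible_component[OF adm l])
    fix \<epsilon> :: real assume \<epsilon>: "\<epsilon> > 0"
    obtain N where N: "\<And>m n. m \<ge> N \<Longrightarrow> n \<ge> N \<Longrightarrow> sqnorm (D m n) < \<epsilon>\<^sup>2" using C[OF \<epsilon>] by blast
    have "H2_norm a b (F m k l - F n k l) < \<epsilon>" if "m \<ge> N" "n \<ge> N" for m n
    proof (rule power2_less_imp_less)
      show "(H2_norm a b (F m k l - F n k l))\<^sup>2 < \<epsilon>\<^sup>2"
        using single[OF admD[of m n] l] N[OF that] by (simp add: D_def)
    qed (use \<epsilon> in simp)
    then show "\<exists>N. \<forall>m\<ge>N. \<forall>n\<ge>N. H2_norm a b (F m k l - F n k l) < \<epsilon>" by blast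
  qed
  then obtain G where G: "\<And>k l. l \<in> I k \<Longrightarrow> G k l \<in> H2_component CARD('d) a b k"
    "\<And>k l. l \<in> I k \<Longrightarrow> (\<lambda>n. H2_norm a b (F n k l - G k l)) \<longlonglongrightarrow> 0" by metis
  define E where "E = (\<lambda>n k l. F n k l - G k l)"
  have lim: "admissible (E n) \<and> sqnorm (E n) \<le> 2 * \<epsilon>\<^sup>2" if \<epsilon>: "\<epsilon> > 0" and N: "\<And>m. m \<ge> N \<Longrightarrow> sqnorm (D n m) < \<epsilon>\<^sup>2" for n \<epsilon> N
  proof -
    have comp: "E n k l \<in> H2_component CARD('d) a b k" if "l \<in> I k" for k l
      unfolding E_def by (intro component_diff admissible_component[OF adm] G that)
    have bnd: "(\<Sum>(k, l)\<in>X. (H2_norm a b (E n k l))\<^sup>2 * L ^ (2 * k)) \<le> 2 * \<epsilon>\<^sup>2" if X: "finite X" "X \<subseteq> J" for X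
    proof (rule tendsto_lowerbound)
      show "(\<lambda>m. 2 * \<epsilon>\<^sup>2 + 2 * (\<Sum>(k, l)\<in>X. (H2_norm a b (F m k l - G k l))\<^sup>2 * L ^ (2 * k))) \<longlonglongrightarrow> 2 * \<epsilon>\<^sup>2"
      proof -
        have "(\<lambda>m. 2 * \<epsilon>\<^sup>2 + 2 * (\<Sum>p\<in>X. (H2_norm a b (F m (fst p) (snd p) - G (fst p) (snd p)))\<^sup>2 * L ^ (2 * fst p)))
            \<longlonglongrightarrow> 2 * \<epsilon>\<^sup>2 + 2 * (\<Sum>p\<in>X. 0\<^sup>2 * L ^ (2 * fst p))"
        proof (intro tendsto_intros)
          fix p assume "p \<in> X"
          then have "snd p \<in> I (fst p)" using X J_iff[of "fst p" "snd p"] by auto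
          then show "(\<lambda>m. H2_norm a b (F m (fst p) (snd p) - G (fst p) (snd p))) \<longlonglongrightarrow> 0" by (rule G(2))
        qed
        then show ?thesis by (simp add: case_prod_unfold)
      qed
      have "(\<Sum>(k, l)\<in>X. (H2_norm a b (E n k l))\<^sup>2 * L ^ (2 * k)) \<le> 2 * \<epsilon>\<^sup>2 + 2 * (\<Sum>(k, l)\<in>X. (H2_norm a b (F m k l - G k l))\<^sup>2 * L ^ (2 * k))"
        if m: "m \<ge> N" for m
      proof -
        have "(\<Sum>(k, l)\<in>X. (H2_norm a b (E n k l))\<^sup>2 * L ^ (2 * k))
          \<le> (\<Sum>(k, l)\<in>X. 2 * ((H2_norm a b (D n m k l))\<^sup>2 * L ^ (2 * k)) + 2 * ((H2_norm a b (F m k l - G k l))\<^sup>2 * L ^ (2 * k)))"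
        proof (intro sum_mono, clarify)
          fix k l assume "(k, l) \<in> X"
          then have l: "l \<in> I k" using X J_iff by blast
          have H: "D n m k l \<in> H2 a b" "F m k l - G k l \<in> H2 a b"
            using admissible_H2[OF admD l] H2_diff[OF admissible_H2[OF adm l] component_H2[OF G(1)[OF l]]] by auto
          have "E n k l = D n m k l + (F m k l - G k l)" by (simp add: E_def D_def)
          then have "(H2_norm a b (E n k l))\<^sup>2 \<le> 2 * (H2_norm a b (D n m k l))\<^sup>2 + 2 * (H2_norm a b (F m k l - G k l))\<^sup>2"
            using H2_norm_add_sq_le[OF H] by simp
          from mult_right_mono[OF this, of "L ^ (2 * k)"]
          show "(H2_norm a b (E n k l))\<^sup>2 * L ^ (2 * k) \<le> 2 * ((H2_norm a b (D n m k l))\<^sup>2 * L ^ (2 * k)) + 2 * ((H2_norm a b (F m k l - G k l))\<^sup>2 * L ^ (2 * k))"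
            using L_gt_1 by (simp add: algebra_simps)
        qed
        also have "\<dots> = 2 * (\<Sum>(k, l)\<in>X. (H2_norm a b (D n m k l))\<^sup>2 * L ^ (2 * k)) + 2 * (\<Sum>(k, l)\<in>X. (H2_norm a b (F m k l - G k l))\<^sup>2 * L ^ (2 * k))"
          by (simp add: sum.distrib sum_distrib_left case_prod_unfold)
        also have "\<dots> \<le> 2 * \<epsilon>\<^sup>2 + 2 * (\<Sum>(k, l)\<in>X. (H2_norm a b (F m k l - G k l))\<^sup>2 * L ^ (2 * k))"
          using finite_sum_le_sqnorm[OF admD X, of n m] N[OF m] by simp
        finally show ?thesis .
      qed
      then show "\<forall>\<^sub>F m in sequentially. (\<Sum>(k, l)\<in>X. (H2_norm a b (E n k l))\<^sup>2 * L ^ (2 * k))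
          \<le> 2 * \<epsilon>\<^sup>2 + 2 * (\<Sum>(k, l)\<in>X. (H2_norm a b (F m k l - G k l))\<^sup>2 * L ^ (2 * k))"
        unfolding eventually_sequentially by blast
    qed simp
    show ?thesis using admissibleI[of "E n", OF comp bnd] by blast
  qed
  have "admissible G"
  proof -
    obtain N where "\<And>m n. m \<ge> N \<Longrightarrow> n \<ge> N \<Longrightarrow> sqnorm (D m n) < 1\<^sup>2" using C[OF zero_less_one] by blast
    then have "admissible (E N)" using lim[OF zero_less_one] order_refl by blast
    from admissible_diff[OF adm[of N] this] show ?thesis by (simp add: E_def)
  qed
  then obtain f where f: "f \<in> HL2 Y a b L" "is_expansion Y a b L f G" using HL2_synthesis by blast
  have exE: "is_expansion Y a b L (u n - f) (E n)" for n
    unfolding E_def by (rule expansion_diff[OF F f(2)])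
  have "(\<lambda>n. HL2_norm Y a b L (u n - f)) \<longlonglongrightarrow> 0"
  proof (rule LIMSEQ_I)
    fix \<epsilon> :: real assume \<epsilon>: "0 < \<epsilon>"
    then have h: "0 < \<epsilon> / 2" by simp
    obtain N where N: "\<And>m n. m \<ge> N \<Longrightarrow> n \<ge> N \<Longrightarrow> sqnorm (D m n) < (\<epsilon> / 2)\<^sup>2" using C[OF h] by blast
    have "norm (HL2_norm Y a b L (u n - f) - 0) < \<epsilon>" if "n \<ge> N" for n
    proof -
      have "sqnorm (E n) \<le> 2 * (\<epsilon> / 2)\<^sup>2" using lim[OF h N[OF that]] by blast
      also have "\<dots> < \<epsilon>\<^sup>2" using \<epsilon> by (simp add: power2_eq_square)
      finally have "sqrt (sqnorm (E n)) < \<epsilon>" using \<epsilon> by (intro real_less_lsqrt) auto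
      then show ?thesis unfolding HL2_norm_eq[OF exE] using sqnorm_nonneg[of "E n"] by simp
    qed
    then show "\<exists>N. \<forall>n\<ge>N. norm (HL2_norm Y a b L (u n - f) - 0) < \<epsilon>" by blast
  qed
  then show "\<exists>f\<in>HL2 Y a b L. (\<lambda>n. HL2_norm Y a b L (u n - f)) \<longlonglongrightarrow> 0" using f(1) by blast
qed

lemma HL2_hilbert: "hilbert_space (HL2 Y a b L) (HL2_inner Y a b L) (HL2_norm Y a b L)"
proof -
  have "HL2_norm Y a b L f = sqrt (Re (HL2_inner Y a b L f f))" if f: "f \<in> HL2 Y a b L" for f
  proof -
    obtain F where F: "is_expansion Y a b L f F" using f by (rule HL2_E)
    show ?thesis unfolding HL2_norm_eq[OF F] HL2_inner_self[OF F] by simp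
  qed
  then show ?thesis
    unfolding hilbert_space_def using HL2_inner_product_space HL2_complete by blast
qed

text \<open>On \<open>K\<close> the modulus of \<open>z\<close> stays in a closed subinterval of \<open>(a, b)\<close>, so expansions are bounded there by
  a constant times the norm; the minimum lies between \<open>0\<close> and \<open>1\<close>, and dividing by it enlarges the
  bound.\<close>

lemma HL2_maximum_principle:
  assumes K: "compact K" "K \<subseteq> cannulus a b"
  shows "\<exists>C>0. \<forall>f\<in>HL2 Y a b L. \<forall>(z, \<theta>)\<in>K.
           cmod (f (z, \<theta>)) \<le> C / min (1 - cmod z / b) (cmod z / a - 1) * HL2_norm Y a b L f"
proof (cases "K = {}")
  case True
  then show ?thesis by (intro exI[of _ 1]) auto
next
  case False
  have cont: "continuous_on K (\<lambda>p. cmod (fst p))" by (intro continuous_intros)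
  obtain p where p: "p \<in> K" "\<And>q. q \<in> K \<Longrightarrow> cmod (fst p) \<le> cmod (fst q)"
    using continuous_attains_inf[OF K(1) False cont] by blast
  obtain p' where p': "p' \<in> K" "\<And>q. q \<in> K \<Longrightarrow> cmod (fst q) \<le> cmod (fst p')"
    using continuous_attains_sup[OF K(1) False cont] by blast
  have ab: "a < cmod (fst p)" "cmod (fst p') < b" "0 < cmod (fst p')"
    using K(2) p(1) p'(1) a_pos by (auto simp: cannulus_def annulus_def)
  obtain C where C: "C > 0" "\<forall>f F z \<theta>. is_expansion Y a b L f F \<and> cmod (fst p) \<le> cmod z \<and> cmod z \<le> cmod (fst p') \<and> \<theta> \<in> sphere 0 1 \<longrightarrow>
     cmod (f (z, \<theta>)) \<le> C * sqrt (sqnorm F)"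
    using expansion_bound[OF ab] by blast
  have "cmod (f (z, \<theta>)) \<le> C / min (1 - cmod z / b) (cmod z / a - 1) * HL2_norm Y a b L f"
    if f: "f \<in> HL2 Y a b L" and zK: "(z, \<theta>) \<in> K" for f z \<theta>
  proof -
    obtain F where F: "is_expansion Y a b L f F" using f by (rule HL2_E)
    have z: "cmod (fst p) \<le> cmod z" "cmod z \<le> cmod (fst p')" using p(2)[OF zK] p'(2)[OF zK] by auto
    have th: "\<theta> \<in> sphere 0 1" using zK K(2) by (auto simp: cannulus_def)
    have 1: "cmod (f (z, \<theta>)) \<le> C * HL2_norm Y a b L f"
      unfolding HL2_norm_eq[OF F] using C(2) F z th by blast
    let ?m = "min (1 - cmod z / b) (cmod z / a - 1)"
    have "cmod z / b < 1" "0 \<le> cmod z / b" "1 < cmod z / a" using z ab a_pos a_less_b by (auto simp: field_simps)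
    then have m: "0 < ?m" "?m \<le> 1" by auto
    then have "C \<le> C / ?m" using C(1) by (simp add: pos_le_divide_eq mult_left_le)
    then have "C * HL2_norm Y a b L f \<le> C / ?m * HL2_norm Y a b L f"
      unfolding HL2_norm_eq[OF F] using sqnorm_nonneg by (intro mult_right_mono) auto
    then show ?thesis using 1 by linarith
  qed
  then show ?thesis using C(1) by (intro exI[of _ C]) auto
qed

end

theorem theorem4p7:
  fixes a b L :: real and Y :: "nat \<Rightarrow> nat \<Rightarrow> real^'d \<Rightarrow> real"
  assumes "CARD('d) \<ge> 2" and "0 < a" and "a < b" and "1 < L" and "harmonic_onb Y"
  shows
    "(complete_wrt (HL2 Y a b L) (HL2_norm Y a b L) \<and>
      hilbert_space (HL2 Y a b L) (HL2_inner Y a b L) (HL2_norm Y a b L)) \<and>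
     (\<forall>K. compact K \<and> K \<subseteq> cannulus a b \<longrightarrow>
        (\<exists>C>0. \<forall>f\<in>HL2 Y a b L. \<forall>(z, \<theta>)\<in>K.
           cmod (f (z, \<theta>)) \<le> C / min (1 - cmod z / b) (cmod z / a - 1) * HL2_norm Y a b L f)) \<and>
     (\<forall>f\<in>HL2 Y a b L. smooth_on f (cannulus a b))"
proof -
  interpret polyharmonic_hardy a b L Y "harmonic_index TYPE('d)" "\<lambda>k. {1..harmonic_dim TYPE('d) k}"
    by unfold_locales (use assms in auto)
  show ?thesis
    using HL2_complete HL2_hilbert HL2_maximum_principle HL2_smooth by blast
qed

end
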